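(* Let $\mathbf A\sim\mathrm{RDPG}(\mathbf X_0)$ with sparsity factor $\rho_n$, where $\mathbf X_0=[\mathbf x_{01},\ldots,\mathbf x_{0n}]^{\mathrm T}\in\mathcal X^n$. Assume $\sup_{\mathbf x\in\mathcal X}|F_n(\mathbf x)-F(\mathbf x)|\to0$ as $n\to\infty$, and that there is a constant $\delta>0$ independent of $n$ with $(\mathbf x_{0i})_{i=1}^n\subset\mathcal X(\delta)$. Let $\widehat{\mathbf X}=[\widehat{\mathbf x}_1,\ldots,\widehat{\mathbf x}_n]^{\mathrm T}$ be the one-step estimator initialized at an estimator $\widetilde{\mathbf X}=[\widetilde{\mathbf x}_1,\ldots,\widetilde{\mathbf x}_n]^{\mathrm T}$ satisfying the approximate linearization property with exponent $\omega\ge0$. For $\mathbf x\in\mathcal X(\delta)$ let $$\mathbf G_n(\mathbf x)=\frac1n\sum_{j=1}^n\frac{\mathbf x_{0j}\mathbf x_{0j}^{\mathrm T}}{\mathbf x^{\mathrm T}\mathbf x_{0j}(1-\rho_n\mathbf x^{\mathrm T}\mathbf x_{0j})}.$$ If either $\rho_n\equiv1$ for all $n$, or $\rho_n\to0$ but $(\log n)^{2(1\vee\omega)}/(n\rho_n^5)\to0$ as $n\to\infty$, then there exists a sequence of orthogonal matrices $\mathbf W=\mathbf W_n\in\mathbb O(d)$ such that for $i=1,\ldots,n$ $$\mathbf W^{\mathrm T}\widehat{\mathbf x}_i-\rho_n^{1/2}\mathbf x_{0i}=\frac1{n\sqrt{\rho_n}}\sum_{j=1}^n\frac{A_{ij}-\rho_n\mathbf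 x_{0i}^{\mathrm T}\mathbf x_{0j}}{\mathbf x_{0i}^{\mathrm T}\mathbf x_{0j}(1-\rho_n\mathbf x_{0i}^{\mathrm T}\mathbf x_{0j})}\mathbf G_n(\mathbf x_{0i})^{-1}\mathbf x_{0j}+\widehat{\mathbf R}_i,$$ where $\|\widehat{\mathbf R}_i\|=O_{\mathbb P_0}\big(n^{-1}\rho_n^{-5/2}(\log n)^{1\vee\omega}\big)$ and $\sum_{i=1}^n\|\widehat{\mathbf R}_i\|^2=O_{\mathbb P_0}\big((n\rho_n^5)^{-1}(\log n)^{2(1\vee\omega)}\big)$.
   Context: Setting: $d\ge1$ is fixed and $\mathcal X=\{\mathbf x=[x_1,\ldots,x_d]^{\mathrm T}\in\mathbb R^d: x_1,\ldots,x_d>0,\ \|\mathbf x\|<1\}$. $(\mathbf x_{0i})_{i\ge1}$ is a deterministic sequence in $\mathcal X$ and $\mathbf X_0=[\mathbf x_{01},\ldots,\mathbf x_{0n}]^{\mathrm T}\in\mathbb R^{n\times d}$; $\rho_n\in(0,1]$. $\mathbf A\sim\mathrm{RDPG}(\mathbf X_0)$ with sparsity factor $\rho_n$ means that $\mathbf A=[A_{ij}]$ is a random symmetric $n\times n$ $\{0,1\}$-matrix with zero diagonal and $A_{ij}\sim\mathrm{Bernoulli}(\rho_n\mathbf x_{0i}^{\mathrm T}\mathbf x_{0j})$ independently for $i<j$. $\mathbb P_0$ is the corresponding probability; $O_{\mathbb P_0},o_{\mathbb P_0}$ are stochastic orders as $n\to\infty$. $F$ is a probability distribution on $\mathcal X$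 (identified with its cumulative distribution function), $F_n(\mathbf x)=\frac1n\sum_{i=1}^n\mathbf 1\{\mathbf x_{0i}\le\mathbf x\}$ with $\le$ coordinatewise. The matrix $\boldsymbol\Delta=\int_{\mathcal X}\mathbf x\mathbf x^{\mathrm T}F(d\mathbf x)$ is assumed non-singular. For $\delta\in(0,1/2)$, $\mathcal X(\delta)$ is a compact convex subset of $\mathcal X$ with $\mathbf x^{\mathrm T}\mathbf u\in[\delta,1-\delta]$ for all $\mathbf x,\mathbf u\in\mathcal X(\delta)$. $\mathbb O(d)$ is the set of $d\times d$ orthogonal matrices; orthogonal alignment matrices depend on $n$ and may depend on $\mathbf A$. $a\vee b=\max(a,b)$; $a\lesssim b$ means $a\le Cb$ for a constant $C>0$. Approximate linearization property (exponent $\omega\ge0$): an estimator $\widetilde{\mathbf X}=[\widetilde{\mathbf x}_1,\ldots,\widetilde{\mathbf x}_n]^{\mathrm T}\in\mathbb R^{n\times d}$ (a function of $\mathbf A$) has this property if for all $n$ there exist $\mathbf W=\mathbf W_n\in\mathbb O(d)$ and an $n\times d$ matrix $\widetilde{\mathbf R}=[\widetilde{\mathbf R}_1,\ldots,\widetilde{\mathbf R}_n]^{\mathrm T}$ with $\|\widetilde{\mathbf R}\|_{\mathrm F}^2=O_{\mathbb P_0}((n\rho_n)^{-1}(\log n)^\omega)$ such that $$\mathbf W^{\mathrm T}\widetilde{\mathbf x}_i-\rho_n^{1/2}\mathbf x_{0i}=\rho_n^{-1/2}\sum_{j=1}^n(A_{ij}-\rho_n\mathbf x_{0i}^{\mathrm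 T}\mathbf x_{0j})\boldsymbol\zeta_{ij}+\widetilde{\mathbf R}_i,\quad i=1,\ldots,n,$$ where $\{\boldsymbol\zeta_{ij}:i,j\in[n]\}$ are deterministic vectors in $\mathbb R^d$ with $\sup_{i,j\in[n]}\|\boldsymbol\zeta_{ij}\|\lesssim1/n$. One-step estimator initialized at $\widetilde{\mathbf X}$: for $i=1,\ldots,n$, $$\widehat{\mathbf x}_i=\widetilde{\mathbf x}_i+\left\{\frac1n\sum_{j=1}^n\frac{\widetilde{\mathbf x}_j\widetilde{\mathbf x}_j^{\mathrm T}}{\widetilde{\mathbf x}_i^{\mathrm T}\widetilde{\mathbf x}_j(1-\widetilde{\mathbf x}_i^{\mathrm T}\widetilde{\mathbf x}_j)}\right\}^{-1}\left\{\frac1n\sum_{j=1}^n\frac{(A_{ij}-\widetilde{\mathbf x}_i^{\mathrm T}\widetilde{\mathbf x}_j)\widetilde{\mathbf x}_j}{\widetilde{\mathbf x}_i^{\mathrm T}\widetilde{\mathbf x}_j(1-\widetilde{\mathbf x}_i^{\mathrm T}\widetilde{\mathbf x}_j)}\right\}$$ (on the event that these expressions are well defined; arbitrary otherwise). *)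

theory Defs
  imports "HOL-Probability.Probability"
begin

definition latent_space :: "(real ^ 'd) set" where
  "latent_space = {x. (\<forall>k. 0 < x $ k) \<and> norm x < 1}"

definition outer_prod :: "real ^ 'd \<Rightarrow> real ^ 'd \<Rightarrow> real ^ 'd ^ 'd" where
  "outer_prod x y = (\<chi> a b. x $ a * y $ b)"

text \<open>
  Row indices range over \<open>{..<n}\<close>, so \<open>x0 0, x0 1, \<dots>\<close> are the latent positions
  \<open>x\<^sub>0\<^sub>1, x\<^sub>0\<^sub>2, \<dots>\<close>.  The order on \<^typ>\<open>real ^ 'd\<close> is the coordinatewise one.
\<close>

definition empirical_cdf :: "(nat \<Rightarrow> real ^ 'd) \<Rightarrow> nat \<Rightarrow> real ^ 'd \<Rightarrow> real" where
  "empirical_cdf x0 n x = (1 / real n) * (\<Sum>i<n. indicator {..x} (x0 i))"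

definition second_moment :: "(real ^ 'd) measure \<Rightarrow> real ^ 'd ^ 'd" where
  "second_moment F = set_lebesgue_integral F latent_space (\<lambda>x. outer_prod x x)"

text \<open>
  An \<open>n \<times> n\<close> matrix is a function of two indices that vanishes outside \<open>{..<n} \<times> {..<n}\<close>.
  Hence the adjacency matrix takes finitely many values, and an arbitrary function of it is
  a random variable.
\<close>

type_synonym adj = "nat \<Rightarrow> nat \<Rightarrow> real"

definition is_rdpg ::
    "'w measure \<Rightarrow> nat \<Rightarrow> real \<Rightarrow> (nat \<Rightarrow> real ^ 'd) \<Rightarrow> ('w \<Rightarrow> adj) \<Rightarrow> bool" where
  "is_rdpg M n r x0 A \<longleftrightarrow>
     prob_space M \<and>
     (\<forall>w\<in>space M. \<forall>i j.
        A w i j \<in> {0, 1} \<and> A w i j = A w j i \<and> A w i i = 0 \<and>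
        (\<not> (i < n \<and> j < n) \<longrightarrow> A w i j = 0)) \<and>
     prob_space.indep_vars M (\<lambda>_. borel) (\<lambda>(i, j) w. A w i j) {(i, j). i < j \<and> j < n} \<and>
     (\<forall>i j. i < j \<and> j < n \<longrightarrow>
        distr M (count_space UNIV) (\<lambda>w. A w i j = 1)
          = measure_pmf (bernoulli_pmf (r * (x0 i \<bullet> x0 j))))"

definition bounded_in_prob ::
    "(nat \<Rightarrow> 'w measure) \<Rightarrow> (nat \<Rightarrow> 'w \<Rightarrow> real) \<Rightarrow> (nat \<Rightarrow> real) \<Rightarrow> bool" where
  "bounded_in_prob M Z a \<longleftrightarrow>
     (\<forall>\<epsilon>>0. \<exists>C>0. \<forall>\<^sub>F n in sequentially.
        measure (M n) {w \<in> space (M n). \<bar>Z n w\<bar> > C * a n} \<le> \<epsilon>)"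

text \<open>
  For a triangular array \<open>Z n w i\<close>, \<open>i < n\<close>: every row index separately is of stochastic order
  \<open>a n\<close>, with constants that do not depend on the index.  The maximum over \<open>i\<close> is outside the
  probability.
\<close>

definition bounded_in_prob_rows ::
    "(nat \<Rightarrow> 'w measure) \<Rightarrow> (nat \<Rightarrow> 'w \<Rightarrow> nat \<Rightarrow> real) \<Rightarrow> (nat \<Rightarrow> real) \<Rightarrow> bool" where
  "bounded_in_prob_rows M Z a \<longleftrightarrow>
     (\<forall>\<epsilon>>0. \<exists>C>0. \<forall>\<^sub>F n in sequentially. \<forall>i<n.
        measure (M n) {w \<in> space (M n). \<bar>Z n w i\<bar> > C * a n} \<le> \<epsilon>)"

text \<open>
  An estimator is, for each \<open>n\<close>, a function of the adjacency matrix; its \<open>i\<close>-th row is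
  \<open>Xt n B i\<close>.  The alignment matrix and the remainder may depend on the adjacency matrix,
  whereas \<open>\<zeta>\<close> is deterministic.
\<close>

definition approx_linearization ::
    "(nat \<Rightarrow> 'w measure) \<Rightarrow> (nat \<Rightarrow> 'w \<Rightarrow> adj) \<Rightarrow> (nat \<Rightarrow> real) \<Rightarrow> (nat \<Rightarrow> real ^ 'd) \<Rightarrow> real
      \<Rightarrow> (nat \<Rightarrow> adj \<Rightarrow> nat \<Rightarrow> real ^ 'd) \<Rightarrow> bool" where
  "approx_linearization M A \<rho> x0 \<omega> Xt \<longleftrightarrow>
     (\<exists>(W :: nat \<Rightarrow> adj \<Rightarrow> real ^ 'd ^ 'd) (R :: nat \<Rightarrow> adj \<Rightarrow> nat \<Rightarrow> real ^ 'd)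
       (\<zeta> :: nat \<Rightarrow> nat \<Rightarrow> nat \<Rightarrow> real ^ 'd).
        (\<forall>n B. orthogonal_matrix (W n B)) \<and>
        (\<exists>C>0. \<forall>n. \<forall>i<n. \<forall>j<n. norm (\<zeta> n i j) \<le> C / real n) \<and>
        (\<forall>n. \<forall>w\<in>space (M n). \<forall>i<n.
           transpose (W n (A n w)) *v Xt n (A n w) i - sqrt (\<rho> n) *\<^sub>R x0 i
             = (1 / sqrt (\<rho> n)) *\<^sub>R (\<Sum>j<n. (A n w i j - \<rho> n * (x0 i \<bullet> x0 j)) *\<^sub>R \<zeta> n i j)
               + R n (A n w) i) \<and>
        bounded_in_prob M (\<lambda>n w. \<Sum>i<n. (norm (R n (A n w) i))\<^sup>2)
          (\<lambda>n. (1 / (real n * \<rho> n)) * ln (real n) powr \<omega>))"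

definition one_step_info :: "nat \<Rightarrow> (nat \<Rightarrow> real ^ 'd) \<Rightarrow> nat \<Rightarrow> real ^ 'd ^ 'd" where
  "one_step_info n X i =
     (1 / real n) *\<^sub>R
       (\<Sum>j<n. (1 / ((X i \<bullet> X j) * (1 - X i \<bullet> X j))) *\<^sub>R outer_prod (X j) (X j))"

definition one_step_score :: "nat \<Rightarrow> adj \<Rightarrow> (nat \<Rightarrow> real ^ 'd) \<Rightarrow> nat \<Rightarrow> real ^ 'd" where
  "one_step_score n B X i =
     (1 / real n) *\<^sub>R
       (\<Sum>j<n. ((B i j - X i \<bullet> X j) / ((X i \<bullet> X j) * (1 - X i \<bullet> X j))) *\<^sub>R X j)"

definition one_step_defined :: "nat \<Rightarrow> (nat \<Rightarrow> real ^ 'd) \<Rightarrow> nat \<Rightarrow> bool" where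
  "one_step_defined n X i \<longleftrightarrow>
     (\<forall>j<n. (X i \<bullet> X j) * (1 - X i \<bullet> X j) \<noteq> 0) \<and> invertible (one_step_info n X i)"

text \<open>
  A row whose defining expression is meaningless is left unconstrained.
\<close>

definition is_one_step ::
    "nat \<Rightarrow> adj \<Rightarrow> (nat \<Rightarrow> real ^ 'd) \<Rightarrow> (nat \<Rightarrow> real ^ 'd) \<Rightarrow> bool" where
  "is_one_step n B X Xh \<longleftrightarrow>
     (\<forall>i<n. one_step_defined n X i \<longrightarrow>
        Xh i = X i + matrix_inv (one_step_info n X i) *v one_step_score n B X i)"

definition G_mat :: "(nat \<Rightarrow> real ^ 'd) \<Rightarrow> real \<Rightarrow> nat \<Rightarrow> real ^ 'd \<Rightarrow> real ^ 'd ^ 'd" where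
  "G_mat x0 r n x =
     (1 / real n) *\<^sub>R
       (\<Sum>j<n. (1 / ((x \<bullet> x0 j) * (1 - r * (x \<bullet> x0 j)))) *\<^sub>R outer_prod (x0 j) (x0 j))"

end

theory Submission
  imports Defs
begin

text \<open>
  Write \<open>u\<^sub>i = \<rho>\<^sup>-\<^sup>1\<^sup>/\<^sup>2 W\<^sup>T x~\<^sub>i = x\<^sub>0\<^sub>i + f\<^sub>i\<close>, where the linearization makes all \<open>f\<^sub>i\<close> of order
  \<open>(L / (n \<rho>\<^sup>2))\<^sup>1\<^sup>/\<^sup>2\<close> with \<open>L = (log n)\<^bsup>max 1 \<omega>\<^esup>\<close>.  Since \<open>u\<^sub>i \<bullet> u\<^sub>j - u\<^sub>j \<bullet> f\<^sub>i = x\<^sub>0\<^sub>i \<bullet> u\<^sub>j\<close>, the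
  error of the Newton step is \<open>\<rho> f\<^sub>i + I\<^sub>i\<^sup>-\<^sup>1 T\<^sub>i - G\<^sub>n\<^sup>-\<^sup>1 T\<^sub>i\<^sup>0\<close> in which \<open>f\<^sub>i\<close> itself cancels to first
  order; up to terms quadratic in \<open>f\<close> there remain sums linear in the other \<open>f\<^sub>j\<close> and products of
  \<open>f\<^sub>i\<close> with row sums of the noise.  Row sums are bounded uniformly by Hoeffding's inequality.
  Inserting the linearization of \<open>f\<^sub>j\<close> turns the linear sums into a quadratic form in the noise,
  whose summands are essentially orthogonal, so its second moment is bounded; this is the only term that
  is controlled row by row and not uniformly.  Invertibility of the information matrices comes
  from convergence of the empirical measure on small half-open boxes, together with compactness of the
  unit sphere.
\<close>

section \<open>Coercivity of the empirical second moment\<close>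

text \<open>The obstacle is the linear sum over the \<open>f j\<close>: estimated by the uniform
  size \<open>s\<close> of the \<open>f j\<close> it has order \<open>s\<close>, whereas the target
  is \<open>s\<^sup>2\<close>. Conditioning on row \<open>i\<close> gives no independence, since
  \<open>f j\<close> contains the noise entry of the pair \<open>(i, j)\<close> itself. The gain
  comes from the deterministic weights \<zeta> of the linearization: they turn the sum into a
  quadratic form \<open>Q\<close> with deterministic weights of order \<open>1 / n\<close>, whose
  second moment is bounded by a constant, and it enters as \<open>Q / (n * r)\<close> with
  \<open>1 / (n * r) \<le> s\<^sup>2\<close>. The linearization remainder is known only in Frobenius
  norm. It also enters this sum as an average, where Cauchy-Schwarz gains the missing factor
  \<open>n\<close> to the power -1/2, again at most \<open>s\<close>. The stated rate is
  \<open>s\<^sup>2 / sqrt r\<close>: the analysis is done for errors multiplied by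
  \<open>sqrt r\<close>, and this factor is divided out at the end. Boxes are half-open because
  convergence is given for lower orthants only, and exactly such boxes are signed sums of
  orthants.\<close>

definition hbox :: "real ^ 'd \<Rightarrow> real ^ 'd \<Rightarrow> (real ^ 'd) set" where
  "hbox a b = {y. \<forall>k. a $ k < y $ k \<and> y $ k \<le> b $ k}"

definition corner :: "real ^ 'd \<Rightarrow> real ^ 'd \<Rightarrow> 'd set \<Rightarrow> real ^ 'd" where
  "corner a b S = (\<chi> k. if k \<in> S then a $ k else b $ k)"

text \<open>Inclusion-exclusion: each coordinate contributes a difference of two orthant indicators,
  and expanding the product over the coordinates produces one orthant per vertex. The order of
  \<open>a\<close> and \<open>b\<close> keeps every factor in {0, 1}.\<close>

lemma indicator_hbox:
  fixes a b y :: "real ^ 'd"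
  assumes "\<And>k. a $ k \<le> b $ k"
  shows "indicator (hbox a b) y
    = (\<Sum>S\<in>UNIV. (-1) ^ card S * (indicator {..corner a b S} y :: real))"
proof -
  have "indicator (hbox a b) y
      = (\<Prod>k\<in>UNIV. of_bool (y $ k \<le> b $ k) - of_bool (y $ k \<le> a $ k) :: real)"
  proof (cases "y \<in> hbox a b")
    case True
    then have "(\<Prod>k\<in>UNIV. of_bool (y $ k \<le> b $ k) - of_bool (y $ k \<le> a $ k) :: real) = (\<Prod>k\<in>(UNIV::'d set). 1)"
      by (intro prod.cong) (auto simp: hbox_def not_le)
    then show ?thesis using True by simp
  next
    case False
    then obtain k where "\<not> (a $ k < y $ k \<and> y $ k \<le> b $ k)" by (auto simp: hbox_def)
    then have "of_bool (y $ k \<le> b $ k) - of_bool (y $ k \<le> a $ k) = (0::real)"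
      using assms[of k] by auto
    then have "(\<Prod>k\<in>UNIV. of_bool (y $ k \<le> b $ k) - of_bool (y $ k \<le> a $ k) :: real) = 0"
      by (intro prod_zero bexI[of _ k]) auto
    then show ?thesis using False by simp
  qed
  also have "\<dots> = (\<Sum>S\<in>Pow UNIV. (-1) ^ card S * (\<Prod>k\<in>S. of_bool (y $ k \<le> a $ k))
                      * (\<Prod>k\<in>UNIV - S. of_bool (y $ k \<le> b $ k)))"
    by (rule prod_diff_conv_sum) simp
  also have "\<dots> = (\<Sum>S\<in>UNIV. (-1) ^ card S * indicator {..corner a b S} y)"
  proof (rule sum.cong)
    fix S :: "'d set"
    have prod_bool: "(\<Prod>k\<in>T. of_bool (P k)) = (of_bool (\<forall>k\<in>T. P k) :: real)" for T :: "'d set" and P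
      by (rule finite_induct[OF finite[of T]]) auto
    have "(\<Prod>k\<in>S. of_bool (y $ k \<le> a $ k)) * (\<Prod>k\<in>UNIV - S. of_bool (y $ k \<le> b $ k))
        = (indicator {..corner a b S} y :: real)"
      by (simp add: prod_bool indicator_def corner_def less_eq_vec_def flip: of_bool_conj) auto
    then show "(-1) ^ card S * (\<Prod>k\<in>S. of_bool (y $ k \<le> a $ k)) * (\<Prod>k\<in>UNIV - S. of_bool (y $ k \<le> b $ k))
      = (-1) ^ card S * (indicator {..corner a b S} y :: real)" by (simp add: mult.assoc)
  qed simp
  finally show ?thesis .
qed

text \<open>The supremum in the convergence hypothesis runs over \<open>latent_space\<close>, so
  every vertex used in the inclusion-exclusion must lie there. Positive coordinates make a mixed
  vertex no longer than \<open>b\<close>.\<close>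

lemma latent_space_corner:
  assumes "a \<in> latent_space" "b \<in> latent_space" "\<And>k. a $ k \<le> b $ k"
  shows "corner a b S \<in> latent_space"
proof -
  have "norm (corner a b S) \<le> norm b"
  proof (rule norm_le_componentwise_cart)
    fix k
    have "0 < a $ k" "0 < b $ k" using assms by (auto simp: latent_space_def)
    then show "norm (corner a b S $ k) \<le> norm (b $ k)"
      using assms(3)[of k] by (auto simp: corner_def)
  qed
  then show ?thesis using assms by (auto simp: latent_space_def corner_def)
qed

lemma measurable_component_cart [measurable]: "(\<lambda>x::real^'d. x $ k) \<in> borel_measurable borel"
  by (intro borel_measurable_continuous_onI continuous_intros)

lemma sets_hbox [measurable]: "hbox a b \<in> sets borel"
proof -
  have "hbox a b = {y \<in> space borel. \<forall>k\<in>UNIV. a $ k < y $ k \<and> y $ k \<le> b $ k}"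
    by (auto simp: hbox_def)
  also have "\<dots> \<in> sets borel" by measurable
  finally show ?thesis .
qed

lemma sets_atMost_cart [measurable]: "{..b::real^'d} \<in> sets borel"
proof -
  have "{..b} = {y \<in> space borel. \<forall>k\<in>UNIV. y $ k \<le> b $ k}"
    by (auto simp: less_eq_vec_def)
  also have "\<dots> \<in> sets borel" by measurable
  finally show ?thesis .
qed

lemma empirical_cdf_tendsto:
  assumes conv: "(\<lambda>n. SUP x\<in>latent_space. \<bar>empirical_cdf x0 n x - measure F {..x}\<bar>) \<longlonglongrightarrow> 0"
    and F: "prob_space F" and x: "x \<in> latent_space"
  shows "(\<lambda>n. empirical_cdf x0 n x) \<longlonglongrightarrow> measure F {..x}"
proof -
  interpret prob_space F by fact
  have e01: "0 \<le> empirical_cdf x0 n y \<and> empirical_cdf x0 n y \<le> 1" for n y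
  proof -
    have "(\<Sum>i<n. indicator {..y} (x0 i)) \<le> (\<Sum>i<n. 1::real)"
      by (intro sum_mono) (auto simp: indicator_def)
    moreover have "0 \<le> (\<Sum>i<n. indicator {..y} (x0 i) :: real)"
      by (intro sum_nonneg) auto
    ultimately show ?thesis unfolding empirical_cdf_def
      by (cases "n = 0") (auto simp: divide_simps)
  qed
  \<comment> \<open>A real \<open>SUP\<close> dominates its members only over a bounded family; the
    bound 1 supplies this.\<close>
  have "\<bar>empirical_cdf x0 n y - measure F {..y}\<bar> \<le> 1" for n y
    using e01[of n y] prob_le_1[of "{..y}"] measure_nonneg[of F "{..y}"] by linarith
  then have "\<bar>empirical_cdf x0 n x - measure F {..x}\<bar>
      \<le> (SUP x\<in>latent_space. \<bar>empirical_cdf x0 n x - measure F {..x}\<bar>)" for n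
    by (intro cSUP_upper x bdd_aboveI2[where M=1]) auto
  then have "(\<lambda>n. empirical_cdf x0 n x - measure F {..x}) \<longlonglongrightarrow> 0"
    by (intro Lim_null_comparison[OF _ conv] always_eventually) auto
  then show ?thesis by (rule LIM_zero_cancel)
qed

lemma empirical_hbox_tendsto:
  assumes conv: "(\<lambda>n. SUP x\<in>latent_space. \<bar>empirical_cdf x0 n x - measure F {..x}\<bar>) \<longlonglongrightarrow> 0"
    and F: "prob_space F" "sets F = sets borel"
    and ab: "a \<in> latent_space" "b \<in> latent_space" "\<And>k. a $ k \<le> b $ k"
  shows "(\<lambda>n. (1 / real n) * (\<Sum>i<n. indicator (hbox a b) (x0 i))) \<longlonglongrightarrow> measure F (hbox a b)"
proof -
  interpret prob_space F by fact
  have [measurable_cong]: "sets F = sets borel" by fact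
  have *: "integrable F (\<lambda>x. (-1) ^ card S * indicator {..corner a b S} x :: real)" for S
    by (intro integrable_mult_right integrable_real_indicator) (auto simp: F emeasure_eq_measure)
  have "measure F (hbox a b) = (\<integral>x. indicator (hbox a b) x \<partial>F)"
    by (simp add: F sets_eq_imp_space_eq[OF F(2)])
  also have "\<dots> = (\<Sum>S\<in>UNIV. \<integral>x. (-1) ^ card S * indicator {..corner a b S} x \<partial>F)"
    by (subst indicator_hbox[OF ab(3)], subst Bochner_Integration.integral_sum[OF *]) auto
  also have "\<dots> = (\<Sum>S\<in>UNIV. (-1) ^ card S * measure F {..corner a b S})"
    by (simp add: F sets_eq_imp_space_eq[OF F(2)])
  finally have 1: "measure F (hbox a b) = (\<Sum>S\<in>UNIV. (-1) ^ card S * measure F {..corner a b S})" .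
  have 2: "(1 / real n) * (\<Sum>i<n. indicator (hbox a b) (x0 i))
     = (\<Sum>S\<in>UNIV. (-1) ^ card S * empirical_cdf x0 n (corner a b S))" for n
    unfolding empirical_cdf_def indicator_hbox[OF ab(3)] sum_distrib_left
    by (subst sum.swap) (simp add: mult_ac)
  show ?thesis unfolding 1 2
    by (intro tendsto_intros empirical_cdf_tendsto[OF conv F(1)] latent_space_corner ab)
qed

text \<open>Otherwise \<open>F\<close> is carried by the hyperplane orthogonal to \<open>v\<close>,
  and \<open>second_moment F *v v\<close>, the mean of \<open>(v \<bullet> x) *\<^sub>R x\<close>,
  vanishes.\<close>

lemma second_moment_nondegenerate:
  assumes F: "prob_space F" "sets F = sets borel" "measure F latent_space = 1"
    and D: "invertible (second_moment F)" and v: "v \<noteq> 0"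
  shows "measure F {x \<in> latent_space. v \<bullet> x \<noteq> 0} > 0"
proof (rule ccontr)
  interpret prob_space F by fact
  have [measurable_cong]: "sets F = sets borel" by fact
  let ?O = "{x \<in> latent_space. v \<bullet> x \<noteq> 0}"
  assume "\<not> measure F ?O > 0"
  then have 0: "measure F ?O = 0" using measure_nonneg[of F ?O] by linarith
  have L: "latent_space = {x \<in> space borel. (\<forall>k\<in>UNIV. 0 < x $ k) \<and> norm x < 1}"
    unfolding latent_space_def by simp
  have Lm[measurable]: "latent_space \<in> sets borel" unfolding L by measurable
  have Om: "?O \<in> sets F" unfolding F by measurable
  have sp: "space F = UNIV" using sets_eq_imp_space_eq[OF F(2)] by simp
  have "?O \<in> null_sets F" using Om 0 by (auto simp: null_sets_def emeasure_eq_measure)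
  then have AE: "AE x in F. x \<notin> ?O" by (rule AE_not_in)
  \<comment> \<open>Integrability follows from invertibility: a non-integrable function has Bochner
    integral 0, and then \<open>second_moment F\<close> would be the zero matrix.\<close>
  have int: "set_integrable F latent_space (\<lambda>x. outer_prod x x)"
  proof (rule ccontr)
    assume "\<not> ?thesis"
    then have "second_moment F = 0"
      by (simp add: second_moment_def set_lebesgue_integral_def set_integrable_def not_integrable_integral_eq)
    then have "second_moment F *v v = 0" by (simp add: matrix_vector_mult_def vec_eq_iff)
    with D v show False by (metis matrix_vector_mult_0_right invertible_def matrix_vector_mul_assoc matrix_vector_mul_lid)
  qed
  have bl: "bounded_linear (\<lambda>B :: real^'a^'a. B *v v)"
    by (intro linear_conv_bounded_linear[THEN iffD1] linearI)
       (auto simp: matrix_vector_mult_add_rdistrib scaleR_matrix_vector_assoc)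
  have "second_moment F *v v = (\<integral>x. (indicator latent_space x *\<^sub>R outer_prod x x) *v v \<partial>F)"
    unfolding second_moment_def set_lebesgue_integral_def
    by (rule integral_bounded_linear[OF bl, symmetric]) (use int in \<open>simp add: set_integrable_def\<close>)
  also have "\<dots> = (\<integral>x. 0 \<partial>F)"
  proof (intro integral_cong_AE)
    have "outer_prod x x *v v = (v \<bullet> x) *\<^sub>R x" for x :: "real^'a"
      by (simp add: vec_eq_iff matrix_vector_mult_def outer_prod_def inner_vec_def sum_distrib_left sum_distrib_right mult_ac)
    then show "AE x in F. (indicator latent_space x *\<^sub>R outer_prod x x) *v v = 0"
      by (intro eventually_mono[OF AE]) (auto simp: indicator_def)
    show "(\<lambda>x. (indicat_real latent_space x *\<^sub>R outer_prod x x) *v v) \<in> borel_measurable F"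
      using integrable_bounded_linear[OF bl int[unfolded set_integrable_def]]
      by (rule borel_measurable_integrable)
  qed auto
  finally have "second_moment F *v v = 0" by simp
  with D v show False by (metis matrix_vector_mult_0_right invertible_def matrix_vector_mul_assoc matrix_vector_mul_lid)
qed

text \<open>The open set where \<open>v \<bullet> x\<close> does not vanish has positive mass, and
  countably many boxes exhaust it, so one of them has positive mass. On its compact closure
  \<open>\<bar>v \<bullet> x\<bar>\<close> has a positive minimum, and the empirical mass of the
  half-open box eventually exceeds half of its limit. Allowing \<open>w\<close> in a ball prepares
  the compactness argument.\<close>

lemma gram_lower_bound_near:
  assumes F: "prob_space F" "sets F = sets borel" "measure F latent_space = 1"
    and D: "invertible (second_moment F)"
    and conv: "(\<lambda>n. SUP x\<in>latent_space. \<bar>empirical_cdf x0 n x - measure F {..x}\<bar>) \<longlonglongrightarrow> 0"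
    and x0: "\<And>i. x0 i \<in> latent_space"
    and v: "v \<noteq> 0"
  shows "\<exists>e>0. \<exists>c>0. \<forall>\<^sub>F n in sequentially. \<forall>w\<in>ball v e. c \<le> (1 / real n) * (\<Sum>j<n. (w \<bullet> x0 j)\<^sup>2)"
proof -
  interpret prob_space F by fact
  let ?O = "{x \<in> latent_space. v \<bullet> x \<noteq> 0}"
  \<comment> \<open>The closed box is required inside \<open>?O\<close>: the minimum is taken on it,
    and it contains the corners \<open>a\<close> and \<open>b\<close>, which must belong to
    \<open>latent_space\<close>. Nonemptiness of the open box gives
    \<open>a $ k < b $ k\<close>.\<close>
  define U where "U = {box a b |a b. box a b \<noteq> {} \<and> cbox a b \<subseteq> ?O}"
  have "open ?O"
  proof -
    have "?O = (\<Inter>k\<in>UNIV. {x. 0 < x $ k}) \<inter> {x. norm x < 1} \<inter> {x. v \<bullet> x \<noteq> 0}"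
      by (auto simp: latent_space_def)
    also have "open \<dots>"
      by (intro open_Int open_INT open_Collect_less open_Collect_neq continuous_intros ballI) auto
    finally show ?thesis .
  qed
  have U: "\<Union>U = ?O"
  proof
    show "\<Union>U \<subseteq> ?O" using box_subset_cbox unfolding U_def by blast
    show "?O \<subseteq> \<Union>U"
    proof
      fix x assume "x \<in> ?O"
      with \<open>open ?O\<close> obtain e where e: "e > 0" "ball x e \<subseteq> ?O" by (meson openE)
      then obtain a b where ab: "x \<in> box a b" "box a b \<subseteq> ball x (e / 2)"
        using rational_boxes[of "e/2" x] by auto
      have "cbox a b = closure (box a b)" using ab(1) by (intro closure_box[symmetric]) auto
      also have "\<dots> \<subseteq> cball x (e / 2)" using ab(2) by (intro closure_minimal) auto
      also have "\<dots> \<subseteq> ball x e" using e(1) by auto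
      finally show "x \<in> \<Union>U" using ab(1) e(2) unfolding U_def by blast
    qed
  qed
  obtain U' where U': "U' \<subseteq> U" "countable U'" "\<Union>U' = \<Union>U"
    by (rule Lindelof[of U]) (auto simp: U_def)
  have "\<exists>B\<in>U'. measure F B > 0"
  proof (rule ccontr)
    assume "\<not> ?thesis"
    then have "measure F B = 0" if "B \<in> U'" for B
      using that measure_nonneg[of F B] by (auto simp: less_le)
    moreover have "B \<in> sets F" if "B \<in> U'" for B using that U' unfolding F U_def by auto
    ultimately have "\<Union>U' \<in> null_sets F"
      using U' by (intro null_sets_UN'[of U' "\<lambda>x. x", simplified]) (auto simp: null_sets_def emeasure_eq_measure)
    then have "measure F ?O = 0" using U U' by (auto simp: null_sets_def measure_def)
    with second_moment_nondegenerate[OF F D v] show False by simp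
  qed
  then obtain B where B: "B \<in> U" "measure F B > 0" using U'(1) by blast
  then obtain a b where pos: "measure F (box a b) > 0" and ne: "box a b \<noteq> {}" and sub: "cbox a b \<subseteq> ?O"
    unfolding U_def by blast
  have lt: "a $ k < b $ k" for k
  proof -
    have "axis k 1 \<in> (Basis :: (real^'a) set)" by (simp add: axis_in_Basis_iff)
    with ne have "a \<bullet> axis k 1 < b \<bullet> axis k 1" unfolding box_ne_empty by blast
    then show ?thesis by (simp add: inner_axis)
  qed
  have h: "hbox a b \<subseteq> cbox a b" "box a b \<subseteq> hbox a b"
    by (auto simp: hbox_def mem_box_cart less_imp_le)
  have "a \<in> cbox a b" "b \<in> cbox a b" using lt by (auto simp: mem_box_cart less_imp_le)
  then have ab: "a \<in> latent_space" "b \<in> latent_space" using sub by auto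
  have "measure F (box a b) \<le> measure F (hbox a b)"
    using h by (intro finite_measure_mono) (auto simp: F)
  with pos have p: "measure F (hbox a b) > 0" by simp
  have "continuous_on (cbox a b) (\<lambda>y. \<bar>v \<bullet> y\<bar>)" by (intro continuous_intros)
  then obtain y where y: "y \<in> cbox a b" "\<And>z. z \<in> cbox a b \<Longrightarrow> \<bar>v \<bullet> y\<bar> \<le> \<bar>v \<bullet> z\<bar>"
    using continuous_attains_inf[of "cbox a b" "\<lambda>y. \<bar>v \<bullet> y\<bar>"] \<open>a \<in> cbox a b\<close> by auto
  \<comment> \<open>Half of the minimum: all points have norm below 1, so replacing \<open>v\<close>
    by \<open>w\<close> within distance \<open>e\<close> changes the inner product by at most
    \<open>e\<close> and leaves at least \<open>e\<close>.\<close>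
  define e where "e = \<bar>v \<bullet> y\<bar> / 2"
  have e: "e > 0" using y(1) sub by (auto simp: e_def)
  define p where "p = measure F (hbox a b)"
  have bound: "e\<^sup>2 * indicator (hbox a b) (x0 j) \<le> (w \<bullet> x0 j)\<^sup>2" if "w \<in> ball v e" for w j
  proof (cases "x0 j \<in> hbox a b")
    case True
    then have 1: "2 * e \<le> \<bar>v \<bullet> x0 j\<bar>" using y(2) h by (auto simp: e_def)
    have "\<bar>(v - w) \<bullet> x0 j\<bar> \<le> norm (v - w) * norm (x0 j)" by (rule Cauchy_Schwarz_ineq2)
    also have "\<dots> \<le> e * 1"
      using that x0[of j] e by (intro mult_mono) (auto simp: dist_norm latent_space_def)
    finally have "e \<le> \<bar>w \<bullet> x0 j\<bar>" using 1 by (auto simp: inner_diff_left)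
    then have "e\<^sup>2 \<le> \<bar>w \<bullet> x0 j\<bar>\<^sup>2" using e by (intro power_mono) auto
    with True show ?thesis by simp
  qed auto
  have "\<forall>\<^sub>F n in sequentially. p / 2 < (1 / real n) * (\<Sum>i<n. indicator (hbox a b) (x0 i))"
    by (intro order_tendstoD(1)[OF empirical_hbox_tendsto[OF conv F(1,2) ab]]) (use lt p in \<open>auto simp: p_def less_imp_le\<close>)
  then have "\<forall>\<^sub>F n in sequentially. \<forall>w\<in>ball v e. e\<^sup>2 * (p / 2) \<le> (1 / real n) * (\<Sum>j<n. (w \<bullet> x0 j)\<^sup>2)"
  proof (rule eventually_mono, intro ballI)
    fix n w assume n: "p / 2 < (1 / real n) * (\<Sum>i<n. indicator (hbox a b) (x0 i))" and w: "w \<in> ball v e"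
    have "e\<^sup>2 * (p / 2) \<le> e\<^sup>2 * ((1 / real n) * (\<Sum>i<n. indicator (hbox a b) (x0 i)))"
      using n by (intro mult_left_mono) auto
    also have "\<dots> = (1 / real n) * (\<Sum>i<n. e\<^sup>2 * indicator (hbox a b) (x0 i))"
      unfolding sum_distrib_left by (simp only: mult_ac)
    also have "\<dots> \<le> (1 / real n) * (\<Sum>j<n. (w \<bullet> x0 j)\<^sup>2)"
      using bound[OF w] by (intro mult_left_mono sum_mono) auto
    finally show "e\<^sup>2 * (p / 2) \<le> (1 / real n) * (\<Sum>j<n. (w \<bullet> x0 j)\<^sup>2)" .
  qed
  moreover have "e\<^sup>2 * (p / 2) > 0" using e p by (simp add: p_def)
  ultimately show ?thesis using e by blast
qed

text \<open>The thresholds for \<open>n\<close> in the local bounds depend on the direction.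
  Finitely many balls cover the unit sphere, so finitely many thresholds and constants combine;
  homogeneity of degree two covers the remaining vectors.\<close>

lemma gram_coercive:
  assumes F: "prob_space F" "sets F = sets borel" "measure F latent_space = 1"
    and D: "invertible (second_moment F)"
    and conv: "(\<lambda>n. SUP x\<in>latent_space. \<bar>empirical_cdf x0 n x - measure F {..x}\<bar>) \<longlonglongrightarrow> 0"
    and x0: "\<And>i. x0 i \<in> (latent_space :: (real ^ 'd) set)"
  shows "\<exists>c>0. \<forall>\<^sub>F n in sequentially. \<forall>v. c * (norm v)\<^sup>2 \<le> (1 / real n) * (\<Sum>j<n. (v \<bullet> x0 j)\<^sup>2)"
proof -
  let ?S = "sphere (0::real^'d) 1"
  let ?q = "\<lambda>n v. (1 / real n) * (\<Sum>j<n. (v \<bullet> x0 j)\<^sup>2)"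
  have "\<exists>e c. e > 0 \<and> c > 0 \<and> (\<forall>\<^sub>F n in sequentially. \<forall>w\<in>ball v e. c \<le> ?q n w)" if "v \<in> ?S" for v
    using gram_lower_bound_near[OF F D conv x0, of v] that by fastforce
  then have "\<exists>f. \<forall>v\<in>?S. fst (f v) > 0 \<and> snd (f v) > 0 \<and> (\<forall>\<^sub>F n in sequentially. \<forall>w\<in>ball v (fst (f v)). snd (f v) \<le> ?q n w)"
    by (intro bchoice) auto
  then obtain f where f: "\<forall>v\<in>?S. fst (f v) > 0 \<and> snd (f v) > 0 \<and> (\<forall>\<^sub>F n in sequentially. \<forall>w\<in>ball v (fst (f v)). snd (f v) \<le> ?q n w)"
    by (elim exE)
  define e c where "e v = fst (f v)" and "c v = snd (f v)" for v
  have ec: "\<And>v. v \<in> ?S \<Longrightarrow> e v > 0 \<and> c v > 0 \<and> (\<forall>\<^sub>F n in sequentially. \<forall>w\<in>ball v (e v). c v \<le> ?q n w)"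
    using f unfolding e_def c_def by (rule bspec)
  have cov: "?S \<subseteq> (\<Union>v\<in>?S. ball v (e v))" using ec by force
  obtain T where T: "T \<subseteq> ?S" "finite T" "?S \<subseteq> (\<Union>v\<in>T. ball v (e v))"
    by (rule compactE_image[OF compact_sphere open_ball cov])
  \<comment> \<open>A point of the sphere, so that the subcover is nonempty and \<open>Min\<close>
    in \<open>c0\<close> is meaningful.\<close>
  have "vec 1 /\<^sub>R norm (vec 1 :: real^'d) \<in> ?S"
    by (simp add: vec_eq_iff)
  then have "T \<noteq> {}" using T by auto
  define c0 where "c0 = Min (c ` T)"
  have c0: "c0 > 0" using T ec \<open>T \<noteq> {}\<close> by (auto simp: c0_def subset_iff)
  have "\<forall>\<^sub>F n in sequentially. \<forall>v\<in>T. \<forall>w\<in>ball v (e v). c v \<le> ?q n w"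
    using T ec by (intro eventually_ball_finite) auto
  then have "\<forall>\<^sub>F n in sequentially. \<forall>v. c0 * (norm v)\<^sup>2 \<le> ?q n v"
  proof (rule eventually_mono, intro allI)
    fix n and v :: "real^'d"
    assume n: "\<forall>v\<in>T. \<forall>w\<in>ball v (e v). c v \<le> ?q n w"
    show "c0 * (norm v)\<^sup>2 \<le> ?q n v"
    proof (cases "v = 0")
      case False
      then have "v /\<^sub>R norm v \<in> ?S" by simp
      then obtain u where u: "u \<in> T" "v /\<^sub>R norm v \<in> ball u (e u)" using T(3) by blast
      have "c0 \<le> c u" using u T by (auto simp: c0_def)
      also have "\<dots> \<le> ?q n (v /\<^sub>R norm v)" using n u by blast
      also have "\<dots> = ?q n v / (norm v)\<^sup>2"
        by (simp add: power_mult_distrib power_inverse divide_inverse mult_ac flip: sum_distrib_left)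
      finally have "c0 \<le> ?q n v / (norm v)\<^sup>2" .
      then show ?thesis using False by (subst (asm) pos_le_divide_eq) auto
    qed auto
  qed
  then show ?thesis using c0 by blast
qed

section \<open>Deterministic analysis of the Newton step\<close>

text \<open>Up to a factor \<open>r\<close>, \<open>phi r t\<close> is the inverse variance of a Bernoulli variable with mean \<open>r t\<close>; \<open>dphi r\<close> is the derivative of \<open>phi r\<close>.\<close>

definition phi :: "real \<Rightarrow> real \<Rightarrow> real" where
  "phi r t = 1 / (t * (1 - r * t))"

definition dphi :: "real \<Rightarrow> real \<Rightarrow> real" where
  "dphi r t = - (1 - 2 * r * t) * (phi r t)\<^sup>2"

text \<open>The bounds are uniform in the sparsity \<open>r\<close>: since \<open>r \<le> 1\<close>,
  also \<open>r * t \<le> 1 - d\<close>, and both factors of the denominator lie between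
  \<open>d\<close> and 1.\<close>

lemma phi_bounds:
  assumes r: "0 \<le> r" "r \<le> 1" and d: "0 < d" and t: "t \<in> {d..1 - d}"
  shows "1 \<le> phi r t" "phi r t \<le> 1 / d\<^sup>2" "t * (1 - r * t) * phi r t = 1"
proof -
  have td: "d \<le> t" "t \<le> 1 - d" using t by auto
  have "r * t \<le> t" "0 \<le> r * t" using mult_right_mono[of r 1 t] r td d by auto
  with td have 1: "d \<le> 1 - r * t" "1 - r * t \<le> 1" by linarith+
  have "d * d \<le> t * (1 - r * t)" using 1 t d by (intro mult_mono) auto
  moreover have "t * (1 - r * t) \<le> 1 * 1" using 1 t d by (intro mult_mono) auto
  moreover have "0 < d * d" using d by simp
  ultimately show "1 \<le> phi r t" "phi r t \<le> 1 / d\<^sup>2" "t * (1 - r * t) * phi r t = 1"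
    unfolding phi_def power2_eq_square by (auto simp: le_divide_eq intro!: divide_left_mono)
qed

lemma phi_diff:
  assumes r: "0 \<le> r" "r \<le> 1" and d: "0 < d" and t: "t \<in> {d..1 - d}" and s: "s \<in> {d..1 - d}"
  shows "phi r s - phi r t = (t - s) * (1 - r * (t + s)) * phi r s * phi r t"
proof -
  let ?g = "\<lambda>t. t * (1 - r * t)"
  note S = phi_bounds(3)[OF r d s] and T = phi_bounds(3)[OF r d t]
  \<comment> \<open>Each term is multiplied by a 1 formed at the other point; the difference becomes
    a multiple of \<open>?g t - ?g s\<close>, a polynomial divisible by
    \<open>t - s\<close>.\<close>
  have "phi r s - phi r t = phi r s * (?g t * phi r t) - phi r t * (?g s * phi r s)"
    by (simp only: S T)
  also have "\<dots> = (t - s) * (1 - r * (t + s)) * phi r s * phi r t"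
    by (simp add: algebra_simps)
  finally show ?thesis .
qed

lemma abs_phi_diff_le:
  assumes r: "0 \<le> r" "r \<le> 1" and d: "0 < d" and t: "t \<in> {d..1 - d}" and s: "s \<in> {d..1 - d}"
  shows "\<bar>phi r s - phi r t\<bar> \<le> (1 / d\<^sup>2)\<^sup>2 * \<bar>s - t\<bar>"
proof -
  have td: "d \<le> t" "t \<le> 1 - d" "d \<le> s" "s \<le> 1 - d" using t s by auto
  have "r * (t + s) \<le> t + s" "0 \<le> r * (t + s)" using mult_right_mono[of r 1 "t + s"] r td d by auto
  with td d have "\<bar>1 - r * (t + s)\<bar> \<le> 1" unfolding abs_le_iff by linarith
  then have "\<bar>t - s\<bar> * \<bar>1 - r * (t + s)\<bar> * \<bar>phi r s\<bar> * \<bar>phi r t\<bar> \<le> \<bar>t - s\<bar> * 1 * (1 / d\<^sup>2) * (1 / d\<^sup>2)"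
    using phi_bounds(1,2)[OF r d t] phi_bounds(1,2)[OF r d s]
    by (intro mult_mono mult_nonneg_nonneg) auto
  then show ?thesis
    by (simp add: phi_diff[OF assms] abs_mult power2_eq_square abs_minus_commute mult_ac)
qed

lemma abs_dphi_le:
  assumes r: "0 \<le> r" "r \<le> 1" and d: "0 < d" and t: "t \<in> {d..1 - d}"
  shows "\<bar>dphi r t\<bar> \<le> (1 / d\<^sup>2)\<^sup>2"
proof -
  have td: "d \<le> t" "t \<le> 1 - d" using t by auto
  have "r * t \<le> t" "0 \<le> r * t" using mult_right_mono[of r 1 t] r td d by auto
  with td d have "\<bar>1 - 2 * r * t\<bar> \<le> 1" unfolding abs_le_iff by linarith
  then have "\<bar>1 - 2 * r * t\<bar> * (phi r t)\<^sup>2 \<le> 1 * (1 / d\<^sup>2)\<^sup>2"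
    using phi_bounds(1,2)[OF r d t] by (intro mult_mono power_mono) auto
  then show ?thesis by (simp add: dphi_def abs_mult abs_minus_commute)
qed

text \<open>An exact factorization replaces the second derivative: the remainder is
  \<open>(s - t) * phi r t\<close> times a bracket, and the bracket is again of order
  \<open>s - t\<close> because it contains \<open>phi r t - phi r s\<close>. Of the three factors
  \<open>1 / d\<^sup>2\<close>, one bounds \<open>phi r t\<close> and two bound the bracket.\<close>

lemma phi_taylor:
  assumes r: "0 \<le> r" "r \<le> 1" and d: "0 < d" and t: "t \<in> {d..1 - d}" and s: "s \<in> {d..1 - d}"
  shows "\<bar>phi r s - phi r t - dphi r t * (s - t)\<bar> \<le> 2 * (1 / d\<^sup>2) ^ 3 * (s - t)\<^sup>2"
proof -
  let ?b = "1 / d\<^sup>2"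
  have b: "1 \<le> ?b" using phi_bounds[OF r d t] by linarith
  have td: "d \<le> t" "t \<le> 1 - d" using t by auto
  have "r * t \<le> t" "0 \<le> r * t" using mult_right_mono[of r 1 t] r td d by auto
  with td d have "\<bar>1 - 2 * r * t\<bar> \<le> 1" unfolding abs_le_iff by linarith
  then have "\<bar>1 - 2 * r * t\<bar> * \<bar>phi r t - phi r s\<bar> \<le> 1 * (?b\<^sup>2 * \<bar>s - t\<bar>)"
    using abs_phi_diff_le[OF r d s t] by (intro mult_mono) (auto simp: abs_minus_commute)
  moreover have "\<bar>r * (s - t) * phi r s\<bar> \<le> 1 * \<bar>s - t\<bar> * ?b"
    unfolding abs_mult using r phi_bounds[OF r d s] by (intro mult_mono) auto
  moreover have "\<bar>s - t\<bar> * ?b * 1 \<le> \<bar>s - t\<bar> * ?b * ?b" using b by (intro mult_left_mono) auto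
  ultimately have "\<bar>(1 - 2 * r * t) * (phi r t - phi r s) + r * (s - t) * phi r s\<bar> \<le> 2 * ?b\<^sup>2 * \<bar>s - t\<bar>"
    by (intro order.trans[OF abs_triangle_ineq]) (auto simp: abs_mult power2_eq_square)
  then have "\<bar>s - t\<bar> * phi r t * \<bar>(1 - 2 * r * t) * (phi r t - phi r s) + r * (s - t) * phi r s\<bar>
      \<le> \<bar>s - t\<bar> * ?b * (2 * ?b\<^sup>2 * \<bar>s - t\<bar>)"
    using phi_bounds[OF r d t] by (intro mult_mono) auto
  moreover have "phi r s - phi r t - dphi r t * (s - t)
     = (s - t) * phi r t * ((1 - 2 * r * t) * (phi r t - phi r s) + r * (s - t) * phi r s)"
    unfolding dphi_def phi_diff[OF assms] by (simp add: algebra_simps power2_eq_square)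
  ultimately show ?thesis
    using phi_bounds(1)[OF r d t] by (simp add: abs_mult power2_eq_square power3_eq_cube mult_ac)
qed

section \<open>Weighted averages, perturbed Gram matrices and the Newton step\<close>

lemma norm_avg_le:
  fixes g :: "nat \<Rightarrow> 'a::real_normed_vector"
  assumes "\<And>j. j < n \<Longrightarrow> norm (g j) \<le> B" "0 \<le> B"
  shows "norm ((1 / real n) *\<^sub>R (\<Sum>j<n. g j)) \<le> B"
proof (cases "n = 0")
  case False
  have "norm (\<Sum>j<n. g j) \<le> (\<Sum>j<n. B)" using assms(1) by (intro sum_norm_le) auto
  then have "norm (\<Sum>j<n. g j) / real n \<le> B" using False by (simp add: divide_le_eq mult.commute)
  then show ?thesis by simp
qed (use assms in auto)

text \<open>
  Matrices \<open>n\<^sup>-\<^sup>1 \<Sum> w\<^sub>j g\<^sub>j g\<^sub>j\<^sup>T\<close> are handled through their action on a vector, so that no matrix norm is needed.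
\<close>

lemma coercive_bound:
  fixes g :: "nat \<Rightarrow> 'a::real_inner"
  assumes c: "0 < c" and w: "\<And>j. j < n \<Longrightarrow> 1 \<le> w j"
    and coer: "c * (norm v)\<^sup>2 \<le> (1 / real n) * (\<Sum>j<n. (g j \<bullet> v)\<^sup>2)"
  shows "c * norm v \<le> norm ((1 / real n) *\<^sub>R (\<Sum>j<n. (w j * (g j \<bullet> v)) *\<^sub>R g j))"
proof (cases "v = 0")
  case False
  let ?I = "(1 / real n) *\<^sub>R (\<Sum>j<n. (w j * (g j \<bullet> v)) *\<^sub>R g j)"
  have "(\<Sum>j<n. (g j \<bullet> v)\<^sup>2) \<le> (\<Sum>j<n. w j * (g j \<bullet> v)\<^sup>2)"
    using w mult_right_mono[of 1 "w _" "(g _ \<bullet> v)\<^sup>2"] by (intro sum_mono) auto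
  then have "c * (norm v)\<^sup>2 \<le> (1 / real n) * (\<Sum>j<n. w j * (g j \<bullet> v)\<^sup>2)"
    by (intro order.trans[OF coer] mult_left_mono) auto
  also have "\<dots> = ?I \<bullet> v"
    by (simp add: inner_sum_left power2_eq_square mult_ac)
  also have "\<dots> \<le> norm ?I * norm v" by (rule norm_cauchy_schwarz)
  finally have "(c * norm v) * norm v \<le> norm ?I * norm v" by (simp add: power2_eq_square mult_ac)
  then show ?thesis using False by (subst (asm) mult_le_cancel_right_pos) auto
qed auto

lemma abs_inner_le:
  fixes v w :: "'a::real_inner"
  assumes "norm v \<le> B" "norm w \<le> C"
  shows "\<bar>v \<bullet> w\<bar> \<le> B * C"
  using assms by (intro order.trans[OF Cauchy_Schwarz_ineq2] mult_mono) (auto intro: order.trans[OF norm_ge_zero])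

lemma perturbed_inner_diff:
  fixes x y v w :: "'a::real_inner"
  assumes "norm x \<le> 1" "norm y \<le> 1" "norm v \<le> \<eta>" "norm w \<le> \<eta>" "\<eta> \<le> 1"
  shows "\<bar>(x + v) \<bullet> (y + w) - x \<bullet> y\<bar> \<le> 3 * \<eta>"
proof -
  have "0 \<le> \<eta>" using assms(3) norm_ge_zero[of v] by linarith
  then have "\<eta> * \<eta> \<le> \<eta>" using assms(5) mult_right_mono[of \<eta> 1 \<eta>] by simp
  moreover have "(x + v) \<bullet> (y + w) - x \<bullet> y = x \<bullet> w + y \<bullet> v + v \<bullet> w"
    by (simp add: inner_add_left inner_add_right inner_commute)
  ultimately show ?thesis
    using abs_inner_le[OF assms(1,4)] abs_inner_le[OF assms(2,3)] abs_inner_le[OF assms(3,4)] by linarith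
qed

text \<open>From \<open>(a + h)\<^sup>2 \<ge> a\<^sup>2 / 2 - h\<^sup>2\<close>: halving leaves
  \<open>c / 2\<close>, and the perturbation costs at most
  \<open>\<eta>\<^sup>2 \<le> c / 4\<close>.\<close>

lemma perturbed_coercive:
  fixes x f :: "nat \<Rightarrow> 'a::real_inner"
  assumes n: "0 < n" and f: "\<And>j. j < n \<Longrightarrow> norm (f j) \<le> \<eta>" and \<eta>: "4 * \<eta>\<^sup>2 \<le> c"
    and coer: "c * (norm v)\<^sup>2 \<le> (1 / real n) * (\<Sum>j<n. (v \<bullet> x j)\<^sup>2)"
  shows "c / 4 * (norm v)\<^sup>2 \<le> (1 / real n) * (\<Sum>j<n. ((x j + f j) \<bullet> v)\<^sup>2)"
proof -
  let ?u = "\<lambda>j. x j + f j"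
  have aux: "c / 4 * N \<le> Q" if "P / 2 - S \<le> Q" "S \<le> c / 4 * N" "c * N \<le> P" for P Q S N :: real
    using that by linarith
  have "(v \<bullet> x j)\<^sup>2 / 2 - \<eta>\<^sup>2 * (norm v)\<^sup>2 \<le> (?u j \<bullet> v)\<^sup>2" if "j < n" for j
  proof -
    have "\<bar>f j \<bullet> v\<bar>\<^sup>2 \<le> (\<eta> * norm v)\<^sup>2" by (intro power_mono abs_inner_le f that) auto
    moreover have "(v \<bullet> x j)\<^sup>2 / 2 - (f j \<bullet> v)\<^sup>2 \<le> (?u j \<bullet> v)\<^sup>2"
      using zero_le_power2[of "(v \<bullet> x j) / 2 + f j \<bullet> v"] zero_le_power2[of "v \<bullet> x j + 2 * (f j \<bullet> v)"]
      by (simp add: inner_add_left inner_commute[of v] power2_eq_square algebra_simps)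
    ultimately show ?thesis by (simp add: power_mult_distrib)
  qed
  then have "(\<Sum>j<n. (v \<bullet> x j)\<^sup>2 / 2 - \<eta>\<^sup>2 * (norm v)\<^sup>2) \<le> (\<Sum>j<n. (?u j \<bullet> v)\<^sup>2)"
    by (intro sum_mono) auto
  then have "(1 / real n) * ((\<Sum>j<n. (v \<bullet> x j)\<^sup>2) / 2 - real n * (\<eta>\<^sup>2 * (norm v)\<^sup>2)) \<le> (1 / real n) * (\<Sum>j<n. (?u j \<bullet> v)\<^sup>2)"
    by (intro mult_left_mono) (auto simp: sum_subtractf sum_divide_distrib)
  then have "(1 / real n) * (\<Sum>j<n. (v \<bullet> x j)\<^sup>2) / 2 - \<eta>\<^sup>2 * (norm v)\<^sup>2 \<le> (1 / real n) * (\<Sum>j<n. (?u j \<bullet> v)\<^sup>2)"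
    using n by (simp add: right_diff_distrib)
  moreover have "\<eta>\<^sup>2 * (norm v)\<^sup>2 \<le> (c / 4) * (norm v)\<^sup>2" using \<eta> by (intro mult_right_mono) auto
  ultimately show ?thesis using coer by (rule aux)
qed

lemma norm3_add: "norm (x + y + z) \<le> norm x + norm y + norm (z::'a::real_normed_vector)"
  by (meson norm_triangle_le add_right_mono norm_triangle_ineq order_trans)

text \<open>In the application \<open>e\<close> is a row of the noise, \<open>z\<close> the rotated
  and rescaled Newton increment and \<open>g\<close> the leading term of the expansion. Both vectors
  are given by their normal equations, so no inverse appears: the perturbed information operator is
  applied to the error, the image is expanded, and coercivity with constant \<open>c / 4\<close> is
  divided out. Two terms linear in \<open>f\<close> stay unestimated, because \<open>\<eta>\<close>
  alone would bound them too weakly.\<close>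

lemma one_step_deterministic:
  fixes x f :: "nat \<Rightarrow> 'a::real_inner" and e :: "nat \<Rightarrow> real" and r \<delta> c \<eta> :: real and n i :: nat
  defines "d \<equiv> \<delta> / 2"
  defines "b \<equiv> 1 / d\<^sup>2"
  defines "u \<equiv> \<lambda>j. x j + f j"
  defines "s \<equiv> \<lambda>j. phi r (u i \<bullet> u j)" and "t \<equiv> \<lambda>j. phi r (x i \<bullet> x j)" and "t' \<equiv> \<lambda>j. dphi r (x i \<bullet> x j)"
  assumes r: "0 \<le> r" "r \<le> 1" and \<delta>: "0 < \<delta>" and c: "0 < c" and i: "i < n"
    and xx: "\<And>j. j < n \<Longrightarrow> x i \<bullet> x j \<in> {\<delta>..1 - \<delta>}" and x1: "\<And>j. j < n \<Longrightarrow> norm (x j) \<le> 1"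
    and f: "\<And>j. j < n \<Longrightarrow> norm (f j) \<le> \<eta>" and \<eta>: "6 * \<eta> \<le> \<delta>" "4 * \<eta>\<^sup>2 \<le> c"
    and coer: "\<And>v. c * (norm v)\<^sup>2 \<le> (1 / real n) * (\<Sum>j<n. (v \<bullet> x j)\<^sup>2)"
    and e: "\<And>j. j < n \<Longrightarrow> \<bar>e j\<bar> \<le> 1"
    and z: "(\<Sum>j<n. (s j * (u j \<bullet> z)) *\<^sub>R u j) = (\<Sum>j<n. ((e j + r * (x i \<bullet> x j) - r * (u i \<bullet> u j)) * s j) *\<^sub>R u j)"
    and g: "(\<Sum>j<n. (t j * (x j \<bullet> g)) *\<^sub>R x j) = (\<Sum>j<n. (e j * t j) *\<^sub>R x j)"
  shows "norm (r *\<^sub>R f i + z - g) \<le> (4 / c) *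
     (norm ((1 / real n) *\<^sub>R (\<Sum>j<n. (e j * t j) *\<^sub>R f j + ((e j * t' j - r * t j) * (x i \<bullet> f j)) *\<^sub>R x j))
      + norm ((1 / real n) *\<^sub>R (\<Sum>j<n. (e j * t' j * (x j \<bullet> f i)) *\<^sub>R x j))
      + 6 * b\<^sup>2 * \<eta> * norm g + 26 * b ^ 3 * \<eta>\<^sup>2)"
proof -
  have dpos: "0 < d" using \<delta> by (simp add: d_def)
  have "\<delta> \<le> 1 - \<delta>" using xx[OF i] by auto
  moreover have "0 \<le> \<eta>" using f[OF i] norm_ge_zero[of "f i"] by linarith
  ultimately have \<eta>1: "0 \<le> \<eta>" "\<eta> \<le> 1" "\<eta> * \<eta> \<le> \<eta>"
    using \<eta>(1) mult_right_mono[of \<eta> 1 \<eta>] by auto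
  have tI: "x i \<bullet> x j \<in> {d..1 - d}" if "j < n" for j
    using xx[OF that] \<delta> by (auto simp: d_def)
  note cs = abs_inner_le
  have exp: "u i \<bullet> u j - x i \<bullet> x j = x i \<bullet> f j + x j \<bullet> f i + f i \<bullet> f j" for j
    by (simp add: u_def inner_add_left inner_add_right inner_commute)
  have diff: "\<bar>u i \<bullet> u j - x i \<bullet> x j\<bar> \<le> 3 * \<eta>" if "j < n" for j
    unfolding u_def by (rule perturbed_inner_diff[OF x1[OF i] x1[OF that] f[OF i] f[OF that] \<eta>1(2)])
  \<comment> \<open>The inner products move by at most \<open>3 * \<eta> \<le> \<delta> / 2\<close>,
    that is, by half of the margin; hence \<open>d = \<delta> / 2\<close>.\<close>
  have sI: "u i \<bullet> u j \<in> {d..1 - d}" if "j < n" for j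
    using diff[OF that] xx[OF that] \<eta> by (auto simp: d_def abs_le_iff)
  have sb: "1 \<le> s j" "s j \<le> b" if "j < n" for j
    using phi_bounds[OF r dpos sI[OF that]] unfolding s_def b_def by auto
  have tb: "1 \<le> t j" "t j \<le> b" if "j < n" for j
    using phi_bounds[OF r dpos tI[OF that]] unfolding t_def b_def by auto
  have b1: "1 \<le> b" using tb(1,2)[OF i] by linarith
  then have b2: "b \<le> b\<^sup>2" "b\<^sup>2 \<le> b^3" "1 \<le> b\<^sup>2" by (auto simp: power_increasing[of 1 2 b, simplified] power_increasing)
  have st: "\<bar>s j - t j\<bar> \<le> 3 * b\<^sup>2 * \<eta>" if "j < n" for j
  proof -
    have "\<bar>s j - t j\<bar> \<le> b\<^sup>2 * \<bar>u i \<bullet> u j - x i \<bullet> x j\<bar>"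
      unfolding s_def t_def b_def by (rule abs_phi_diff_le[OF r dpos tI[OF that] sI[OF that]])
    also have "\<dots> \<le> b\<^sup>2 * (3 * \<eta>)" using diff[OF that] by (intro mult_left_mono) auto
    finally show ?thesis by (simp add: mult_ac)
  qed
  have tay: "\<bar>s j - t j - t' j * (u i \<bullet> u j - x i \<bullet> x j)\<bar> \<le> 18 * b^3 * \<eta>\<^sup>2" if "j < n" for j
  proof -
    have "\<bar>s j - t j - t' j * (u i \<bullet> u j - x i \<bullet> x j)\<bar> \<le> 2 * b^3 * (u i \<bullet> u j - x i \<bullet> x j)\<^sup>2"
      unfolding s_def t_def t'_def b_def by (rule phi_taylor[OF r dpos tI[OF that] sI[OF that]])
    also have "(u i \<bullet> u j - x i \<bullet> x j)\<^sup>2 \<le> (3 * \<eta>)\<^sup>2"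
      using diff[OF that] power_mono[OF diff[OF that], of 2] by auto
    then have "2 * b^3 * (u i \<bullet> u j - x i \<bullet> x j)\<^sup>2 \<le> 2 * b^3 * (3 * \<eta>)\<^sup>2"
      using b1 by (intro mult_left_mono) auto
    finally show ?thesis by (simp add: power_mult_distrib mult_ac)
  qed
  have tb': "\<bar>t' j\<bar> \<le> b\<^sup>2" if "j < n" for j
    unfolding t'_def b_def by (rule abs_dphi_le[OF r dpos tI[OF that]])
  define avg where "avg h = (1 / real n) *\<^sub>R (\<Sum>j<n. h j)" for h :: "nat \<Rightarrow> 'a"
  have avg_add: "avg (\<lambda>j. h j + k j) = avg h + avg k" for h k
    by (simp add: avg_def sum.distrib scaleR_right_distrib)
  have avg_diff: "avg (\<lambda>j. h j - k j) = avg h - avg k" for h k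
    by (simp add: avg_def sum_subtractf scaleR_right_diff_distrib)
  have coer': "(c / 4) * norm v \<le> norm (avg (\<lambda>j. (s j * (u j \<bullet> v)) *\<^sub>R u j))" for v
    unfolding avg_def
  proof (rule coercive_bound)
    show "0 < c / 4" using c by simp
    show "1 \<le> s j" if "j < n" for j using sb(1)[OF that] .
    show "c / 4 * (norm v)\<^sup>2 \<le> (1 / real n) * (\<Sum>j<n. (u j \<bullet> v)\<^sup>2)"
      unfolding u_def using i f \<eta>(2) coer by (intro perturbed_coercive[where \<eta>=\<eta>]) auto
  qed
  \<comment> \<open>The parts of the image of the error beyond the two linear terms:
    \<open>E\<close> is quadratic in \<open>f\<close> with a noise factor and includes the Taylor
    remainder of \<open>phi\<close>; \<open>E'\<close> is the quadratic part of what survives the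
    cancellation of \<open>f i\<close>; \<open>D\<close> is the change of the information operator
    acting on \<open>g\<close>, of first order in \<open>f\<close> but with the extra small factor
    \<open>norm g\<close>.\<close>
  define E where "E j = e j *\<^sub>R ((s j - t j) *\<^sub>R f j + (s j - t j - t' j * (u i \<bullet> u j - x i \<bullet> x j)) *\<^sub>R x j
       + (t' j * (f i \<bullet> f j)) *\<^sub>R x j)" for j
  define E' where "E' j = (- r * (x i \<bullet> f j)) *\<^sub>R (s j *\<^sub>R f j + (s j - t j) *\<^sub>R x j)" for j
  define D where "D j = - ((s j * (u j \<bullet> g)) *\<^sub>R f j + (s j * (f j \<bullet> g)) *\<^sub>R x j + ((s j - t j) * (x j \<bullet> g)) *\<^sub>R x j)" for j
  let ?r = "r *\<^sub>R f i + z - g"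
  let ?H = "\<lambda>j. (e j * t j) *\<^sub>R f j + ((e j * t' j - r * t j) * (x i \<bullet> f j)) *\<^sub>R x j"
  let ?P = "\<lambda>j. (e j * t' j * (x j \<bullet> f i)) *\<^sub>R x j"
  have "avg (\<lambda>j. (s j * (u j \<bullet> ?r)) *\<^sub>R u j)
     = avg (\<lambda>j. (s j * r * (u j \<bullet> f i)) *\<^sub>R u j) + avg (\<lambda>j. (s j * (u j \<bullet> z)) *\<^sub>R u j) - avg (\<lambda>j. (s j * (u j \<bullet> g)) *\<^sub>R u j)"
    by (simp add: inner_add_right inner_diff_right algebra_simps flip: avg_add avg_diff)
  also have "avg (\<lambda>j. (s j * (u j \<bullet> z)) *\<^sub>R u j) = avg (\<lambda>j. ((e j + r * (x i \<bullet> x j) - r * (u i \<bullet> u j)) * s j) *\<^sub>R u j)"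
    unfolding avg_def z ..
  \<comment> \<open>The normal equation of \<open>g\<close> enters as an added zero, so that the
    terms in \<open>g\<close> and in \<open>e\<close> become differences between perturbed and exact
    positions.\<close>
  also have "avg (\<lambda>j. (s j * r * (u j \<bullet> f i)) *\<^sub>R u j) + \<dots> - avg (\<lambda>j. (s j * (u j \<bullet> g)) *\<^sub>R u j)
    = avg (\<lambda>j. (s j * r * (u j \<bullet> f i)) *\<^sub>R u j) + \<dots> - avg (\<lambda>j. (s j * (u j \<bullet> g)) *\<^sub>R u j)
       + (avg (\<lambda>j. (t j * (x j \<bullet> g)) *\<^sub>R x j) - avg (\<lambda>j. (e j * t j) *\<^sub>R x j))"
    unfolding avg_def g by simp
  also have "\<dots> = avg ?H + avg ?P + avg E + avg E' + avg D"
    unfolding avg_add[symmetric] avg_diff[symmetric]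
  proof (rule arg_cong[where f=avg], rule ext)
    fix j
    have "s j * r * (u j \<bullet> f i) + (e j + r * (x i \<bullet> x j) - r * (u i \<bullet> u j)) * s j = s j * e j - s j * r * (x i \<bullet> f j)"
      by (simp add: u_def inner_add_left inner_add_right inner_commute algebra_simps)
    then have "(s j * r * (u j \<bullet> f i)) *\<^sub>R u j + ((e j + r * (x i \<bullet> x j) - r * (u i \<bullet> u j)) * s j) *\<^sub>R u j
       = (s j * e j - s j * r * (x i \<bullet> f j)) *\<^sub>R u j"
      by (simp flip: scaleR_left_distrib)
    then show "(s j * r * (u j \<bullet> f i)) *\<^sub>R u j + ((e j + r * (x i \<bullet> x j) - r * (u i \<bullet> u j)) * s j) *\<^sub>R u j - (s j * (u j \<bullet> g)) *\<^sub>R u j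
        + ((t j * (x j \<bullet> g)) *\<^sub>R x j - (e j * t j) *\<^sub>R x j) = ?H j + ?P j + E j + E' j + D j"
      unfolding E_def E'_def D_def exp
      by (simp add: u_def inner_add_left scaleR_left_distrib scaleR_right_distrib scaleR_left_diff_distrib algebra_simps)
  qed
  finally have "(c / 4) * norm ?r \<le> norm (avg ?H + avg ?P + avg E + avg E' + avg D)"
    using coer'[of ?r] by simp
  also have "\<dots> \<le> norm (avg ?H) + norm (avg ?P) + norm (avg E) + norm (avg E') + norm (avg D)"
    by (intro order.trans[OF norm_triangle_ineq] add_right_mono) simp
  \<comment> \<open>The constant is 3 from the change of weight, 18 from the Taylor remainder and 1
    from the product \<open>f i \<bullet> f j\<close>; with the 4 of \<open>E'\<close> it makes
    26.\<close>
  also have "norm (avg E) \<le> 22 * b^3 * \<eta>\<^sup>2"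
    unfolding avg_def
  proof (rule norm_avg_le)
    fix j assume j: "j < n"
    have "norm ((s j - t j) *\<^sub>R f j) \<le> (3 * b\<^sup>2 * \<eta>) * \<eta>"
      unfolding norm_scaleR real_norm_def using st[OF j] f[OF j] \<eta>1 by (intro mult_mono) auto
    also have "\<dots> \<le> 3 * b^3 * \<eta>\<^sup>2" using mult_right_mono[OF b2(2), of "\<eta>\<^sup>2"] by (simp add: power2_eq_square mult_ac)
    finally have 1: "norm ((s j - t j) *\<^sub>R f j) \<le> 3 * b^3 * \<eta>\<^sup>2" .
    have 2: "norm ((s j - t j - t' j * (u i \<bullet> u j - x i \<bullet> x j)) *\<^sub>R x j) \<le> (18 * b^3 * \<eta>\<^sup>2) * 1"
      unfolding norm_scaleR using tay[OF j] x1[OF j] b1 by (intro mult_mono) auto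
    have "norm ((t' j * (f i \<bullet> f j)) *\<^sub>R x j) \<le> (b\<^sup>2 * (\<eta> * \<eta>)) * 1"
      unfolding norm_scaleR real_norm_def abs_mult using tb'[OF j] x1[OF j] cs[OF f[OF i] f[OF j]] \<eta>1 by (intro mult_mono) auto
    also have "\<dots> \<le> b^3 * \<eta>\<^sup>2" using mult_right_mono[OF b2(2), of "\<eta>\<^sup>2"] by (simp add: power2_eq_square mult_ac)
    finally have 3: "norm ((t' j * (f i \<bullet> f j)) *\<^sub>R x j) \<le> b^3 * \<eta>\<^sup>2" .
    have "norm (E j) \<le> 1 * (22 * b^3 * \<eta>\<^sup>2)"
      unfolding E_def norm_scaleR using e[OF j] 1 2 3 by (intro mult_mono order.trans[OF norm3_add]) auto
    then show "norm (E j) \<le> 22 * b^3 * \<eta>\<^sup>2" by simp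
  qed (use b1 in auto)
  also have "norm (avg E') \<le> 4 * b^3 * \<eta>\<^sup>2"
    unfolding avg_def
  proof (rule norm_avg_le)
    fix j assume j: "j < n"
    have "\<bar>- r * (x i \<bullet> f j)\<bar> \<le> 1 * (1 * \<eta>)"
      unfolding abs_mult using r cs[OF x1[OF i] f[OF j]] \<eta>1 by (intro mult_mono) auto
    moreover have "norm (s j *\<^sub>R f j) \<le> b * \<eta>"
      using sb(1,2)[OF j] f[OF j] b1 by (auto intro!: mult_mono)
    moreover have "norm ((s j - t j) *\<^sub>R x j) \<le> (3 * b\<^sup>2 * \<eta>) * 1"
      unfolding norm_scaleR using st[OF j] x1[OF j] \<eta>1 by (intro mult_mono) auto
    moreover have "b * \<eta> \<le> b\<^sup>2 * \<eta>" using b2(1) \<eta>1 by (intro mult_right_mono) auto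
    ultimately have "norm (E' j) \<le> \<eta> * (4 * b\<^sup>2 * \<eta>)"
      unfolding E'_def norm_scaleR real_norm_def using \<eta>1 by (intro mult_mono order.trans[OF norm_triangle_ineq]) auto
    also have "\<dots> \<le> 4 * b^3 * \<eta>\<^sup>2" using mult_right_mono[OF b2(2), of "\<eta>\<^sup>2"] by (simp add: power2_eq_square mult_ac)
    finally show "norm (E' j) \<le> 4 * b^3 * \<eta>\<^sup>2" .
  qed (use b1 in auto)
  also have "norm (avg D) \<le> 6 * b\<^sup>2 * \<eta> * norm g"
    unfolding avg_def
  proof (rule norm_avg_le)
    fix j assume j: "j < n"
    have u2: "norm (u j) \<le> 2" unfolding u_def using x1[OF j] f[OF j] \<eta>1 by (intro order.trans[OF norm_triangle_ineq]) auto
    have "norm ((s j * (u j \<bullet> g)) *\<^sub>R f j) \<le> (b * (2 * norm g)) * \<eta>"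
      unfolding norm_scaleR real_norm_def abs_mult using sb(1,2)[OF j] cs[OF u2 order_refl, of g] f[OF j] b1 by (intro mult_mono) auto
    moreover have "norm ((s j * (f j \<bullet> g)) *\<^sub>R x j) \<le> (b * (\<eta> * norm g)) * 1"
      unfolding norm_scaleR real_norm_def abs_mult using sb(1,2)[OF j] cs[OF f[OF j] order_refl, of g] x1[OF j] b1 \<eta>1 by (intro mult_mono) auto
    moreover have "norm (((s j - t j) * (x j \<bullet> g)) *\<^sub>R x j) \<le> ((3 * b\<^sup>2 * \<eta>) * (1 * norm g)) * 1"
      unfolding norm_scaleR real_norm_def abs_mult using st[OF j] cs[OF x1[OF j] order_refl, of g] x1[OF j] b1 \<eta>1 by (intro mult_mono) auto
    moreover have "b * (\<eta> * norm g) \<le> b\<^sup>2 * (\<eta> * norm g)" using b2(1) \<eta>1 by (intro mult_right_mono) auto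
    ultimately show "norm (D j) \<le> 6 * b\<^sup>2 * \<eta> * norm g"
      unfolding D_def norm_minus_cancel by (intro order.trans[OF norm3_add]) (simp add: mult_ac)
  qed (use b1 \<eta>1 in auto)
  finally have "(c / 4) * norm ?r \<le> norm (avg ?H) + norm (avg ?P) + 6 * b\<^sup>2 * \<eta> * norm g + 26 * b ^ 3 * \<eta>\<^sup>2"
    by (simp add: mult_ac)
  moreover have aux: "N \<le> (4 / c) * Y" if "(c / 4) * N \<le> Y" for N Y
    using that c by (simp add: field_simps)
  ultimately have "norm ?r \<le> (4 / c) * (norm (avg ?H) + norm (avg ?P) + 6 * b\<^sup>2 * \<eta> * norm g + 26 * b ^ 3 * \<eta>\<^sup>2)"
    by blast
  then show ?thesis by (simp add: avg_def)
qed

section \<open>Moments and concentration of the noise\<close>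

definition upairs :: "nat \<Rightarrow> (nat \<times> nat) set" where
  "upairs n = {(i, j). i < j \<and> j < n}"

text \<open>Independence is available for pairs \<open>i < j\<close>, whereas the sums below run
  over both orders; \<open>edge\<close> names the underlying independent variable.\<close>

definition edge :: "nat \<Rightarrow> nat \<Rightarrow> nat \<times> nat" where
  "edge i j = (min i j, max i j)"

lemma edge_eq_iff: "edge i j = edge k l \<longleftrightarrow> i = k \<and> j = l \<or> i = l \<and> j = k"
  by (auto simp: edge_def min_def max_def)

lemma edge_upairs: "i < n \<Longrightarrow> j < n \<Longrightarrow> i \<noteq> j \<Longrightarrow> edge i j \<in> upairs n"
  by (auto simp: edge_def upairs_def min_def max_def)

lemma finite_upairs [simp]: "finite (upairs n)"
  by (rule finite_subset[of _ "{..<n} \<times> {..<n}"]) (auto simp: upairs_def)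

lemma is_rdpgD:
  assumes "is_rdpg M n r x0 A"
  shows "prob_space M"
    and "w \<in> space M \<Longrightarrow> A w i j \<in> {0, 1}"
    and "w \<in> space M \<Longrightarrow> A w i j = A w j i"
    and "w \<in> space M \<Longrightarrow> A w i i = 0"
    and "w \<in> space M \<Longrightarrow> \<not> (i < n \<and> j < n) \<Longrightarrow> A w i j = 0"
    and "prob_space.indep_vars M (\<lambda>_. borel) (\<lambda>(i, j) w. A w i j) (upairs n)"
    and "i < j \<Longrightarrow> j < n \<Longrightarrow> distr M (count_space UNIV) (\<lambda>w. A w i j = 1)
          = measure_pmf (bernoulli_pmf (r * (x0 i \<bullet> x0 j)))"
  using assms unfolding is_rdpg_def upairs_def by blast+

lemma rdpg_entry_measurable:
  assumes A: "is_rdpg M n r x0 A"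
  shows "(\<lambda>w. A w i j) \<in> borel_measurable M"
proof -
  interpret prob_space M by (rule is_rdpgD(1)[OF A])
  have up: "(\<lambda>w. A w i j) \<in> borel_measurable M" if "i < j" "j < n" for i j
  proof -
    have "(case (i, j) of (i, j) \<Rightarrow> \<lambda>w. A w i j) \<in> borel_measurable M"
      using is_rdpgD(6)[OF A] that unfolding indep_vars_def by (auto simp: upairs_def)
    then show ?thesis by simp
  qed
  consider "i < j" "j < n" | "j < i" "i < n" | "i = j" | "\<not> (i < n \<and> j < n)" by linarith
  then show ?thesis
  proof cases
    case 2
    then show ?thesis using up[OF 2] is_rdpgD(3)[OF A] by (subst measurable_cong[where g="\<lambda>w. A w j i"]) auto
  next
    case 3
    then show ?thesis using is_rdpgD(4)[OF A] by (subst measurable_cong[where g="\<lambda>w. 0"]) auto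
  next
    case 4
    then show ?thesis using is_rdpgD(5)[OF A] by (subst measurable_cong[where g="\<lambda>w. 0"]) auto
  qed (use up in auto)
qed

lemma rdpg_finite_range:
  assumes A: "is_rdpg M n r x0 A"
  shows "finite (A ` space M)"
proof (rule finite_subset)
  let ?mk = "\<lambda>E i j. of_bool ((i, j) \<in> E) :: real"
  show "A ` space M \<subseteq> ?mk ` Pow ({..<n} \<times> {..<n})"
  proof
    fix B assume "B \<in> A ` space M"
    then obtain w where w: "w \<in> space M" "B = A w" by auto
    have "B i j = ?mk {(i, j). i < n \<and> j < n \<and> B i j = 1} i j" for i j
      using is_rdpgD(2)[OF A w(1), of i j] is_rdpgD(5)[OF A w(1), of i j] w(2) by auto
    then have "B = ?mk {(i, j). i < n \<and> j < n \<and> B i j = 1}" by (intro ext)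
    then show "B \<in> ?mk ` Pow ({..<n} \<times> {..<n})" by (rule image_eqI) auto
  qed
qed auto

text \<open>The predicate is arbitrary: the event is a finite union of events that prescribe all
  entries. This makes statements about unrestricted functions of the matrix, such as the estimators,
  the alignment and the remainder, measurable.\<close>

lemma rdpg_sets:
  assumes A: "is_rdpg M n r x0 A"
  shows "{w \<in> space M. P (A w)} \<in> sets M"
proof -
  note [measurable] = rdpg_entry_measurable[OF A]
  have "A w = A v" if "w \<in> space M" "v \<in> space M" "\<forall>i\<in>{..<n}. \<forall>j\<in>{..<n}. A w i j = A v i j" for w v
  proof (intro ext)
    fix i j
    show "A w i j = A v i j"
      using that(3) is_rdpgD(5)[OF A that(1), of i j] is_rdpgD(5)[OF A that(2), of i j]
      by (cases "i < n \<and> j < n") auto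
  qed
  then have "{w \<in> space M. P (A w)}
      = (\<Union>B\<in>{B \<in> A ` space M. P B}. {w \<in> space M. \<forall>i\<in>{..<n}. \<forall>j\<in>{..<n}. A w i j = B i j})"
    by fastforce
  also have "\<dots> \<in> sets M"
    using rdpg_finite_range[OF A] by (intro sets.finite_UN) auto
  finally show ?thesis .
qed

lemma rdpg_borel_measurable:
  assumes A: "is_rdpg M n r x0 A"
  shows "(\<lambda>w. h (A w)) \<in> borel_measurable M"
  using rdpg_sets[OF A, of "\<lambda>B. h B \<in> _"]
  by (intro measurableI) (auto simp: vimage_def Int_def conj_commute)

lemma rdpg_integrable:
  fixes h :: "adj \<Rightarrow> real"
  assumes A: "is_rdpg M n r x0 A"
  shows "integrable M (\<lambda>w. h (A w))"
proof -
  interpret prob_space M by (rule is_rdpgD(1)[OF A])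
  let ?S = "(\<lambda>B. \<bar>h B\<bar>) ` A ` space M"
  have "\<bar>h (A w)\<bar> \<le> Max ?S" if "w \<in> space M" for w
    using that rdpg_finite_range[OF A] by (intro Max_ge) auto
  then show ?thesis
    by (intro integrable_const_bound[where B="Max ?S"] rdpg_borel_measurable[OF A]) auto
qed

section \<open>Centred noise, its mixed moments and row sums\<close>

definition noise :: "real \<Rightarrow> (nat \<Rightarrow> real ^ 'd) \<Rightarrow> adj \<Rightarrow> nat \<Rightarrow> nat \<Rightarrow> real" where
  "noise r x0 B i j = B i j - r * (x0 i \<bullet> x0 j)"

lemma rdpg_noise_mean:
  assumes A: "is_rdpg M n r x0 A" and p: "0 \<le> r * (x0 i \<bullet> x0 j)" "r * (x0 i \<bullet> x0 j) \<le> 1"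
    and ij: "i < j" "j < n"
  shows "(\<integral>w. noise r x0 (A w) i j \<partial>M) = 0"
proof -
  interpret prob_space M by (rule is_rdpgD(1)[OF A])
  have [measurable]: "(\<lambda>w. A w i j = 1) \<in> measurable M (count_space UNIV)"
    using rdpg_entry_measurable[OF A, of i j] by measurable
  have "measure M {w \<in> space M. A w i j = 1} = measure (distr M (count_space UNIV) (\<lambda>w. A w i j = 1)) {True}"
    by (subst measure_distr) (auto simp: vimage_def Int_def conj_commute)
  also have "\<dots> = r * (x0 i \<bullet> x0 j)"
    using p by (simp add: is_rdpgD(7)[OF A ij] measure_pmf_single)
  finally have "measure M {w \<in> space M. A w i j = 1} = r * (x0 i \<bullet> x0 j)" .
  moreover have "(\<integral>w. A w i j \<partial>M) = (\<integral>w. indicator {w \<in> space M. A w i j = 1} w \<partial>M)"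
    using is_rdpgD(2)[OF A, of _ i j] by (intro Bochner_Integration.integral_cong) (auto simp: indicator_def)
  ultimately have "(\<integral>w. A w i j \<partial>M) = r * (x0 i \<bullet> x0 j)"
    by (simp add: Int_def conj_commute)
  then show ?thesis
    unfolding noise_def by (subst Bochner_Integration.integral_diff)
      (auto intro: rdpg_integrable[OF A, of "\<lambda>B. B i j"] simp: prob_space)
qed

lemma abs_noise_le:
  assumes A: "is_rdpg M n r x0 A" and p: "0 \<le> r * (x0 i \<bullet> x0 j)" "r * (x0 i \<bullet> x0 j) \<le> 1" and w: "w \<in> space M"
  shows "\<bar>noise r x0 (A w) i j\<bar> \<le> 1"
  using is_rdpgD(2)[OF A w, of i j] p by (auto simp: noise_def)

lemma noise_edge:
  assumes A: "is_rdpg M n r x0 A" and w: "w \<in> space M"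
  shows "noise r x0 (A w) i j = noise r x0 (A w) (fst (edge i j)) (snd (edge i j))"
  using is_rdpgD(3)[OF A w, of i j] by (auto simp: noise_def edge_def min_def max_def inner_commute)

lemma rdpg_noise_indep:
  assumes A: "is_rdpg M n r x0 A"
  shows "prob_space.indep_vars M (\<lambda>_. borel) (\<lambda>e w. noise r x0 (A w) (fst e) (snd e)) (upairs n)"
proof -
  interpret prob_space M by (rule is_rdpgD(1)[OF A])
  show ?thesis
    using indep_vars_compose2[OF is_rdpgD(6)[OF A], of "\<lambda>e y. y - r * (x0 (fst e) \<bullet> x0 (snd e))" "\<lambda>_. borel"]
    by (simp add: noise_def case_prod_beta)
qed

lemma prod_list_eq_prod_count:
  fixes g :: "'a \<Rightarrow> real"
  assumes "finite P" "set es \<subseteq> P"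
  shows "prod_list (map g es) = (\<Prod>e\<in>P. g e ^ count_list es e)"
  using assms(2)
proof (induction es)
  case (Cons a es)
  have "(\<Prod>e\<in>P. g e ^ count_list (a # es) e) = (\<Prod>e\<in>P. (if e = a then g a else 1) * g e ^ count_list es e)"
    by (intro prod.cong) auto
  also have "\<dots> = g a * (\<Prod>e\<in>P. g e ^ count_list es e)"
    using Cons assms(1) by (subst prod.distrib) (auto simp: prod.delta)
  finally show ?case using Cons by simp
qed auto

text \<open>Grouping equal factors gives a product of powers of independent variables; exponent 1 at
  \<open>e\<close> leaves the mean of a centred variable as a factor.\<close>

lemma rdpg_noise_prod_zero:
  assumes A: "is_rdpg M n r x0 A" and p: "\<And>i j. 0 \<le> r * (x0 i \<bullet> x0 j)" "\<And>i j. r * (x0 i \<bullet> x0 j) \<le> 1"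
    and es: "set es \<subseteq> upairs n" and e: "count_list es e = 1"
  shows "(\<integral>w. prod_list (map (\<lambda>e. noise r x0 (A w) (fst e) (snd e)) es) \<partial>M) = 0"
proof -
  interpret prob_space M by (rule is_rdpgD(1)[OF A])
  let ?X = "\<lambda>e w. noise r x0 (A w) (fst e) (snd e)"
  have eP: "e \<in> upairs n" using e es by (metis count_notin subsetD zero_neq_one)
  have "(\<integral>w. prod_list (map (\<lambda>e. ?X e w) es) \<partial>M) = (\<integral>w. (\<Prod>e\<in>upairs n. ?X e w ^ count_list es e) \<partial>M)"
    by (subst prod_list_eq_prod_count[OF _ es]) auto
  also have "\<dots> = (\<Prod>e\<in>upairs n. \<integral>w. ?X e w ^ count_list es e \<partial>M)"
  proof (rule indep_vars_lebesgue_integral)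
    show "indep_vars (\<lambda>_. borel) (\<lambda>e w. ?X e w ^ count_list es e) (upairs n)"
      by (rule indep_vars_compose2[OF rdpg_noise_indep[OF A]]) auto
    show "integrable M (\<lambda>w. ?X e w ^ count_list es e)" for e
      by (rule rdpg_integrable[OF A, of "\<lambda>B. noise r x0 B (fst e) (snd e) ^ count_list es e"])
  qed simp
  also have "\<dots> = 0"
    using eP e rdpg_noise_mean[OF A p, of "fst e" "snd e"]
    by (intro prod_zero[OF finite_upairs] bexI[of _ e]) (auto simp: upairs_def)
  finally show ?thesis .
qed

text \<open>By symmetry of the matrix, \<open>(i, j)\<close> and \<open>(j, i)\<close> name the same
  variable, so multiplicities are counted after passing to \<open>edge\<close>.\<close>

lemma noise_prod_zero:
  assumes A: "is_rdpg M n r x0 A" and p: "\<And>i j. 0 \<le> r * (x0 i \<bullet> x0 j)" "\<And>i j. r * (x0 i \<bullet> x0 j) \<le> 1"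
    and es: "\<And>i j. (i, j) \<in> set es \<Longrightarrow> i < n \<and> j < n \<and> i \<noteq> j"
    and e: "count_list (map (case_prod edge) es) e = 1"
  shows "(\<integral>w. prod_list (map (\<lambda>(i, j). noise r x0 (A w) i j) es) \<partial>M) = 0"
proof -
  have "(\<integral>w. prod_list (map (\<lambda>(i, j). noise r x0 (A w) i j) es) \<partial>M)
      = (\<integral>w. prod_list (map (\<lambda>e. noise r x0 (A w) (fst e) (snd e)) (map (case_prod edge) es)) \<partial>M)"
    by (intro Bochner_Integration.integral_cong refl arg_cong[where f=prod_list])
       (auto simp: noise_edge[OF A, symmetric])
  also have "\<dots> = 0"
    by (rule rdpg_noise_prod_zero[OF A p _ e]) (auto intro!: edge_upairs dest!: es)
  finally show ?thesis .
qed

text \<open>Pythagoras: the cross terms have mean 0, and each of the \<open>card I\<close> squares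
  has mean at most \<open>c\<^sup>2\<close>.\<close>

lemma rdpg_second_moment_orthogonal:
  fixes Y :: "'b \<Rightarrow> adj \<Rightarrow> real"
  assumes A: "is_rdpg M n r x0 A" and I: "finite I"
    and Y: "\<And>p w. p \<in> I \<Longrightarrow> w \<in> space M \<Longrightarrow> \<bar>Y p (A w)\<bar> \<le> 1"
    and orth: "\<And>p q. p \<in> I \<Longrightarrow> q \<in> I \<Longrightarrow> p \<noteq> q \<Longrightarrow> (\<integral>w. Y p (A w) * Y q (A w) \<partial>M) = 0"
    and a: "\<And>p. p \<in> I \<Longrightarrow> \<bar>a p\<bar> \<le> c"
  shows "(\<integral>w. (\<Sum>p\<in>I. a p * Y p (A w))\<^sup>2 \<partial>M) \<le> real (card I) * c\<^sup>2"
proof -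
  interpret prob_space M by (rule is_rdpgD(1)[OF A])
  have int: "integrable M (\<lambda>w. h (A w))" for h :: "adj \<Rightarrow> real" by (rule rdpg_integrable[OF A])
  have "(\<integral>w. (\<Sum>p\<in>I. a p * Y p (A w))\<^sup>2 \<partial>M) = (\<integral>w. (\<Sum>p\<in>I. \<Sum>q\<in>I. a p * a q * (Y p (A w) * Y q (A w))) \<partial>M)"
    by (simp add: power2_eq_square sum_product mult_ac)
  also have "\<dots> = (\<Sum>p\<in>I. \<Sum>q\<in>I. a p * a q * (\<integral>w. Y p (A w) * Y q (A w) \<partial>M))"
    using int[of "\<lambda>B. Y _ B * Y _ B"]
    by (subst Bochner_Integration.integral_sum, intro int[of "\<lambda>B. \<Sum>q\<in>I. a _ * a q * (Y _ B * Y q B)"])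
       (intro sum.cong refl, subst Bochner_Integration.integral_sum, auto)
  also have "\<dots> = (\<Sum>p\<in>I. (a p)\<^sup>2 * (\<integral>w. (Y p (A w))\<^sup>2 \<partial>M))"
  proof (rule sum.cong)
    fix p assume p: "p \<in> I"
    have "(\<Sum>q\<in>I. a p * a q * (\<integral>w. Y p (A w) * Y q (A w) \<partial>M))
        = (\<Sum>q\<in>I. if p = q then a p * a p * (\<integral>w. Y p (A w) * Y p (A w) \<partial>M) else 0)"
      using orth[OF p] by (intro sum.cong) auto
    then show "(\<Sum>q\<in>I. a p * a q * (\<integral>w. Y p (A w) * Y q (A w) \<partial>M)) = (a p)\<^sup>2 * (\<integral>w. (Y p (A w))\<^sup>2 \<partial>M)"
      using I p by (simp add: power2_eq_square)
  qed simp
  also have "\<dots> \<le> (\<Sum>p\<in>I. c\<^sup>2 * 1)"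
  proof (intro sum_mono mult_mono)
    fix p assume p: "p \<in> I"
    have "(\<integral>w. (Y p (A w))\<^sup>2 \<partial>M) \<le> (\<integral>w. 1 \<partial>M)"
      using Y[OF p] by (intro integral_mono int[of "\<lambda>B. (Y p B)\<^sup>2"]) (auto simp: abs_square_le_1)
    then show "(\<integral>w. (Y p (A w))\<^sup>2 \<partial>M) \<le> 1" by (simp add: prob_space)
    show "(a p)\<^sup>2 \<le> c\<^sup>2" using power_mono[OF a[OF p], of 2] by simp
  qed auto
  finally show ?thesis by simp
qed

text \<open>All but order \<open>n\<close> of the summands, each of size at most
  \<open>c / n\<close>, fall into three orthogonal families of at most \<open>n\<^sup>2\<close>
  members, and each family contributes at most \<open>c\<^sup>2\<close>. The at most
  \<open>4 * n\<close> degenerate summands are bounded by \<open>4 * c\<close> in absolute value.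
  Squaring a sum of four terms costs a factor 4, whence 76 = 4 * 3 + 4 * 16.\<close>

lemma rdpg_quadratic_second_moment:
  fixes a a' :: "nat \<Rightarrow> nat \<Rightarrow> real"
  assumes A: "is_rdpg M n r x0 A" and p: "\<And>i j. 0 \<le> r * (x0 i \<bullet> x0 j)" "\<And>i j. r * (x0 i \<bullet> x0 j) \<le> 1"
    and i: "i < n" and c: "0 \<le> c"
    and a: "\<And>j k. j < n \<Longrightarrow> k < n \<Longrightarrow> \<bar>a j k\<bar> \<le> c / real n" "\<And>j k. j < n \<Longrightarrow> k < n \<Longrightarrow> \<bar>a' j k\<bar> \<le> c / real n"
  defines "e \<equiv> \<lambda>w. noise r x0 (A w)"
  shows "(\<integral>w. (\<Sum>j<n. \<Sum>k<n. e w j k * (e w i j * a j k + a' j k))\<^sup>2 \<partial>M) \<le> 76 * c\<^sup>2"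
proof -
  interpret prob_space M by (rule is_rdpgD(1)[OF A])
  have int: "integrable M (\<lambda>w. h (A w))" for h :: "adj \<Rightarrow> real" by (rule rdpg_integrable[OF A])
  have e1: "\<bar>e w j k\<bar> \<le> 1" if "w \<in> space M" for w j k
    unfolding e_def by (rule abs_noise_le[OF A p that])
  have e2: "\<bar>e w j k * e w j' k'\<bar> \<le> 1" if "w \<in> space M" for w j k j' k'
    using mult_mono[OF e1[OF that, of j k] e1[OF that, of j' k']] by (simp add: abs_mult)
  let ?N = "{..<n} \<times> {..<n}"
  \<comment> \<open>The linear part is split by the order of \<open>j\<close> and \<open>k\<close>,
    since \<open>(j, k)\<close> and \<open>(k, j)\<close> carry the same variable and are not
    orthogonal. The diagonal is set apart: noise there is the nonzero constant
    \<open>- r * (x0 j \<bullet> x0 j)\<close>.\<close>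
  define T where "T = {(j, k) \<in> ?N. j \<noteq> i \<and> k \<noteq> i \<and> j \<noteq> k}"
  define T1 where "T1 = {(j, k) \<in> ?N. j < k}"
  define T2 where "T2 = {(j, k) \<in> ?N. k < j}"
  define Dg where "Dg = (\<lambda>j. (j, j)) ` {..<n}"
  have fin: "finite T" "finite T1" "finite T2"
    by (rule finite_subset[of _ ?N]; auto simp: T_def T1_def T2_def)+
  have cardN: "real (card U) * (c / real n)\<^sup>2 \<le> c\<^sup>2" if "U \<subseteq> ?N" for U
  proof -
    have "card U \<le> card ?N" using that by (intro card_mono) auto
    then have "card U \<le> n * n" by (simp add: card_cartesian_product)
    then have "real (card U) \<le> real n * real n" by (metis of_nat_le_iff of_nat_mult)
    then have "real (card U) * (c / real n)\<^sup>2 \<le> real n * real n * (c / real n)\<^sup>2" by (intro mult_right_mono) auto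
    also have "\<dots> = c\<^sup>2" using i by (simp add: power2_eq_square)
    finally show ?thesis .
  qed
  define S where "S w = (\<Sum>q\<in>T. (case q of (j, k) \<Rightarrow> a j k) * (case q of (j, k) \<Rightarrow> e w i j * e w j k))" for w
  define S1 where "S1 w = (\<Sum>q\<in>T1. (case q of (j, k) \<Rightarrow> a' j k) * (case q of (j, k) \<Rightarrow> e w j k))" for w
  define S2 where "S2 w = (\<Sum>q\<in>T2. (case q of (j, k) \<Rightarrow> a' j k) * (case q of (j, k) \<Rightarrow> e w j k))" for w
  define R1 where "R1 w = (\<Sum>(j,k)\<in>?N - T. e w j k * e w i j * a j k)" for w
  define R2 where "R2 w = (\<Sum>(j,k)\<in>Dg. e w j k * a' j k)" for w
  have R1: "\<bar>R1 w\<bar> \<le> 3 * c" if w: "w \<in> space M" for w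
  proof -
    have "?N - T \<subseteq> (\<lambda>k. (i, k)) ` {..<n} \<union> (\<lambda>j. (j, i)) ` {..<n} \<union> (\<lambda>j. (j, j)) ` {..<n}"
      by (auto simp: T_def)
    then have "card (?N - T) \<le> card ((\<lambda>k. (i, k)) ` {..<n} \<union> (\<lambda>j. (j, i)) ` {..<n} \<union> (\<lambda>j. (j, j)) ` {..<n})"
      by (intro card_mono) auto
    also have "\<dots> \<le> card ((\<lambda>k. (i, k)) ` {..<n}) + card ((\<lambda>j. (j, i)) ` {..<n}) + card ((\<lambda>j. (j, j)) ` {..<n})"
      by (meson card_Un_le le_trans add_le_mono1)
    also have "\<dots> \<le> n + n + n" by (intro add_mono card_image_le[THEN order.trans]) auto
    finally have cd: "real (card (?N - T)) \<le> 3 * real n" by linarith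
    have "\<bar>R1 w\<bar> \<le> (\<Sum>q\<in>?N - T. c / real n)"
      unfolding R1_def
    proof (rule order.trans[OF sum_abs sum_mono])
      fix q assume "q \<in> ?N - T"
      then show "\<bar>case q of (j, k) \<Rightarrow> e w j k * e w i j * a j k\<bar> \<le> c / real n"
        using mult_mono[OF e2[OF w, of "fst q" "snd q" i "fst q"] a(1)[of "fst q" "snd q"]]
        by (auto simp: abs_mult case_prod_beta)
    qed
    also have "\<dots> \<le> 3 * real n * (c / real n)" using mult_right_mono[OF cd, of "c / real n"] c by simp
    finally show ?thesis using i by simp
  qed
  have R2: "\<bar>R2 w\<bar> \<le> c" if w: "w \<in> space M" for w
  proof -
    have "\<bar>R2 w\<bar> \<le> (\<Sum>q\<in>Dg. c / real n)"
      unfolding R2_def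
    proof (rule order.trans[OF sum_abs sum_mono])
      fix q assume "q \<in> Dg"
      then show "\<bar>case q of (j, k) \<Rightarrow> e w j k * a' j k\<bar> \<le> c / real n"
        using mult_mono[OF e1[OF w, of "fst q" "snd q"] a(2)[of "fst q" "snd q"]]
        by (auto simp: abs_mult Dg_def)
    qed
    also have "\<dots> = c" using i by (simp add: Dg_def card_image inj_on_def)
    finally show ?thesis .
  qed
  have decomp: "(\<Sum>j<n. \<Sum>k<n. e w j k * (e w i j * a j k + a' j k)) = S w + S1 w + S2 w + (R1 w + R2 w)" for w
  proof -
    have d0: "(\<Sum>j<n. \<Sum>k<n. e w j k * (e w i j * a j k + a' j k))
       = (\<Sum>(j,k)\<in>?N. e w j k * e w i j * a j k) + (\<Sum>(j,k)\<in>?N. e w j k * a' j k)"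
      by (simp add: sum.cartesian_product distrib_left sum.distrib case_prod_beta mult.assoc)
    have d1: "(\<Sum>(j,k)\<in>?N. e w j k * e w i j * a j k) = R1 w + S w"
      unfolding R1_def S_def
      by (subst sum.subset_diff[of T ?N]) (auto simp: T_def case_prod_beta mult_ac)
    have un: "sum f (T1 \<union> T2 \<union> Dg) = sum f T1 + sum f T2 + sum f Dg" for f :: "nat \<times> nat \<Rightarrow> real"
    proof -
      have "T1 \<inter> T2 = {}" "(T1 \<union> T2) \<inter> Dg = {}" by (auto simp: T1_def T2_def Dg_def)
      moreover have "finite Dg" by (simp add: Dg_def)
      ultimately show ?thesis using fin by (simp add: sum.union_disjoint)
    qed
    have "(\<Sum>(j,k)\<in>?N. e w j k * a' j k) = (\<Sum>(j,k)\<in>T1 \<union> T2 \<union> Dg. e w j k * a' j k)"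
      by (rule arg_cong[where f="sum _"]) (auto simp: T1_def T2_def Dg_def)
    then have "(\<Sum>(j,k)\<in>?N. e w j k * a' j k) = S1 w + S2 w + R2 w"
      unfolding un R2_def S1_def S2_def by (simp add: case_prod_beta mult_ac)
    with d0 d1 show ?thesis by simp
  qed
  have S: "(\<integral>w. (S w)\<^sup>2 \<partial>M) \<le> c\<^sup>2"
    unfolding S_def e_def
  proof (rule order.trans[OF rdpg_second_moment_orthogonal[OF A fin(1), where c="c / real n"
        and Y="\<lambda>q B. case q of (j, k) \<Rightarrow> noise r x0 B i j * noise r x0 B j k"] cardN])
    fix q q' assume q: "q \<in> T" "q' \<in> T" "q \<noteq> q'"
    obtain j k j' k' where jk: "q = (j, k)" "q' = (j', k')" by force
    let ?es = "[(i, j), (j, k), (i, j'), (j', k')]"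
    \<comment> \<open>An edge of multiplicity one: if \<open>j\<close> and \<open>j'\<close> differ,
      it is the edge from \<open>i\<close> to \<open>j\<close>, because \<open>k\<close> and
      \<open>k'\<close> avoid \<open>i\<close>; if they agree, then \<open>k\<close> and
      \<open>k'\<close> differ and the edge from \<open>j\<close> to \<open>k\<close> occurs
      once.\<close>
    have "(\<integral>w. prod_list (map (\<lambda>(i, j). noise r x0 (A w) i j) ?es) \<partial>M) = 0"
      using q jk i
      by (intro noise_prod_zero[OF A p, where e="if j = j' then edge j k else edge i j"])
         (auto simp: T_def edge_eq_iff)
    then show "(\<integral>w. (case q of (j, k) \<Rightarrow> noise r x0 (A w) i j * noise r x0 (A w) j k) *
              (case q' of (j, k) \<Rightarrow> noise r x0 (A w) i j * noise r x0 (A w) j k) \<partial>M) = 0"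
      by (simp add: jk mult_ac)
  qed (use e2 a in \<open>auto simp: T_def e_def\<close>)
  have S1: "(\<integral>w. (S1 w)\<^sup>2 \<partial>M) \<le> c\<^sup>2"
    unfolding S1_def e_def
  proof (rule order.trans[OF rdpg_second_moment_orthogonal[OF A fin(2), where c="c / real n"
        and Y="\<lambda>q B. case q of (j, k) \<Rightarrow> noise r x0 B j k"] cardN])
    fix q q' assume q: "q \<in> T1" "q' \<in> T1" "q \<noteq> q'"
    obtain j k j' k' where jk: "q = (j, k)" "q' = (j', k')" by force
    have "(\<integral>w. prod_list (map (\<lambda>(i, j). noise r x0 (A w) i j) [(j, k), (j', k')]) \<partial>M) = 0"
      using q jk by (intro noise_prod_zero[OF A p, where e="edge j k"]) (auto simp: T1_def edge_eq_iff)
    then show "(\<integral>w. (case q of (j, k) \<Rightarrow> noise r x0 (A w) j k) *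
              (case q' of (j, k) \<Rightarrow> noise r x0 (A w) j k) \<partial>M) = 0"
      by (simp add: jk mult_ac)
  qed (use e1 a in \<open>auto simp: T1_def e_def\<close>)
  have S2: "(\<integral>w. (S2 w)\<^sup>2 \<partial>M) \<le> c\<^sup>2"
    unfolding S2_def e_def
  proof (rule order.trans[OF rdpg_second_moment_orthogonal[OF A fin(3), where c="c / real n"
        and Y="\<lambda>q B. case q of (j, k) \<Rightarrow> noise r x0 B j k"] cardN])
    fix q q' assume q: "q \<in> T2" "q' \<in> T2" "q \<noteq> q'"
    obtain j k j' k' where jk: "q = (j, k)" "q' = (j', k')" by force
    have "(\<integral>w. prod_list (map (\<lambda>(i, j). noise r x0 (A w) i j) [(j, k), (j', k')]) \<partial>M) = 0"
      using q jk by (intro noise_prod_zero[OF A p, where e="edge j k"]) (auto simp: T2_def edge_eq_iff)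
    then show "(\<integral>w. (case q of (j, k) \<Rightarrow> noise r x0 (A w) j k) *
              (case q' of (j, k) \<Rightarrow> noise r x0 (A w) j k) \<partial>M) = 0"
      by (simp add: jk mult_ac)
  qed (use e1 a in \<open>auto simp: T2_def e_def\<close>)
  have sq4: "(x + y + z + t)\<^sup>2 \<le> 4 * x\<^sup>2 + 4 * y\<^sup>2 + 4 * z\<^sup>2 + 4 * t\<^sup>2" for x y z t :: real
  proof -
    have "(u + v)\<^sup>2 \<le> 2 * u\<^sup>2 + 2 * v\<^sup>2" for u v :: real
      using zero_le_power2[of "u - v"] by (simp add: power2_eq_square algebra_simps)
    from this[of "x + y" "z + t"] this[of x y] this[of z t] show ?thesis by (simp add: add.assoc)
  qed
  have intS: "integrable M (\<lambda>w. (S w)\<^sup>2)" "integrable M (\<lambda>w. (S1 w)\<^sup>2)" "integrable M (\<lambda>w. (S2 w)\<^sup>2)"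
    unfolding S_def S1_def S2_def e_def
    by (rule int[of "\<lambda>B. (\<Sum>q\<in>T. (case q of (j, k) \<Rightarrow> a j k) * (case q of (j, k) \<Rightarrow> noise r x0 B i j * noise r x0 B j k))\<^sup>2"],
        rule int[of "\<lambda>B. (\<Sum>q\<in>T1. (case q of (j, k) \<Rightarrow> a' j k) * (case q of (j, k) \<Rightarrow> noise r x0 B j k))\<^sup>2"],
        rule int[of "\<lambda>B. (\<Sum>q\<in>T2. (case q of (j, k) \<Rightarrow> a' j k) * (case q of (j, k) \<Rightarrow> noise r x0 B j k))\<^sup>2"])
  have "(\<integral>w. (\<Sum>j<n. \<Sum>k<n. e w j k * (e w i j * a j k + a' j k))\<^sup>2 \<partial>M)
      \<le> (\<integral>w. 4 * (S w)\<^sup>2 + 4 * (S1 w)\<^sup>2 + 4 * (S2 w)\<^sup>2 + 64 * c\<^sup>2 \<partial>M)"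
  proof (rule integral_mono)
    show "integrable M (\<lambda>w. (\<Sum>j<n. \<Sum>k<n. e w j k * (e w i j * a j k + a' j k))\<^sup>2)"
      unfolding e_def by (rule int[of "\<lambda>B. (\<Sum>j<n. \<Sum>k<n. noise r x0 B j k * (noise r x0 B i j * a j k + a' j k))\<^sup>2"])
    fix w assume w: "w \<in> space M"
    have "\<bar>R1 w + R2 w\<bar> \<le> 4 * c" using R1[OF w] R2[OF w] by linarith
    then have "(R1 w + R2 w)\<^sup>2 \<le> (4 * c)\<^sup>2" using power_mono[of "\<bar>R1 w + R2 w\<bar>" "4 * c" 2] by simp
    then show "(\<Sum>j<n. \<Sum>k<n. e w j k * (e w i j * a j k + a' j k))\<^sup>2 \<le> 4 * (S w)\<^sup>2 + 4 * (S1 w)\<^sup>2 + 4 * (S2 w)\<^sup>2 + 64 * c\<^sup>2"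
      unfolding decomp using sq4[of "S w" "S1 w" "S2 w" "R1 w + R2 w"] by (simp add: power_mult_distrib)
  qed (use intS in auto)
  also have "\<dots> = 4 * (\<integral>w. (S w)\<^sup>2 \<partial>M) + 4 * (\<integral>w. (S1 w)\<^sup>2 \<partial>M) + 4 * (\<integral>w. (S2 w)\<^sup>2 \<partial>M) + 64 * c\<^sup>2"
    using intS by (simp add: prob_space)
  also have "\<dots> \<le> 76 * c\<^sup>2" using S S1 S2 by simp
  finally show ?thesis .
qed

text \<open>The diagonal summand is left out because it is deterministic and not centred. The other
  entries of the row are distinct independent edges with values in an interval of length 2.\<close>

lemma rdpg_row_hoeffding:
  assumes A: "is_rdpg M n r x0 A" and p: "\<And>i j. 0 \<le> r * (x0 i \<bullet> x0 j)" "\<And>i j. r * (x0 i \<bullet> x0 j) \<le> 1"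
    and i: "i < n" and n: "2 \<le> n" and t: "0 \<le> t"
    and a: "\<And>j. j < n \<Longrightarrow> \<bar>a j\<bar> \<le> 1"
  shows "measure M {w \<in> space M. t \<le> \<bar>\<Sum>j\<in>{..<n} - {i}. noise r x0 (A w) i j * a j\<bar>} \<le> 2 * exp (- t\<^sup>2 / (2 * real n))"
proof -
  interpret prob_space M by (rule is_rdpgD(1)[OF A])
  let ?J = "{..<n} - {i}" and ?I = "edge i ` ({..<n} - {i})"
  \<comment> \<open>The endpoint other than \<open>i\<close> is recovered from the sum of the
    endpoints, so that the weight becomes a function of the edge.\<close>
  have other: "fst (edge i j) + snd (edge i j) - i = j" for j
    by (auto simp: edge_def min_def max_def)
  define X where "X e w = noise r x0 (A w) (fst e) (snd e) * a (fst e + snd e - i)" for e w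
  have sub: "?I \<subseteq> upairs n" using i by (auto intro!: edge_upairs)
  have X1: "\<bar>X e w\<bar> \<le> 1" if "e \<in> ?I" "w \<in> space M" for e w
  proof -
    have "\<bar>a (fst e + snd e - i)\<bar> \<le> 1" using that(1) other a by auto
    then show ?thesis
      using mult_mono[OF abs_noise_le[OF A p that(2), of "fst e" "snd e"]] by (fastforce simp: X_def abs_mult)
  qed
  have "indep_vars (\<lambda>_. borel) X ?I"
    unfolding X_def
    by (rule indep_vars_compose2[OF indep_vars_subset[OF rdpg_noise_indep[OF A] sub]]) auto
  then interpret H: Hoeffding_ineq M ?I X "\<lambda>_. -1" "\<lambda>_. 1" "\<Sum>e\<in>?I. expectation (X e)"
    by unfold_locales (use X1 in \<open>auto simp: abs_le_iff intro!: AE_I2\<close>)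
  have "expectation (X e) = 0" if "e \<in> ?I" for e
  proof -
    have "fst e < snd e" "snd e < n" using that sub by (auto simp: upairs_def)
    then have "expectation (\<lambda>w. noise r x0 (A w) (fst e) (snd e)) = 0"
      by (rule rdpg_noise_mean[OF A p])
    then show ?thesis by (simp add: X_def[abs_def])
  qed
  then have mu: "(\<Sum>e\<in>?I. expectation (X e)) = 0" by simp
  have inj: "inj_on (edge i) ?J" by (auto simp: inj_on_def edge_eq_iff)
  have card: "card ?I = n - 1" using i by (simp add: card_image[OF inj])
  have sum: "(\<Sum>e\<in>?I. X e w) = (\<Sum>j\<in>?J. noise r x0 (A w) i j * a j)" if "w \<in> space M" for w
    by (simp add: sum.reindex[OF inj] X_def other noise_edge[OF A that, symmetric])
  have "prob {w \<in> space M. t \<le> \<bar>\<Sum>j\<in>?J. noise r x0 (A w) i j * a j\<bar>}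
     = prob {w \<in> space M. \<bar>(\<Sum>e\<in>?I. X e w) - (\<Sum>e\<in>?I. expectation (X e))\<bar> \<ge> t}"
    unfolding mu by (intro arg_cong[where f=prob]) (auto simp: sum)
  also have "\<dots> \<le> 2 * exp (- 2 * t\<^sup>2 / (\<Sum>e\<in>?I. (1 - - 1)\<^sup>2))"
    using n t by (intro H.Hoeffding_ineq_abs_ge) (auto simp: card)
  also have "\<dots> = 2 * exp (- (t\<^sup>2 / (2 * (real n - 1))))"
  proof -
    have "(\<Sum>e\<in>?I. (1 - - 1)\<^sup>2) = 2 * (2 * (real n - 1))" using n by (simp add: card of_nat_diff)
    then have "- 2 * t\<^sup>2 / (\<Sum>e\<in>?I. (1 - - 1)\<^sup>2) = - (2 * t\<^sup>2 / (2 * (2 * (real n - 1))))" by (simp only: minus_divide_left mult_minus_left)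
    then show ?thesis by (simp only: mult_divide_mult_cancel_left_if) simp
  qed
  also have "\<dots> \<le> 2 * exp (- (t\<^sup>2 / (2 * real n)))"
    using n by (intro mult_left_mono) (auto intro!: divide_left_mono)
  finally show ?thesis by simp
qed

text \<open>At the level \<open>?t\<close>, twice the square root of \<open>n * ln n\<close>,
  Hoeffding's inequality gives \<open>2 / n\<^sup>2\<close> per row, hence \<open>2 / n\<close> for
  all rows. The diagonal summand is at most \<open>1 \<le> ?t\<close>, which explains the factor 4
  instead of 2; \<open>3 \<le> n\<close> ensures \<open>ln n \<ge> 1\<close>.\<close>

lemma rdpg_row_sums_scalar:
  assumes A: "is_rdpg M n r x0 A" and p: "\<And>i j. 0 \<le> r * (x0 i \<bullet> x0 j)" "\<And>i j. r * (x0 i \<bullet> x0 j) \<le> 1"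
    and n: "3 \<le> n"
    and a: "\<And>i j. i < n \<Longrightarrow> j < n \<Longrightarrow> \<bar>a i j\<bar> \<le> 1"
  shows "measure M {w \<in> space M. \<exists>i<n. 4 * sqrt (real n * ln (real n)) < \<bar>\<Sum>j<n. noise r x0 (A w) i j * a i j\<bar>} \<le> 2 / real n"
proof -
  interpret prob_space M by (rule is_rdpgD(1)[OF A])
  let ?t = "2 * sqrt (real n * ln (real n))"
  have "exp (1::real) \<le> real n" using exp_le n by linarith
  then have ln1: "1 \<le> ln (real n)" using n by (subst ln_ge_iff) auto
  have "1 \<le> real n * ln (real n)" using mult_mono[of 1 "real n" 1 "ln (real n)"] ln1 n by auto
  then have "1 \<le> sqrt (real n * ln (real n))" by (rule real_sqrt_ge_one)
  then have t1: "1 \<le> ?t" by linarith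
  let ?B = "\<lambda>i. {w \<in> space M. ?t \<le> \<bar>\<Sum>j\<in>{..<n} - {i}. noise r x0 (A w) i j * a i j\<bar>}"
  have meas: "?B i \<in> sets M" for i
    by (rule rdpg_sets[OF A, of "\<lambda>B. ?t \<le> \<bar>\<Sum>j\<in>{..<n} - {i}. noise r x0 B i j * a i j\<bar>"])
  have "{w \<in> space M. \<exists>i<n. 4 * sqrt (real n * ln (real n)) < \<bar>\<Sum>j<n. noise r x0 (A w) i j * a i j\<bar>} \<subseteq> (\<Union>i\<in>{..<n}. ?B i)"
  proof clarify
    fix w i assume w: "w \<in> space M" and i: "i < n"
      and *: "4 * sqrt (real n * ln (real n)) < \<bar>\<Sum>j<n. noise r x0 (A w) i j * a i j\<bar>"
    have "\<bar>noise r x0 (A w) i i * a i i\<bar> \<le> 1"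
      using mult_mono[OF abs_noise_le[OF A p w, of i i] a[OF i i]] by (simp add: abs_mult)
    then have "?t \<le> \<bar>\<Sum>j\<in>{..<n} - {i}. noise r x0 (A w) i j * a i j\<bar>"
      using * t1 i by (subst (asm) sum.remove[of _ i]) auto
    then show "w \<in> (\<Union>i\<in>{..<n}. ?B i)" using w i by auto
  qed
  then have "measure M {w \<in> space M. \<exists>i<n. 4 * sqrt (real n * ln (real n)) < \<bar>\<Sum>j<n. noise r x0 (A w) i j * a i j\<bar>}
     \<le> measure M (\<Union>i\<in>{..<n}. ?B i)"
    by (rule finite_measure_mono) (intro sets.finite_UN finite_lessThan meas)
  also have "\<dots> \<le> (\<Sum>i<n. measure M (?B i))"
    by (rule measure_UNION_le[OF finite_lessThan meas])
  also have "\<dots> \<le> (\<Sum>i<n. 2 * exp (- ?t\<^sup>2 / (2 * real n)))"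
    using n t1 a by (intro sum_mono rdpg_row_hoeffding[OF A p]) auto
  also have "?t\<^sup>2 / (2 * real n) = 2 * ln (real n)"
    using n ln1 by (simp add: power_mult_distrib)
  then have "- ?t\<^sup>2 / (2 * real n) = - ln (real n) + - ln (real n)" by simp
  also have "exp \<dots> = 1 / (real n * real n)" using n unfolding exp_add by (simp add: exp_minus inverse_eq_divide)
  finally show ?thesis using n by simp
qed

text \<open>Applied coordinatewise with weights divided by \<open>c\<close>. The l1 bound of the
  norm puts one factor \<open>CARD('e)\<close> into the threshold, the union over coordinates
  another into the probability.\<close>

lemma rdpg_row_sums:
  fixes a :: "nat \<Rightarrow> nat \<Rightarrow> real ^ 'e" and c :: real
  assumes A: "is_rdpg M n r x0 A" and p: "\<And>i j. 0 \<le> r * (x0 i \<bullet> x0 j)" "\<And>i j. r * (x0 i \<bullet> x0 j) \<le> 1"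
    and n: "3 \<le> n" and c: "0 < c"
    and a: "\<And>i j. i < n \<Longrightarrow> j < n \<Longrightarrow> norm (a i j) \<le> c"
  shows "measure M {w \<in> space M. \<exists>i<n. 4 * real CARD('e) * c * sqrt (real n * ln (real n)) < norm (\<Sum>j<n. noise r x0 (A w) i j *\<^sub>R a i j)}
     \<le> 2 * real CARD('e) / real n"
proof -
  interpret prob_space M by (rule is_rdpgD(1)[OF A])
  let ?t = "4 * sqrt (real n * ln (real n))"
  let ?B = "\<lambda>l. {w \<in> space M. \<exists>i<n. ?t < \<bar>\<Sum>j<n. noise r x0 (A w) i j * (a i j $ l / c)\<bar>}"
  have meas: "?B l \<in> sets M" for l
    by (rule rdpg_sets[OF A, of "\<lambda>B. \<exists>i<n. ?t < \<bar>\<Sum>j<n. noise r x0 B i j * (a i j $ l / c)\<bar>"])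
  have "{w \<in> space M. \<exists>i<n. 4 * real CARD('e) * c * sqrt (real n * ln (real n)) < norm (\<Sum>j<n. noise r x0 (A w) i j *\<^sub>R a i j)}
     \<subseteq> (\<Union>l\<in>UNIV. ?B l)"
  proof (rule subsetI, rule ccontr)
    fix w
    assume "w \<in> {w \<in> space M. \<exists>i<n. 4 * real CARD('e) * c * sqrt (real n * ln (real n)) < norm (\<Sum>j<n. noise r x0 (A w) i j *\<^sub>R a i j)}"
    then obtain i where w: "w \<in> space M" "i < n" and *: "4 * real CARD('e) * c * sqrt (real n * ln (real n)) < norm (\<Sum>j<n. noise r x0 (A w) i j *\<^sub>R a i j)"
      by (elim CollectE conjE exE)
    assume "w \<notin> (\<Union>l\<in>UNIV. ?B l)"
    then have nB: "w \<notin> ?B l" for l by (rule contrapos_nn) (rule UN_I[OF UNIV_I])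
    have "norm (\<Sum>j<n. noise r x0 (A w) i j *\<^sub>R a i j) \<le> (\<Sum>l\<in>UNIV. \<bar>(\<Sum>j<n. noise r x0 (A w) i j *\<^sub>R a i j) $ l\<bar>)"
      by (rule norm_le_l1_cart)
    also have "\<dots> \<le> (\<Sum>l\<in>(UNIV :: 'e set). c * ?t)"
    proof (rule sum_mono)
      fix l
      have "\<bar>\<Sum>j<n. noise r x0 (A w) i j * (a i j $ l / c)\<bar> \<le> ?t"
      proof (rule ccontr)
        assume "\<not> ?thesis"
        then have "?t < \<bar>\<Sum>j<n. noise r x0 (A w) i j * (a i j $ l / c)\<bar>" by (rule not_le_imp_less)
        then have "w \<in> ?B l" using w(1) by (intro CollectI conjI exI[of _ i] w(2))
        with nB[of l] show False by (rule notE)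
      qed
      then have "c * \<bar>\<Sum>j<n. noise r x0 (A w) i j * (a i j $ l / c)\<bar> \<le> c * ?t" using c by simp
      moreover have "c * \<bar>\<Sum>j<n. noise r x0 (A w) i j * (a i j $ l / c)\<bar> = \<bar>c * (\<Sum>j<n. noise r x0 (A w) i j * (a i j $ l / c))\<bar>"
        using c by (simp add: abs_mult)
      moreover have "c * (\<Sum>j<n. noise r x0 (A w) i j * (a i j $ l / c)) = (\<Sum>j<n. noise r x0 (A w) i j *\<^sub>R a i j) $ l"
        using c by (simp add: sum_distrib_left)
      ultimately show "\<bar>(\<Sum>j<n. noise r x0 (A w) i j *\<^sub>R a i j) $ l\<bar> \<le> c * ?t" by simp
    qed
    also have "\<dots> = 4 * real CARD('e) * c * sqrt (real n * ln (real n))" by simp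
    finally show False using * by simp
  qed
  then have "measure M {w \<in> space M. \<exists>i<n. 4 * real CARD('e) * c * sqrt (real n * ln (real n)) < norm (\<Sum>j<n. noise r x0 (A w) i j *\<^sub>R a i j)}
     \<le> measure M (\<Union>l\<in>UNIV. ?B l)"
    by (rule finite_measure_mono) (intro sets.finite_UN finite meas)
  also have "\<dots> \<le> (\<Sum>l\<in>UNIV. measure M (?B l))"
    by (rule measure_UNION_le[OF finite meas])
  also have "\<dots> \<le> (\<Sum>l\<in>(UNIV::'e set). 2 / real n)"
  proof (intro sum_mono rdpg_row_sums_scalar[OF A p n])
    fix l i j assume "i < n" "j < n"
    then have "\<bar>a i j $ l\<bar> \<le> c" by (intro order.trans[OF component_le_norm_cart a])
    then show "\<bar>a i j $ l / c\<bar> \<le> 1" using c by simp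
  qed
  finally show ?thesis by (simp add: mult.commute)
qed

lemma rdpg_quadratic_second_moment_vec:
  fixes a a' :: "nat \<Rightarrow> nat \<Rightarrow> real ^ 'e" and c :: real
  assumes A: "is_rdpg M n r x0 A" and p: "\<And>i j. 0 \<le> r * (x0 i \<bullet> x0 j)" "\<And>i j. r * (x0 i \<bullet> x0 j) \<le> 1"
    and i: "i < n" and c: "0 \<le> c"
    and a: "\<And>j k. j < n \<Longrightarrow> k < n \<Longrightarrow> norm (a j k) \<le> c / real n" "\<And>j k. j < n \<Longrightarrow> k < n \<Longrightarrow> norm (a' j k) \<le> c / real n"
  shows "(\<integral>w. (norm (\<Sum>j<n. \<Sum>k<n. noise r x0 (A w) j k *\<^sub>R (noise r x0 (A w) i j *\<^sub>R a j k + a' j k)))\<^sup>2 \<partial>M)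
     \<le> 76 * real CARD('e) * c\<^sup>2"
proof -
  have nv: "(norm v)\<^sup>2 = (\<Sum>l\<in>UNIV. (v $ l)\<^sup>2)" for v :: "real ^ 'e"
    by (simp only: power2_norm_eq_inner inner_vec_def) (simp add: power2_eq_square)
  have "(\<integral>w. (norm (\<Sum>j<n. \<Sum>k<n. noise r x0 (A w) j k *\<^sub>R (noise r x0 (A w) i j *\<^sub>R a j k + a' j k)))\<^sup>2 \<partial>M)
    = (\<integral>w. (\<Sum>l\<in>UNIV. (\<Sum>j<n. \<Sum>k<n. noise r x0 (A w) j k * (noise r x0 (A w) i j * a j k $ l + a' j k $ l))\<^sup>2) \<partial>M)"
    unfolding nv by simp
  also have "\<dots> = (\<Sum>l\<in>UNIV. \<integral>w. (\<Sum>j<n. \<Sum>k<n. noise r x0 (A w) j k * (noise r x0 (A w) i j * a j k $ l + a' j k $ l))\<^sup>2 \<partial>M)"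
    by (rule Bochner_Integration.integral_sum)
       (rule rdpg_integrable[OF A, of "\<lambda>B. (\<Sum>j<n. \<Sum>k<n. noise r x0 B j k * (noise r x0 B i j * a j k $ _ + a' j k $ _))\<^sup>2"])
  also have "\<dots> \<le> (\<Sum>l\<in>(UNIV::'e set). 76 * c\<^sup>2)"
    using a by (intro sum_mono rdpg_quadratic_second_moment[OF A p i c]) (auto intro: order.trans[OF component_le_norm_cart])
  finally show ?thesis by (simp add: mult_ac)
qed

section \<open>The remainder of the one-step estimator\<close>

lemma weighted_gram_mult:
  fixes g :: "nat \<Rightarrow> real ^ 'd"
  shows "((1 / real n) *\<^sub>R (\<Sum>j<n. w j *\<^sub>R outer_prod (g j) (g j))) *v v
    = (1 / real n) *\<^sub>R (\<Sum>j<n. (w j * (g j \<bullet> v)) *\<^sub>R g j)"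
proof -
  have "(\<Sum>j<n. w j *\<^sub>R outer_prod (g j) (g j)) *v v = (\<Sum>j<n. (w j * (g j \<bullet> v)) *\<^sub>R g j)"
  proof (induction n)
    case (Suc n)
    have "outer_prod (g n) (g n) *v v = (g n \<bullet> v) *\<^sub>R g n"
      by (simp add: vec_eq_iff matrix_vector_mult_def outer_prod_def inner_vec_def sum_distrib_left sum_distrib_right mult_ac)
    then show ?case
      using Suc by (simp add: matrix_vector_mult_add_rdistrib flip: scaleR_matrix_vector_assoc)
  qed simp
  then show ?thesis by (simp flip: scaleR_matrix_vector_assoc)
qed

lemma invertible_of_trivial_kernel:
  fixes B :: "real ^ 'd ^ 'd"
  assumes "\<And>v. B *v v = 0 \<Longrightarrow> v = 0"
  shows "invertible B"
  using assms invertible_left_inverse matrix_left_invertible_ker by blast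

lemma mult_matrix_inv:
  fixes B :: "real ^ 'd ^ 'd"
  assumes "invertible B"
  shows "B *v (matrix_inv B *v v) = v"
proof -
  have "B ** matrix_inv B = mat 1"
    using assms unfolding invertible_def matrix_inv_def by (rule someI2_ex) blast
  then show ?thesis by (simp add: matrix_vector_mul_assoc)
qed

lemma transpose_orthogonal_inner:
  fixes W :: "real ^ 'd ^ 'd"
  assumes "orthogonal_matrix W"
  shows "(transpose W *v v) \<bullet> (transpose W *v w) = v \<bullet> w"
proof -
  have "(transpose W *v v) \<bullet> (transpose W *v w) = v \<bullet> (W *v (transpose W *v w))"
    by (simp add: dot_lmul_matrix)
  also have "W *v (transpose W *v w) = w"
    using assms unfolding orthogonal_matrix_def by (simp only: matrix_vector_mul_assoc matrix_vector_mul_lid)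
  finally show ?thesis .
qed

lemma matrix_vector_mult_sum:
  fixes B :: "real ^ 'd ^ 'e"
  shows "B *v (\<Sum>j\<in>I. g j) = (\<Sum>j\<in>I. B *v g j)"
  by (rule linear_sum[OF matrix_vector_mul_linear])

text \<open>Coercivity passes from the unweighted Gram matrix to \<open>G_mat\<close> because all
  weights are at least 1. The leading term is thereby expressed as the solution of a normal
  equation, the form in which it is compared with the Newton step.\<close>

lemma G_mat_inverse:
  fixes x0 :: "nat \<Rightarrow> real ^ 'd" and e :: "nat \<Rightarrow> real"
  assumes r: "0 \<le> r" "r \<le> 1" and \<delta>: "0 < \<delta>" and c: "0 < c"
    and xx: "\<And>j. j < n \<Longrightarrow> x \<bullet> x0 j \<in> {\<delta>..1 - \<delta>}"
    and coer: "\<And>v. c * (norm v)\<^sup>2 \<le> (1 / real n) * (\<Sum>j<n. (v \<bullet> x0 j)\<^sup>2)"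
  defines "t \<equiv> \<lambda>j. phi r (x \<bullet> x0 j)"
  defines "g \<equiv> matrix_inv (G_mat x0 r n x) *v ((1 / real n) *\<^sub>R (\<Sum>j<n. (e j * t j) *\<^sub>R x0 j))"
  shows "(1 / real n) *\<^sub>R (\<Sum>j<n. (t j * (x0 j \<bullet> g)) *\<^sub>R x0 j) = (1 / real n) *\<^sub>R (\<Sum>j<n. (e j * t j) *\<^sub>R x0 j)"
    and "c * norm g \<le> norm ((1 / real n) *\<^sub>R (\<Sum>j<n. (e j * t j) *\<^sub>R x0 j))"
proof -
  have G: "G_mat x0 r n x *v v = (1 / real n) *\<^sub>R (\<Sum>j<n. (t j * (x0 j \<bullet> v)) *\<^sub>R x0 j)" for v
    unfolding G_mat_def weighted_gram_mult by (simp add: t_def phi_def)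
  have cG: "c * norm v \<le> norm (G_mat x0 r n x *v v)" for v
    unfolding G using phi_bounds(1)[OF r \<delta> xx] coer[of v] c
    by (intro coercive_bound) (auto simp: t_def inner_commute)
  have "invertible (G_mat x0 r n x)"
  proof (rule invertible_of_trivial_kernel)
    fix v assume "G_mat x0 r n x *v v = 0"
    then have "c * norm v \<le> 0" using cG[of v] by simp
    then show "v = 0" using c by (simp add: mult_le_0_iff)
  qed
  then have Gg: "G_mat x0 r n x *v g = (1 / real n) *\<^sub>R (\<Sum>j<n. (e j * t j) *\<^sub>R x0 j)"
    unfolding g_def by (rule mult_matrix_inv)
  show "(1 / real n) *\<^sub>R (\<Sum>j<n. (t j * (x0 j \<bullet> g)) *\<^sub>R x0 j) = (1 / real n) *\<^sub>R (\<Sum>j<n. (e j * t j) *\<^sub>R x0 j)"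
    using Gg unfolding G .
  show "c * norm g \<le> norm ((1 / real n) *\<^sub>R (\<Sum>j<n. (e j * t j) *\<^sub>R x0 j))"
    using cG[of g] unfolding Gg .
qed

text \<open>The Newton step commutes with rotations, so it can be computed in the aligned
  coordinates \<open>u\<close>. There the information matrix carries no power of \<open>r\<close>
  and the score a factor \<open>1 / sqrt r\<close>; hence \<open>sqrt r\<close> times the increment
  solves an equation in \<open>u\<close> alone. Coercivity yields invertibility, so the row is
  indeed given by its defining formula.\<close>

lemma one_step_rotated:
  fixes x0 X Xh :: "nat \<Rightarrow> real ^ 'd" and W :: "real ^ 'd ^ 'd" and f
  assumes r: "0 < r" "r \<le> 1" and d: "0 < d" and c: "0 < c" and i: "i < n" and W: "orthogonal_matrix W"
    and u: "\<And>j. j < n \<Longrightarrow> transpose W *v X j = sqrt r *\<^sub>R u j"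
    and uu: "\<And>j. j < n \<Longrightarrow> u i \<bullet> u j \<in> {d..1 - d}"
    and coer: "\<And>v. c * (norm v)\<^sup>2 \<le> (1 / real n) * (\<Sum>j<n. (u j \<bullet> v)\<^sup>2)"
    and step: "is_one_step n B X Xh"
  defines "s \<equiv> \<lambda>j. phi r (u i \<bullet> u j)"
  shows "\<exists>z. (\<Sum>j<n. (s j * (u j \<bullet> z)) *\<^sub>R u j) = (\<Sum>j<n. ((B i j - r * (u i \<bullet> u j)) * s j) *\<^sub>R u j)
     \<and> sqrt r *\<^sub>R (transpose W *v Xh i) = r *\<^sub>R u i + z"
proof -
  let ?T = "\<lambda>v. transpose W *v v"
  have sr: "0 < sqrt r" "sqrt r * sqrt r = r" using r by auto
  have XX: "X i \<bullet> X j = r * (u i \<bullet> u j)" if "j < n" for j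
    using transpose_orthogonal_inner[OF W, of "X i" "X j"] u[OF i] u[OF that] sr by (simp add: mult.assoc[symmetric])
  have Xv: "X j \<bullet> v = sqrt r * (u j \<bullet> ?T v)" if "j < n" for j v
    using transpose_orthogonal_inner[OF W, of "X j" v] u[OF that] by simp
  have w: "1 / ((X i \<bullet> X j) * (1 - X i \<bullet> X j)) = s j / r" if "j < n" for j
    using r by (simp add: XX[OF that] s_def phi_def)
  have s1: "1 \<le> s j" "(u i \<bullet> u j) * (1 - r * (u i \<bullet> u j)) * s j = 1" if "j < n" for j
    using phi_bounds[OF _ r(2) d uu[OF that]] r unfolding s_def by auto
  have nz: "(X i \<bullet> X j) * (1 - X i \<bullet> X j) \<noteq> 0" if "j < n" for j
  proof -
    have "(u i \<bullet> u j) * (1 - r * (u i \<bullet> u j)) \<noteq> 0" using s1(2)[OF that] by force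
    then show ?thesis using r by (simp add: XX[OF that])
  qed
  have info: "one_step_info n X i *v v = (1 / real n) *\<^sub>R (\<Sum>j<n. (s j / r * (X j \<bullet> v)) *\<^sub>R X j)" for v
    unfolding one_step_info_def weighted_gram_mult using w by (intro arg_cong[where f="scaleR _"] sum.cong) auto
  have Tinfo: "?T (one_step_info n X i *v v) = (1 / real n) *\<^sub>R (\<Sum>j<n. (s j * (u j \<bullet> ?T v)) *\<^sub>R u j)" for v
    unfolding info matrix_vector_mult_scaleR matrix_vector_mult_sum
  proof (intro arg_cong[where f="scaleR _"] sum.cong refl)
    fix j assume "j \<in> {..<n}"
    then have j: "j < n" by simp
    have "s j / r * (sqrt r * (u j \<bullet> ?T v)) * sqrt r = s j * (u j \<bullet> ?T v) * (sqrt r * sqrt r) / r"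
      by (simp only: times_divide_eq_left times_divide_eq_right mult_ac)
    also have "\<dots> = s j * (u j \<bullet> ?T v)" using sr(2) r by simp
    finally show "(s j / r * (X j \<bullet> v)) *\<^sub>R ?T (X j) = (s j * (u j \<bullet> ?T v)) *\<^sub>R u j"
      unfolding Xv[OF j] u[OF j] by simp
  qed
  have inv: "invertible (one_step_info n X i)"
  proof (rule invertible_of_trivial_kernel)
    fix v assume "one_step_info n X i *v v = 0"
    then have "(1 / real n) *\<^sub>R (\<Sum>j<n. (s j * (u j \<bullet> ?T v)) *\<^sub>R u j) = 0"
      using Tinfo[of v] by simp
    moreover have "c * norm (?T v) \<le> norm ((1 / real n) *\<^sub>R (\<Sum>j<n. (s j * (u j \<bullet> ?T v)) *\<^sub>R u j))"
      by (rule coercive_bound[OF c s1(1) coer])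
    ultimately have "c * norm (?T v) \<le> 0" by (simp only: norm_zero)
    then have "?T v = 0" using c by (simp add: mult_le_0_iff)
    then show "v = 0" using transpose_orthogonal_inner[OF W, of v v] by simp
  qed
  then have "one_step_defined n X i" using nz by (simp add: one_step_defined_def)
  then have Xh: "Xh i = X i + matrix_inv (one_step_info n X i) *v one_step_score n B X i" (is "_ = _ + ?z0")
    using step i by (simp add: is_one_step_def)
  define z where "z = sqrt r *\<^sub>R ?T ?z0"
  have "(1 / real n) *\<^sub>R (\<Sum>j<n. (s j * (u j \<bullet> ?T ?z0)) *\<^sub>R u j) = ?T (one_step_score n B X i)"
    by (simp only: Tinfo[symmetric] mult_matrix_inv[OF inv])
  also have "\<dots> = (1 / real n) *\<^sub>R (\<Sum>j<n. ((B i j - r * (u i \<bullet> u j)) * s j / sqrt r) *\<^sub>R u j)"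
    unfolding one_step_score_def matrix_vector_mult_scaleR matrix_vector_mult_sum
  proof (intro arg_cong[where f="scaleR _"] sum.cong refl)
    fix j assume "j \<in> {..<n}"
    then have j: "j < n" by simp
    have "(B i j - X i \<bullet> X j) / ((X i \<bullet> X j) * (1 - X i \<bullet> X j)) = (B i j - r * (u i \<bullet> u j)) * (s j / r)"
      unfolding w[OF j, symmetric] by (simp add: XX[OF j])
    also have "\<dots> * sqrt r = (B i j - r * (u i \<bullet> u j)) * s j / sqrt r"
    proof -
      have "sqrt r / r = 1 / sqrt r" by (subst frac_eq_eq) (use sr r in auto)
      moreover have "(B i j - r * (u i \<bullet> u j)) * (s j / r) * sqrt r = (B i j - r * (u i \<bullet> u j)) * s j * (sqrt r / r)"
        by (simp only: times_divide_eq_left times_divide_eq_right mult_ac)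
      ultimately show ?thesis by simp
    qed
    finally show "((B i j - X i \<bullet> X j) / ((X i \<bullet> X j) * (1 - X i \<bullet> X j))) *\<^sub>R ?T (X j) = ((B i j - r * (u i \<bullet> u j)) * s j / sqrt r) *\<^sub>R u j"
      by (simp only: u[OF j] scaleR_scaleR)
  qed
  finally have "(\<Sum>j<n. (s j * (u j \<bullet> ?T ?z0)) *\<^sub>R u j) = (\<Sum>j<n. ((B i j - r * (u i \<bullet> u j)) * s j / sqrt r) *\<^sub>R u j)"
    using i by simp
  then have "sqrt r *\<^sub>R (\<Sum>j<n. (s j * (u j \<bullet> ?T ?z0)) *\<^sub>R u j) = sqrt r *\<^sub>R (\<Sum>j<n. ((B i j - r * (u i \<bullet> u j)) * s j / sqrt r) *\<^sub>R u j)"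
    by simp
  then have "(\<Sum>j<n. (s j * (u j \<bullet> z)) *\<^sub>R u j) = (\<Sum>j<n. ((B i j - r * (u i \<bullet> u j)) * s j) *\<^sub>R u j)"
    using sr(1) unfolding z_def by (simp add: scaleR_sum_right mult_ac)
  moreover have "sqrt r *\<^sub>R ?T (Xh i) = r *\<^sub>R u i + z"
    unfolding Xh z_def matrix_vector_right_distrib using u[OF i] sr(2) by (simp add: scaleR_right_distrib)
  ultimately show ?thesis by blast
qed

text \<open>The number \<open>s\<close> is the common scale: noise sums weighted by \<zeta> are of
  order \<open>r * s\<close> and remainders of order \<open>sqrt r * s\<close>, so both parts of
  \<open>f j\<close> are of order \<open>s\<close> after division by \<open>r\<close> and
  \<open>sqrt r\<close>. The form \<open>Q\<close> is kept in the bound, since only its second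
  moment is available.\<close>

lemma one_step_remainder:
  fixes x0 X Xh R :: "nat \<Rightarrow> real ^ 'd" and \<zeta> :: "nat \<Rightarrow> nat \<Rightarrow> real ^ 'd" and W :: "real ^ 'd ^ 'd"
    and B :: adj and r \<delta> c c1 c2 c3 s :: real and n i :: nat
  defines "e \<equiv> noise r x0 B"
  defines "b \<equiv> 1 / (\<delta> / 2)\<^sup>2"
  defines "t \<equiv> \<lambda>i j. phi r (x0 i \<bullet> x0 j)" and "t' \<equiv> \<lambda>i j. dphi r (x0 i \<bullet> x0 j)"
  defines "Q \<equiv> \<Sum>j<n. \<Sum>k<n. e j k *\<^sub>R (e i j *\<^sub>R (t i j *\<^sub>R \<zeta> j k + (t' i j * (x0 i \<bullet> \<zeta> j k)) *\<^sub>R x0 j)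
      + (- (r * t i j * (x0 i \<bullet> \<zeta> j k))) *\<^sub>R x0 j)"
  assumes r: "0 < r" "r \<le> 1" and \<delta>: "0 < \<delta>" and c: "0 < c" "0 \<le> c1" "0 \<le> c2" "0 \<le> c3" "0 \<le> s" and i: "i < n"
    and xx: "\<And>i j. x0 i \<bullet> x0 j \<in> {\<delta>..1 - \<delta>}" and x1: "\<And>j. norm (x0 j) \<le> 1"
    and coer: "\<And>v. c * (norm v)\<^sup>2 \<le> (1 / real n) * (\<Sum>j<n. (v \<bullet> x0 j)\<^sup>2)"
    and e: "\<And>j. \<bar>e i j\<bar> \<le> 1" and W: "orthogonal_matrix W"
    and lin: "\<And>j. j < n \<Longrightarrow> transpose W *v X j - sqrt r *\<^sub>R x0 j = (1 / sqrt r) *\<^sub>R (\<Sum>k<n. e j k *\<^sub>R \<zeta> j k) + R j"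
    and step: "is_one_step n B X Xh"
    and E1: "\<And>j. j < n \<Longrightarrow> norm (\<Sum>k<n. e j k *\<^sub>R \<zeta> j k) \<le> c1 * r * s"
    and E2: "\<And>l. norm (\<Sum>j<n. e i j *\<^sub>R ((t' i j * x0 j $ l) *\<^sub>R x0 j)) \<le> c2 * real n * s"
    and E3: "norm (\<Sum>j<n. e i j *\<^sub>R (t i j *\<^sub>R x0 j)) \<le> c2 * real n * s"
    and E4: "(\<Sum>j<n. (norm (R j))\<^sup>2) \<le> c3\<^sup>2 * r * s\<^sup>2"
    and s: "1 \<le> real n * s\<^sup>2" "6 * ((c1 + c3) * s) \<le> \<delta>" "4 * ((c1 + c3) * s)\<^sup>2 \<le> c"
  shows "sqrt r * norm (transpose W *v Xh i - sqrt r *\<^sub>R x0 i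
       - (1 / (real n * sqrt r)) *\<^sub>R (\<Sum>j<n. (e i j / ((x0 i \<bullet> x0 j) * (1 - r * (x0 i \<bullet> x0 j)))) *\<^sub>R (matrix_inv (G_mat x0 r n (x0 i)) *v x0 j)))
     \<le> (4 / c) * (1 + 3 * b\<^sup>2 * c3 + real CARD('d) * (c1 + c3) * c2 + 6 * b\<^sup>2 * (c1 + c3) * c2 / c + 26 * b ^ 3 * (c1 + c3)\<^sup>2)
        * (s\<^sup>2 + norm Q / (real n * r))"
    (is "_ * norm ?Rh \<le> _")
proof -
  have n: "0 < n" using i by simp
  have sr: "0 < sqrt r" "sqrt r * sqrt r = r" using r by auto
  define \<eta> where "\<eta> = (c1 + c3) * s"
  define f where "f j = (1 / r) *\<^sub>R (\<Sum>k<n. e j k *\<^sub>R \<zeta> j k) + (1 / sqrt r) *\<^sub>R R j" for j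
  define u where "u j = x0 j + f j" for j
  have u: "transpose W *v X j = sqrt r *\<^sub>R u j" if "j < n" for j
  proof -
    have "sqrt r / r = 1 / sqrt r" by (subst frac_eq_eq) (use sr r in auto)
    then show ?thesis
      using lin[OF that] sr by (simp add: u_def f_def scaleR_right_distrib algebra_simps)
  qed
  have f: "norm (f j) \<le> \<eta>" if j: "j < n" for j
  proof -
    \<comment> \<open>One row is bounded by the whole Frobenius sum; this is crude, but only order
      \<open>s\<close> is asked of a single \<open>f j\<close>.\<close>
    have "(norm (R j))\<^sup>2 \<le> (\<Sum>j<n. (norm (R j))\<^sup>2)" using j by (intro member_le_sum) auto
    also have "\<dots> \<le> (c3 * sqrt r * s)\<^sup>2" using E4 r by (simp add: power_mult_distrib)
    finally have "norm (R j) \<le> c3 * sqrt r * s" by (rule power2_le_imp_le) (use c sr in auto)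
    then have "norm ((1 / sqrt r) *\<^sub>R R j) \<le> c3 * s" using sr by (simp add: divide_le_eq mult_ac)
    moreover have "norm ((1 / r) *\<^sub>R (\<Sum>k<n. e j k *\<^sub>R \<zeta> j k)) \<le> c1 * s"
      using E1[OF j] r by (simp add: divide_le_eq mult_ac)
    ultimately show ?thesis unfolding f_def \<eta>_def distrib_right by (intro norm_triangle_le) linarith
  qed
  have \<eta>: "6 * \<eta> \<le> \<delta>" "4 * \<eta>\<^sup>2 \<le> c" using s unfolding \<eta>_def by auto
  have "\<delta> \<le> 1 - \<delta>" using xx[of i i] by auto
  moreover have "0 \<le> \<eta>" using f[OF i] norm_ge_zero[of "f i"] by linarith
  ultimately have \<eta>1: "0 \<le> \<eta>" "\<eta> \<le> 1" using \<eta>(1) by auto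
  have uu: "u i \<bullet> u j \<in> {\<delta> / 2..1 - \<delta> / 2}" if "j < n" for j
    using perturbed_inner_diff[OF x1 x1 f[OF i] f[OF that] \<eta>1(2), of i j] xx[of i j] \<eta>(1)
    by (auto simp: u_def abs_le_iff)
  have coeru: "c / 4 * (norm v)\<^sup>2 \<le> (1 / real n) * (\<Sum>j<n. (u j \<bullet> v)\<^sup>2)" for v
    unfolding u_def by (rule perturbed_coercive[OF n f \<eta>(2) coer])
  obtain z where z: "(\<Sum>j<n. (phi r (u i \<bullet> u j) * (u j \<bullet> z)) *\<^sub>R u j)
       = (\<Sum>j<n. ((B i j - r * (u i \<bullet> u j)) * phi r (u i \<bullet> u j)) *\<^sub>R u j)"
     and Xh: "sqrt r *\<^sub>R (transpose W *v Xh i) = r *\<^sub>R u i + z"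
    using one_step_rotated[OF r _ _ i W u uu coeru step] \<delta> c by auto
  define g where "g = matrix_inv (G_mat x0 r n (x0 i)) *v ((1 / real n) *\<^sub>R (\<Sum>j<n. (e i j * t i j) *\<^sub>R x0 j))"
  have r0: "0 \<le> r" using r by simp
  have g: "(1 / real n) *\<^sub>R (\<Sum>j<n. (t i j * (x0 j \<bullet> g)) *\<^sub>R x0 j) = (1 / real n) *\<^sub>R (\<Sum>j<n. (e i j * t i j) *\<^sub>R x0 j)"
    "c * norm g \<le> norm ((1 / real n) *\<^sub>R (\<Sum>j<n. (e i j * t i j) *\<^sub>R x0 j))"
    unfolding g_def t_def by (rule G_mat_inverse[OF r0 r(2) \<delta> c(1) xx coer])+
  have gb: "norm g \<le> c2 * s / c"
  proof -
    have "c * norm g \<le> (1 / real n) * (c2 * real n * s)"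
    proof (rule order.trans[OF g(2)])
      show "norm ((1 / real n) *\<^sub>R (\<Sum>j<n. (e i j * t i j) *\<^sub>R x0 j)) \<le> (1 / real n) * (c2 * real n * s)"
        unfolding norm_scaleR using E3 by (intro mult_mono) auto
    qed
    then show ?thesis using c n by (simp add: pos_le_divide_eq mult_ac)
  qed
  have Rh: "sqrt r *\<^sub>R ?Rh = r *\<^sub>R f i + z - g"
  proof -
    have "(\<Sum>j<n. (e i j / ((x0 i \<bullet> x0 j) * (1 - r * (x0 i \<bullet> x0 j)))) *\<^sub>R (matrix_inv (G_mat x0 r n (x0 i)) *v x0 j))
        = matrix_inv (G_mat x0 r n (x0 i)) *v (\<Sum>j<n. (e i j * t i j) *\<^sub>R x0 j)"
      by (simp add: matrix_vector_mult_sum matrix_vector_mult_scaleR t_def phi_def)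
    then have "sqrt r *\<^sub>R ((1 / (real n * sqrt r)) *\<^sub>R (\<Sum>j<n. (e i j / ((x0 i \<bullet> x0 j) * (1 - r * (x0 i \<bullet> x0 j)))) *\<^sub>R (matrix_inv (G_mat x0 r n (x0 i)) *v x0 j))) = g"
      using sr(1) by (simp add: g_def matrix_vector_mult_scaleR)
    then have "sqrt r *\<^sub>R ?Rh = (r *\<^sub>R u i + z) - r *\<^sub>R x0 i - g"
      by (simp only: scaleR_diff_right scaleR_scaleR sr(2) Xh)
    then show ?thesis by (simp add: u_def scaleR_right_distrib)
  qed
  have "norm (r *\<^sub>R f i + z - g) \<le> (4 / c) *
     (norm ((1 / real n) *\<^sub>R (\<Sum>j<n. (e i j * t i j) *\<^sub>R f j + ((e i j * t' i j - r * t i j) * (x0 i \<bullet> f j)) *\<^sub>R x0 j))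
      + norm ((1 / real n) *\<^sub>R (\<Sum>j<n. (e i j * t' i j * (x0 j \<bullet> f i)) *\<^sub>R x0 j))
      + 6 * b\<^sup>2 * \<eta> * norm g + 26 * b ^ 3 * \<eta>\<^sup>2)"
    unfolding b_def t_def t'_def
  proof (rule one_step_deterministic[OF r0 r(2) \<delta> c(1) i xx x1 f \<eta> coer e])
    show "(\<Sum>j<n. (phi r ((x0 i + f i) \<bullet> (x0 j + f j)) * ((x0 j + f j) \<bullet> z)) *\<^sub>R (x0 j + f j)) =
      (\<Sum>j<n. ((e i j + r * (x0 i \<bullet> x0 j) - r * ((x0 i + f i) \<bullet> (x0 j + f j))) * phi r ((x0 i + f i) \<bullet> (x0 j + f j))) *\<^sub>R (x0 j + f j))"
      using z by (simp add: u_def e_def noise_def)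
    show "(\<Sum>j<n. (phi r (x0 i \<bullet> x0 j) * (x0 j \<bullet> g)) *\<^sub>R x0 j) = (\<Sum>j<n. (e i j * phi r (x0 i \<bullet> x0 j)) *\<^sub>R x0 j)"
      using g(1) n by (simp add: t_def)
  qed
  also have "\<dots> \<le> (4 / c) * ((norm Q / (real n * r) + 3 * b\<^sup>2 * c3 * s\<^sup>2) + real CARD('d) * (c1 + c3) * c2 * s\<^sup>2
       + 6 * b\<^sup>2 * (c1 + c3) * c2 / c * s\<^sup>2 + 26 * b ^ 3 * (c1 + c3)\<^sup>2 * s\<^sup>2)"
  proof (intro mult_left_mono add_mono)
    have d0: "0 < \<delta> / 2" and xx2: "x0 i \<bullet> x0 j \<in> {\<delta> / 2..1 - \<delta> / 2}" for j
      using \<delta> xx[of i j] by auto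
    have tb: "1 \<le> t i j" "t i j \<le> b" "\<bar>t' i j\<bar> \<le> b\<^sup>2" for j
      using phi_bounds[OF r0 r(2) d0 xx2] abs_dphi_le[OF r0 r(2) d0 xx2] unfolding t_def t'_def b_def by auto
    have b1: "1 \<le> b" "b \<le> b\<^sup>2" using tb(1,2)[of i] by (auto simp: power_increasing[of 1 2 b, simplified])
    \<comment> \<open>The summand of the linear term as a linear map of \<open>v\<close>, so that
      the expansion of \<open>f j\<close> into noise and remainder can be carried through
      it.\<close>
    define H where "H j v = (e i j * t i j) *\<^sub>R v + ((e i j * t' i j - r * t i j) * (x0 i \<bullet> v)) *\<^sub>R x0 j" for j v
    have Hlin: "linear (H j)" for j
      unfolding H_def by (intro linearI) (auto simp: inner_add_right algebra_simps)
    have Hn: "norm (H j v) \<le> 3 * b\<^sup>2 * norm v" for j v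
    proof -
      have "norm ((e i j * t i j) *\<^sub>R v) \<le> (1 * b) * norm v"
        unfolding norm_scaleR real_norm_def abs_mult[of "e i j"] using e[of j] tb[of j] b1 by (intro mult_right_mono mult_mono) auto
      moreover have "norm (((e i j * t' i j - r * t i j) * (x0 i \<bullet> v)) *\<^sub>R x0 j) \<le> ((1 * b\<^sup>2 + 1 * b) * (1 * norm v)) * 1"
        unfolding norm_scaleR real_norm_def abs_mult[of "_ - _"]
      proof (intro mult_mono)
        have "\<bar>e i j * t' i j\<bar> \<le> 1 * b\<^sup>2" "\<bar>r * t i j\<bar> \<le> 1 * b"
          unfolding abs_mult using e[of j] tb[of j] r b1 by (intro mult_mono; auto)+
        then show "\<bar>e i j * t' i j - r * t i j\<bar> \<le> 1 * b\<^sup>2 + 1 * b" by linarith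
        show "\<bar>x0 i \<bullet> v\<bar> \<le> 1 * norm v" by (rule abs_inner_le[OF x1 order_refl])
      qed (use x1 b1 in auto)
      moreover have "b * norm v \<le> b\<^sup>2 * norm v" using b1 by (intro mult_right_mono) auto
      ultimately show ?thesis unfolding H_def by (intro norm_triangle_le) (simp add: algebra_simps)
    qed
    have Hf: "H j (f j) = (1 / r) *\<^sub>R (\<Sum>k<n. e j k *\<^sub>R (e i j *\<^sub>R (t i j *\<^sub>R \<zeta> j k + (t' i j * (x0 i \<bullet> \<zeta> j k)) *\<^sub>R x0 j)
      + (- (r * t i j * (x0 i \<bullet> \<zeta> j k))) *\<^sub>R x0 j)) + (1 / sqrt r) *\<^sub>R H j (R j)" for j
    proof -
      have "H j (f j) = (1 / r) *\<^sub>R (\<Sum>k<n. e j k *\<^sub>R H j (\<zeta> j k)) + (1 / sqrt r) *\<^sub>R H j (R j)"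
        unfolding f_def by (simp only: linear_add[OF Hlin] linear_scale[OF Hlin] linear_sum[OF Hlin])
      moreover have "H j (\<zeta> j k) = e i j *\<^sub>R (t i j *\<^sub>R \<zeta> j k + (t' i j * (x0 i \<bullet> \<zeta> j k)) *\<^sub>R x0 j)
        + (- (r * t i j * (x0 i \<bullet> \<zeta> j k))) *\<^sub>R x0 j" for k
        by (simp add: H_def algebra_simps)
      ultimately show ?thesis by simp
    qed
    \<comment> \<open>Compared with the bound on single rows, Cauchy-Schwarz gains
      \<open>1 / sqrt n\<close>, which is at most \<open>s\<close> by
      \<open>1 \<le> n * s\<^sup>2\<close>; the averaged remainder thus has order
      \<open>s\<^sup>2\<close>.\<close>
    have "(\<Sum>j<n. norm (R j)) \<le> real n * (c3 * sqrt r * s\<^sup>2)"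
    proof (rule power2_le_imp_le)
      have "(\<Sum>j<n. 1 * norm (R j))\<^sup>2 \<le> (\<Sum>j<n. 1\<^sup>2) * (\<Sum>j<n. (norm (R j))\<^sup>2)"
        by (rule Cauchy_Schwarz_ineq_sum)
      also have "\<dots> \<le> real n * (c3\<^sup>2 * r * s\<^sup>2) * 1" using E4 by (simp add: mult_left_mono)
      also have "\<dots> \<le> real n * (c3\<^sup>2 * r * s\<^sup>2) * (real n * s\<^sup>2)" using s(1) r by (intro mult_left_mono) auto
      also have "\<dots> = (real n * (c3 * sqrt r * s\<^sup>2))\<^sup>2" using r by (simp add: power_mult_distrib power2_eq_square mult_ac)
      finally show "(\<Sum>j<n. norm (R j))\<^sup>2 \<le> (real n * (c3 * sqrt r * s\<^sup>2))\<^sup>2" by simp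
    qed (use c sr in auto)
    then have "(1 / (real n * sqrt r)) * (3 * b\<^sup>2 * (\<Sum>j<n. norm (R j))) \<le> (1 / (real n * sqrt r)) * (3 * b\<^sup>2 * (real n * (c3 * sqrt r * s\<^sup>2)))"
      using sr n b1 by (intro mult_left_mono) auto
    also have "\<dots> = 3 * b\<^sup>2 * c3 * s\<^sup>2" using sr(1) n by simp
    finally have RR: "(1 / (real n * sqrt r)) * (\<Sum>j<n. 3 * b\<^sup>2 * norm (R j)) \<le> 3 * b\<^sup>2 * c3 * s\<^sup>2"
      by (simp only: sum_distrib_left)
    have "(1 / real n) *\<^sub>R (\<Sum>j<n. H j (f j)) = (1 / (real n * r)) *\<^sub>R Q + (1 / (real n * sqrt r)) *\<^sub>R (\<Sum>j<n. H j (R j))"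
      unfolding Hf Q_def by (simp add: sum.distrib scaleR_right_distrib flip: scaleR_sum_right)
    also have "norm \<dots> \<le> norm Q / (real n * r) + (1 / (real n * sqrt r)) * (\<Sum>j<n. 3 * b\<^sup>2 * norm (R j))"
    proof (intro order.trans[OF norm_triangle_ineq] add_mono)
      have "norm (\<Sum>j<n. H j (R j)) \<le> (\<Sum>j<n. 3 * b\<^sup>2 * norm (R j))" by (intro sum_norm_le Hn)
      then show "norm ((1 / (real n * sqrt r)) *\<^sub>R (\<Sum>j<n. H j (R j))) \<le> (1 / (real n * sqrt r)) * (\<Sum>j<n. 3 * b\<^sup>2 * norm (R j))"
        using sr n by (simp add: divide_right_mono)
    qed (use r in simp)
    finally show "norm ((1 / real n) *\<^sub>R (\<Sum>j<n. (e i j * t i j) *\<^sub>R f j + ((e i j * t' i j - r * t i j) * (x0 i \<bullet> f j)) *\<^sub>R x0 j))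
       \<le> norm Q / (real n * r) + 3 * b\<^sup>2 * c3 * s\<^sup>2"
      using RR unfolding H_def by linarith
    \<comment> \<open>The vector \<open>f i\<close> depends on the same noise, so its coordinates
      are pulled out of the sum. What remains are row sums with deterministic weights, one for each
      coordinate \<open>l\<close>, as bounded in \<open>E2\<close>.\<close>
    have "(\<Sum>j<n. (e i j * t' i j * (x0 j \<bullet> f i)) *\<^sub>R x0 j) = (\<Sum>l\<in>UNIV. f i $ l *\<^sub>R (\<Sum>j<n. e i j *\<^sub>R ((t' i j * x0 j $ l) *\<^sub>R x0 j)))"
      unfolding scaleR_sum_right by (subst sum.swap) (simp add: inner_vec_def sum_distrib_left scaleR_sum_left mult_ac)
    also have "norm \<dots> \<le> (\<Sum>l\<in>(UNIV :: 'd set). \<eta> * (c2 * real n * s))"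
    proof (rule sum_norm_le)
      fix l
      show "norm (f i $ l *\<^sub>R (\<Sum>j<n. e i j *\<^sub>R ((t' i j * x0 j $ l) *\<^sub>R x0 j))) \<le> \<eta> * (c2 * real n * s)"
        unfolding norm_scaleR real_norm_def
        using order.trans[OF component_le_norm_cart f[OF i]] E2[of l] \<eta>1 by (intro mult_mono) auto
    qed
    finally have "norm (\<Sum>j<n. (e i j * t' i j * (x0 j \<bullet> f i)) *\<^sub>R x0 j) / real n \<le> (real CARD('d) * (\<eta> * (c2 * real n * s))) / real n"
      by (intro divide_right_mono) auto
    then show "norm ((1 / real n) *\<^sub>R (\<Sum>j<n. (e i j * t' i j * (x0 j \<bullet> f i)) *\<^sub>R x0 j)) \<le> real CARD('d) * (c1 + c3) * c2 * s\<^sup>2"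
      using n by (simp add: \<eta>_def power2_eq_square mult_ac)
    have "6 * b\<^sup>2 * \<eta> * norm g \<le> 6 * b\<^sup>2 * \<eta> * (c2 * s / c)" using gb \<eta>1 by (intro mult_left_mono) auto
    then show "6 * b\<^sup>2 * \<eta> * norm g \<le> 6 * b\<^sup>2 * (c1 + c3) * c2 / c * s\<^sup>2"
      by (simp add: \<eta>_def power2_eq_square mult_ac)
    show "26 * b ^ 3 * \<eta>\<^sup>2 \<le> 26 * b ^ 3 * (c1 + c3)\<^sup>2 * s\<^sup>2"
      by (simp add: \<eta>_def power_mult_distrib mult_ac)
  qed (use c in auto)
  also have "\<dots> \<le> (4 / c) * ((1 + 3 * b\<^sup>2 * c3 + real CARD('d) * (c1 + c3) * c2 + 6 * b\<^sup>2 * (c1 + c3) * c2 / c + 26 * b ^ 3 * (c1 + c3)\<^sup>2)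
        * (s\<^sup>2 + norm Q / (real n * r)))"
  proof (intro mult_left_mono)
    define K where "K = 3 * b\<^sup>2 * c3 + real CARD('d) * (c1 + c3) * c2 + 6 * b\<^sup>2 * (c1 + c3) * c2 / c + 26 * b ^ 3 * (c1 + c3)\<^sup>2"
    have "0 \<le> b" by (simp add: b_def)
    then have "0 \<le> K" using c by (simp add: K_def)
    moreover have "0 \<le> norm Q / (real n * r)" using r by simp
    ultimately have "norm Q / (real n * r) + K * s\<^sup>2 \<le> (1 + K) * (s\<^sup>2 + norm Q / (real n * r))"
      using mult_nonneg_nonneg[of K "norm Q / (real n * r)"] by (simp only: distrib_left distrib_right) simp
    then show "norm Q / (real n * r) + 3 * b\<^sup>2 * c3 * s\<^sup>2 + real CARD('d) * (c1 + c3) * c2 * s\<^sup>2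
       + 6 * b\<^sup>2 * (c1 + c3) * c2 / c * s\<^sup>2 + 26 * b ^ 3 * (c1 + c3)\<^sup>2 * s\<^sup>2
      \<le> (1 + 3 * b\<^sup>2 * c3 + real CARD('d) * (c1 + c3) * c2 + 6 * b\<^sup>2 * (c1 + c3) * c2 / c + 26 * b ^ 3 * (c1 + c3)\<^sup>2)
        * (s\<^sup>2 + norm Q / (real n * r))"
      by (simp only: K_def distrib_right add.assoc mult_1_left)
  qed (use c in auto)
  finally have "norm (sqrt r *\<^sub>R ?Rh) \<le> (4 / c) * ((1 + 3 * b\<^sup>2 * c3 + real CARD('d) * (c1 + c3) * c2 + 6 * b\<^sup>2 * (c1 + c3) * c2 / c + 26 * b ^ 3 * (c1 + c3)\<^sup>2)
        * (s\<^sup>2 + norm Q / (real n * r)))"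
    unfolding Rh .
  moreover have "norm (sqrt r *\<^sub>R ?Rh) = sqrt r * norm ?Rh" using sr(1) by simp
  ultimately show ?thesis by (simp only: mult.assoc)
qed

section \<open>From the deterministic bound to high probability\<close>

definition one_step_residual ::
    "(nat \<Rightarrow> real ^ 'd) \<Rightarrow> real \<Rightarrow> nat \<Rightarrow> real ^ 'd ^ 'd \<Rightarrow> adj \<Rightarrow> (nat \<Rightarrow> real ^ 'd) \<Rightarrow> nat \<Rightarrow> real ^ 'd" where
  "one_step_residual x0 r n W B Xh i =
     transpose W *v Xh i - sqrt r *\<^sub>R x0 i
       - (1 / (real n * sqrt r)) *\<^sub>R
         (\<Sum>j<n. (noise r x0 B i j / ((x0 i \<bullet> x0 j) * (1 - r * (x0 i \<bullet> x0 j)))) *\<^sub>R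
               (matrix_inv (G_mat x0 r n (x0 i)) *v x0 j))"

definition quadratic_noise ::
    "(nat \<Rightarrow> real ^ 'd) \<Rightarrow> real \<Rightarrow> nat \<Rightarrow> (nat \<Rightarrow> nat \<Rightarrow> real ^ 'd) \<Rightarrow> adj \<Rightarrow> nat \<Rightarrow> real ^ 'd" where
  "quadratic_noise x0 r n \<zeta> B i =
     (\<Sum>j<n. \<Sum>k<n. noise r x0 B j k *\<^sub>R
        (noise r x0 B i j *\<^sub>R
           (phi r (x0 i \<bullet> x0 j) *\<^sub>R \<zeta> j k + (dphi r (x0 i \<bullet> x0 j) * (x0 i \<bullet> \<zeta> j k)) *\<^sub>R x0 j)
         + (- (r * phi r (x0 i \<bullet> x0 j) * (x0 i \<bullet> \<zeta> j k))) *\<^sub>R x0 j))"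

text \<open>The two groups of coefficients take the roles of \<open>a\<close> and \<open>a'\<close>;
  the bounds on \<open>phi\<close> and \<open>dphi\<close> make both at most
  \<open>2 * b\<^sup>2 * C / n\<close>, so the second moment is bounded independently of
  \<open>n\<close> and \<open>r\<close>.\<close>

lemma rdpg_second_moment_quadratic_noise:
  fixes x0 :: "nat \<Rightarrow> real ^ 'd" and \<zeta> :: "nat \<Rightarrow> nat \<Rightarrow> real ^ 'd" and r \<delta> C b :: real
  assumes A: "is_rdpg M n r x0 A" and r: "0 \<le> r" "r \<le> 1" and \<delta>: "0 < \<delta>" and i: "i < n" and C: "0 \<le> C"
    and xx: "\<And>i j. x0 i \<bullet> x0 j \<in> {\<delta>..1 - \<delta>}" and x1: "\<And>j. norm (x0 j) \<le> 1"
    and \<zeta>: "\<And>j k. j < n \<Longrightarrow> k < n \<Longrightarrow> norm (\<zeta> j k) \<le> C / real n"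
  defines "b \<equiv> 1 / (\<delta> / 2)\<^sup>2"
  shows "(\<integral>w. (norm (quadratic_noise x0 r n \<zeta> (A w) i))\<^sup>2 \<partial>M) \<le> 76 * real CARD('d) * (2 * b\<^sup>2 * C)\<^sup>2"
  unfolding quadratic_noise_def
proof (rule rdpg_quadratic_second_moment_vec[OF A])
  have d0: "0 < \<delta> / 2" and xx2: "x0 i \<bullet> x0 j \<in> {\<delta> / 2..1 - \<delta> / 2}" for i j
    using \<delta> xx[of i j] by auto
  show "0 \<le> r * (x0 i \<bullet> x0 j)" "r * (x0 i \<bullet> x0 j) \<le> 1" for i j
    using r \<delta> xx[of i j] mult_mono[of r 1 "x0 i \<bullet> x0 j" 1] by auto
  have tb: "1 \<le> phi r (x0 i \<bullet> x0 j)" "phi r (x0 i \<bullet> x0 j) \<le> b" "\<bar>dphi r (x0 i \<bullet> x0 j)\<bar> \<le> b\<^sup>2" for j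
    using phi_bounds[OF r d0 xx2] abs_dphi_le[OF r d0 xx2] unfolding b_def by auto
  have b1: "1 \<le> b" "b \<le> b\<^sup>2" using tb(1,2)[of i] by (auto simp: power_increasing[of 1 2 b, simplified])
  fix j k assume jk: "j < n" "k < n"
  have xz: "\<bar>x0 i \<bullet> \<zeta> j k\<bar> \<le> 1 * (C / real n)" by (rule abs_inner_le[OF x1 \<zeta>[OF jk]])
  have Cn: "0 \<le> C / real n" using C by simp
  have bC: "b * (C / real n) \<le> b\<^sup>2 * (C / real n)" using b1 Cn by (intro mult_right_mono) auto
  have "norm (phi r (x0 i \<bullet> x0 j) *\<^sub>R \<zeta> j k) \<le> b * (C / real n)"
    unfolding norm_scaleR real_norm_def using tb[of j] b1 \<zeta>[OF jk] by (intro mult_mono) auto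
  moreover have "norm ((dphi r (x0 i \<bullet> x0 j) * (x0 i \<bullet> \<zeta> j k)) *\<^sub>R x0 j) \<le> (b\<^sup>2 * (1 * (C / real n))) * 1"
    unfolding norm_scaleR real_norm_def abs_mult using tb[of j] xz x1
    by (intro mult_mono) (auto intro!: mult_nonneg_nonneg Cn simp del: times_divide_eq_right)
  ultimately show "norm (phi r (x0 i \<bullet> x0 j) *\<^sub>R \<zeta> j k + (dphi r (x0 i \<bullet> x0 j) * (x0 i \<bullet> \<zeta> j k)) *\<^sub>R x0 j) \<le> 2 * b\<^sup>2 * C / real n"
  proof (intro norm_triangle_le)
    assume 1: "norm (phi r (x0 i \<bullet> x0 j) *\<^sub>R \<zeta> j k) \<le> b * (C / real n)"
      and 2: "norm ((dphi r (x0 i \<bullet> x0 j) * (x0 i \<bullet> \<zeta> j k)) *\<^sub>R x0 j) \<le> (b\<^sup>2 * (1 * (C / real n))) * 1"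
    have "2 * b\<^sup>2 * C / real n = b\<^sup>2 * (C / real n) + b\<^sup>2 * (C / real n)" by simp
    moreover have "x + y \<le> z" if "x \<le> u" "y \<le> v" "u \<le> v" "z = v + v" for x y z u v :: real
      using that by linarith
    ultimately show "norm (phi r (x0 i \<bullet> x0 j) *\<^sub>R \<zeta> j k) + norm ((dphi r (x0 i \<bullet> x0 j) * (x0 i \<bullet> \<zeta> j k)) *\<^sub>R x0 j) \<le> 2 * b\<^sup>2 * C / real n"
      using 1 2[unfolded mult_1_left mult_1_right] bC by blast
  qed
  have "norm ((- (r * phi r (x0 i \<bullet> x0 j) * (x0 i \<bullet> \<zeta> j k))) *\<^sub>R x0 j) \<le> ((1 * b) * (1 * (C / real n))) * 1"
    unfolding norm_scaleR real_norm_def abs_mult abs_minus_cancel using tb[of j] xz x1 r b1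
    by (intro mult_mono) (auto intro!: mult_nonneg_nonneg Cn simp del: times_divide_eq_right)
  also have "\<dots> \<le> b\<^sup>2 * (C / real n)" using bC by simp
  also have "\<dots> \<le> 2 * (b\<^sup>2 * (C / real n))"
    using mult_nonneg_nonneg[OF zero_le_power2[of b] Cn] by (simp only: mult_2 le_add_same_cancel1)
  finally show "norm ((- (r * phi r (x0 i \<bullet> x0 j) * (x0 i \<bullet> \<zeta> j k))) *\<^sub>R x0 j) \<le> 2 * b\<^sup>2 * C / real n"
    by simp
qed (use i C in auto)

text \<open>The exceptional set is contained in the remainder event, of probability at most
  \<open>p\<close>, together with \<open>CARD('d) + 2\<close> row-sum events of probability at most
  \<open>2 * CARD('d) / n\<close> each. Outside it the bound holds for all rows at once, with the
  quadratic form still present.\<close>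

lemma one_step_residual_event:
  fixes x0 :: "nat \<Rightarrow> real ^ 'd" and X Xh R :: "adj \<Rightarrow> nat \<Rightarrow> real ^ 'd" and \<zeta> :: "nat \<Rightarrow> nat \<Rightarrow> real ^ 'd"
    and W :: "adj \<Rightarrow> real ^ 'd ^ 'd" and r \<delta> c c1 c2 c3 s C p b K :: real
  assumes A: "is_rdpg M n r x0 A"
    and r: "0 < r" "r \<le> 1" and \<delta>: "0 < \<delta>" and c: "0 < c" "0 \<le> c3" "0 \<le> s" and n: "3 \<le> n" and C: "0 < C"
    and xx: "\<And>i j. x0 i \<bullet> x0 j \<in> {\<delta>..1 - \<delta>}" and x1: "\<And>j. norm (x0 j) \<le> 1"
    and coer: "\<And>v. c * (norm v)\<^sup>2 \<le> (1 / real n) * (\<Sum>j<n. (v \<bullet> x0 j)\<^sup>2)"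
    and W: "\<And>B. orthogonal_matrix (W B)"
    and \<zeta>: "\<And>j k. j < n \<Longrightarrow> k < n \<Longrightarrow> norm (\<zeta> j k) \<le> C / real n"
    and lin: "\<And>w j. w \<in> space M \<Longrightarrow> j < n \<Longrightarrow> transpose (W (A w)) *v X (A w) j - sqrt r *\<^sub>R x0 j
        = (1 / sqrt r) *\<^sub>R (\<Sum>k<n. noise r x0 (A w) j k *\<^sub>R \<zeta> j k) + R (A w) j"
    and step: "\<And>w. w \<in> space M \<Longrightarrow> is_one_step n (A w) (X (A w)) (Xh (A w))"
    and R: "measure M {w \<in> space M. c3\<^sup>2 * r * s\<^sup>2 < (\<Sum>j<n. (norm (R (A w) j))\<^sup>2)} \<le> p"
    and s: "1 \<le> real n * s\<^sup>2" "sqrt (real n * ln (real n)) \<le> real n * (r * s)"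
  defines "b \<equiv> 1 / (\<delta> / 2)\<^sup>2"
  defines "c1 \<equiv> 4 * real CARD('d) * C" and "c2 \<equiv> 4 * real CARD('d) * b\<^sup>2"
  assumes small: "6 * ((c1 + c3) * s) \<le> \<delta>" "4 * ((c1 + c3) * s)\<^sup>2 \<le> c"
  defines "K \<equiv> (4 / c) * (1 + 3 * b\<^sup>2 * c3 + real CARD('d) * (c1 + c3) * c2 + 6 * b\<^sup>2 * (c1 + c3) * c2 / c + 26 * b ^ 3 * (c1 + c3)\<^sup>2)"
  shows "measure M {w \<in> space M. \<exists>i<n. K * (s\<^sup>2 + norm (quadratic_noise x0 r n \<zeta> (A w) i) / (real n * r))
        < sqrt r * norm (one_step_residual x0 r n (W (A w)) (A w) (Xh (A w)) i)}
     \<le> p + 2 * real CARD('d) * (2 + real CARD('d)) / real n"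
proof -
  interpret prob_space M by (rule is_rdpgD(1)[OF A])
  have d0: "0 < \<delta> / 2" and xx2: "x0 i \<bullet> x0 j \<in> {\<delta> / 2..1 - \<delta> / 2}" for i j
    using \<delta> xx[of i j] by auto
  have r0: "0 \<le> r" using r by simp
  have tb: "1 \<le> phi r (x0 i \<bullet> x0 j)" "phi r (x0 i \<bullet> x0 j) \<le> b" "\<bar>dphi r (x0 i \<bullet> x0 j)\<bar> \<le> b\<^sup>2" for i j
    using phi_bounds[OF r0 r(2) d0 xx2] abs_dphi_le[OF r0 r(2) d0 xx2] unfolding b_def by auto
  have b1: "1 \<le> b" "b \<le> b\<^sup>2" "0 < b\<^sup>2" using tb(1,2)[of 0 0] by (auto simp: power_increasing[of 1 2 b, simplified])
  have rp: "0 \<le> r * (x0 i \<bullet> x0 j)" "r * (x0 i \<bullet> x0 j) \<le> 1" for i j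
    using r \<delta> xx[of i j] mult_mono[of r 1 "x0 i \<bullet> x0 j" 1] by auto
  define S where "S = sqrt (real n * ln (real n))"
  let ?d = "real CARD('d)"
  define E1 where "E1 = {w \<in> space M. \<exists>j<n. 4 * ?d * (C / real n) * S < norm (\<Sum>k<n. noise r x0 (A w) j k *\<^sub>R \<zeta> j k)}"
  define E2 where "E2 l = {w \<in> space M. \<exists>i<n. 4 * ?d * b\<^sup>2 * S < norm (\<Sum>j<n. noise r x0 (A w) i j *\<^sub>R ((dphi r (x0 i \<bullet> x0 j) * x0 j $ l) *\<^sub>R x0 j))}" for l
  define E3 where "E3 = {w \<in> space M. \<exists>i<n. 4 * ?d * b\<^sup>2 * S < norm (\<Sum>j<n. noise r x0 (A w) i j *\<^sub>R (phi r (x0 i \<bullet> x0 j) *\<^sub>R x0 j))}"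
  define E4 where "E4 = {w \<in> space M. c3\<^sup>2 * r * s\<^sup>2 < (\<Sum>j<n. (norm (R (A w) j))\<^sup>2)}"
  have sets: "E1 \<in> sets M" "E2 l \<in> sets M" "E3 \<in> sets M" "E4 \<in> sets M" for l
    unfolding E1_def E2_def E3_def E4_def
    by (rule rdpg_sets[OF A, of "\<lambda>B. \<exists>j<n. 4 * ?d * (C / real n) * S < norm (\<Sum>k<n. noise r x0 B j k *\<^sub>R \<zeta> j k)"],
        rule rdpg_sets[OF A, of "\<lambda>B. \<exists>i<n. 4 * ?d * b\<^sup>2 * S < norm (\<Sum>j<n. noise r x0 B i j *\<^sub>R ((dphi r (x0 i \<bullet> x0 j) * x0 j $ l) *\<^sub>R x0 j))"],
        rule rdpg_sets[OF A, of "\<lambda>B. \<exists>i<n. 4 * ?d * b\<^sup>2 * S < norm (\<Sum>j<n. noise r x0 B i j *\<^sub>R (phi r (x0 i \<bullet> x0 j) *\<^sub>R x0 j))"],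
        rule rdpg_sets[OF A, of "\<lambda>B. c3\<^sup>2 * r * s\<^sup>2 < (\<Sum>j<n. (norm (R B j))\<^sup>2)"])
  have Cn: "0 < C / real n" using C n by simp
  have m1: "measure M E1 \<le> 2 * ?d / real n"
    unfolding E1_def S_def by (rule rdpg_row_sums[OF A rp n Cn \<zeta>])
  have m2: "measure M (E2 l) \<le> 2 * ?d / real n" for l
    unfolding E2_def S_def
  proof (rule rdpg_row_sums[OF A rp n b1(3)])
    fix i j
    have "\<bar>dphi r (x0 i \<bullet> x0 j)\<bar> * \<bar>x0 j $ l\<bar> * norm (x0 j) \<le> b\<^sup>2 * 1 * 1"
      using tb[of i j] x1[of j] order.trans[OF component_le_norm_cart x1[of j]] b1 by (intro mult_mono) auto
    then show "norm ((dphi r (x0 i \<bullet> x0 j) * x0 j $ l) *\<^sub>R x0 j) \<le> b\<^sup>2" by (simp add: abs_mult)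
  qed
  have m3: "measure M E3 \<le> 2 * ?d / real n"
    unfolding E3_def S_def
  proof (rule rdpg_row_sums[OF A rp n b1(3)])
    fix i j
    have "\<bar>phi r (x0 i \<bullet> x0 j)\<bar> * norm (x0 j) \<le> b * 1"
      using tb[of i j] x1[of j] b1 by (intro mult_mono) auto
    then show "norm (phi r (x0 i \<bullet> x0 j) *\<^sub>R x0 j) \<le> b\<^sup>2" using b1 by simp
  qed
  \<comment> \<open>The factor \<open>r\<close> is needed for the sums weighted by \<zeta>, which
    are later divided by \<open>r\<close>; the sums in \<open>E2\<close> and \<open>E3\<close> use
    the weaker bound \<open>S \<le> n * s\<close>.\<close>
  have S1: "S \<le> real n * (r * s)" using s(2) unfolding S_def .
  have "r * s \<le> 1 * s" using r c by (intro mult_right_mono) auto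
  then have "real n * (r * s) \<le> real n * s" by (intro mult_left_mono) auto
  then have S2: "S \<le> real n * s" using S1 by linarith
  have c12: "0 \<le> c1" "0 \<le> c2" using C by (auto simp: c1_def c2_def)
  have sub: "{w \<in> space M. \<exists>i<n. K * (s\<^sup>2 + norm (quadratic_noise x0 r n \<zeta> (A w) i) / (real n * r))
        < sqrt r * norm (one_step_residual x0 r n (W (A w)) (A w) (Xh (A w)) i)}
     \<subseteq> E4 \<union> (E1 \<union> (E3 \<union> (\<Union>l\<in>UNIV. E2 l)))"
  proof (rule subsetI, rule ccontr)
    fix w assume "w \<in> {w \<in> space M. \<exists>i<n. K * (s\<^sup>2 + norm (quadratic_noise x0 r n \<zeta> (A w) i) / (real n * r))
        < sqrt r * norm (one_step_residual x0 r n (W (A w)) (A w) (Xh (A w)) i)}"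
    then obtain i where w: "w \<in> space M" and i: "i < n" and *: "K * (s\<^sup>2 + norm (quadratic_noise x0 r n \<zeta> (A w) i) / (real n * r))
        < sqrt r * norm (one_step_residual x0 r n (W (A w)) (A w) (Xh (A w)) i)" by (elim CollectE conjE exE)
    assume "w \<notin> E4 \<union> (E1 \<union> (E3 \<union> (\<Union>l\<in>UNIV. E2 l)))"
    then have nE: "w \<notin> E4" "w \<notin> E1" "w \<notin> E3" "w \<notin> E2 l" for l by auto
    have "sqrt r * norm (one_step_residual x0 r n (W (A w)) (A w) (Xh (A w)) i)
       \<le> K * (s\<^sup>2 + norm (quadratic_noise x0 r n \<zeta> (A w) i) / (real n * r))"
      unfolding one_step_residual_def quadratic_noise_def K_def b_def
    proof (rule one_step_remainder[OF r \<delta> c(1) c12 c(2,3) i xx x1 coer _ W lin[OF w] step[OF w]])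
      show "\<bar>noise r x0 (A w) i j\<bar> \<le> 1" for j by (rule abs_noise_le[OF A rp w])
      show "norm (\<Sum>k<n. noise r x0 (A w) j k *\<^sub>R \<zeta> j k) \<le> c1 * r * s" if j: "j < n" for j
      proof -
        have "norm (\<Sum>k<n. noise r x0 (A w) j k *\<^sub>R \<zeta> j k) \<le> 4 * ?d * (C / real n) * S"
          using nE(2) w j unfolding E1_def mem_Collect_eq by (meson not_le_imp_less)
        also have "\<dots> \<le> 4 * ?d * (C / real n) * (real n * (r * s))" using S1 C by (intro mult_left_mono) auto
        also have "\<dots> = c1 * r * s" using n by (simp add: c1_def)
        finally show ?thesis .
      qed
      have le: "4 * ?d * b\<^sup>2 * S \<le> c2 * real n * s"
        using mult_left_mono[OF S2, of "4 * ?d * b\<^sup>2"] by (simp add: c2_def mult_ac)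
      show "norm (\<Sum>j<n. noise r x0 (A w) i j *\<^sub>R ((dphi r (x0 i \<bullet> x0 j) * x0 j $ l) *\<^sub>R x0 j)) \<le> c2 * real n * s" for l
      proof (rule order.trans[OF _ le])
        show "norm (\<Sum>j<n. noise r x0 (A w) i j *\<^sub>R ((dphi r (x0 i \<bullet> x0 j) * x0 j $ l) *\<^sub>R x0 j)) \<le> 4 * ?d * b\<^sup>2 * S"
          using nE(4)[of l] w i unfolding E2_def mem_Collect_eq by (meson not_le_imp_less)
      qed
      show "norm (\<Sum>j<n. noise r x0 (A w) i j *\<^sub>R (phi r (x0 i \<bullet> x0 j) *\<^sub>R x0 j)) \<le> c2 * real n * s"
      proof (rule order.trans[OF _ le])
        show "norm (\<Sum>j<n. noise r x0 (A w) i j *\<^sub>R (phi r (x0 i \<bullet> x0 j) *\<^sub>R x0 j)) \<le> 4 * ?d * b\<^sup>2 * S"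
          using nE(3) w i unfolding E3_def mem_Collect_eq by (meson not_le_imp_less)
      qed
      show "(\<Sum>j<n. (norm (R (A w) j))\<^sup>2) \<le> c3\<^sup>2 * r * s\<^sup>2"
        using nE(1) w unfolding E4_def by (simp add: not_less)
    qed (use s small in auto)
    with * show False by linarith
  qed
  have "measure M {w \<in> space M. \<exists>i<n. K * (s\<^sup>2 + norm (quadratic_noise x0 r n \<zeta> (A w) i) / (real n * r))
        < sqrt r * norm (one_step_residual x0 r n (W (A w)) (A w) (Xh (A w)) i)}
     \<le> measure M (E4 \<union> (E1 \<union> (E3 \<union> (\<Union>l\<in>UNIV. E2 l))))"
    by (rule finite_measure_mono[OF sub]) (intro sets.Un sets.finite_UN finite sets)
  also have "\<dots> \<le> measure M E4 + (measure M E1 + (measure M E3 + measure M (\<Union>l\<in>UNIV. E2 l)))"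
    by (intro order.trans[OF measure_Un_le] add_left_mono sets.Un sets.finite_UN finite sets order_refl)
  also have "measure M (\<Union>l\<in>UNIV. E2 l) \<le> (\<Sum>l\<in>UNIV. measure M (E2 l))"
    by (rule measure_UNION_le[OF finite sets(2)])
  also have "\<dots> \<le> (\<Sum>l\<in>(UNIV :: 'd set). 2 * ?d / real n)" by (intro sum_mono m2)
  also have "\<dots> = ?d * (2 * ?d / real n)" by simp
  also have "measure M E4 + (measure M E1 + (measure M E3 + ?d * (2 * ?d / real n)))
      \<le> p + (2 * ?d / real n + (2 * ?d / real n + ?d * (2 * ?d / real n)))"
    using R m1 m3 unfolding E4_def by (intro add_mono) auto
  also have "\<dots> = p + 2 * ?d * (2 + ?d) / real n" by (simp add: add_divide_distrib algebra_simps)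
  finally show ?thesis by simp
qed

section \<open>Markov's inequality, logarithmic rates and the asymptotic statement\<close>

lemma rdpg_markov:
  fixes h :: "adj \<Rightarrow> real"
  assumes A: "is_rdpg M n r x0 A" and m: "(\<integral>w. h (A w) \<partial>M) \<le> m" and h: "\<And>w. 0 \<le> h (A w)" and t: "0 < t"
  shows "measure M {w \<in> space M. t \<le> h (A w)} \<le> m / t"
proof -
  have "measure M {w \<in> space M. t \<le> h (A w)} \<le> (\<integral>w. h (A w) \<partial>M) / t"
    using rdpg_integrable[OF A, of h] h t by (intro integral_Markov_inequality_measure[where A="{}"]) auto
  also have "\<dots> \<le> m / t" using m t by (intro divide_right_mono) auto
  finally show ?thesis .
qed

text \<open>This serves the dense regime. A bound for the power \<open>2 * a\<close> of the
  logarithm, linear in \<open>n\<close>, gives after a square root a bound for the power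
  \<open>a\<close> of order \<open>sqrt n\<close>.\<close>

lemma ln_powr_div_tendsto_0:
  assumes "0 < a"
  shows "(\<lambda>n. ln (real n) powr a / real n) \<longlonglongrightarrow> 0"
proof -
  let ?D = "sqrt ((2 * a) powr (2 * a))"
  have "(\<lambda>n. ?D / sqrt (real n)) \<longlonglongrightarrow> 0"
    by (intro tendsto_divide_0[OF tendsto_const] filterlim_at_top_imp_at_infinity
        filterlim_compose[OF sqrt_at_top filterlim_real_sequentially])
  moreover have "\<forall>\<^sub>F n in sequentially. norm (ln (real n) powr a / real n) \<le> ?D / sqrt (real n)"
    using eventually_ge_at_top[of 2]
  proof eventually_elim
    case (elim n)
    have "(ln (real n) powr a)\<^sup>2 = ln (real n) powr (2 * a)" using elim by (simp add: powr_powr mult.commute flip: powr_numeral)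
    also have "\<dots> \<le> (2 * a) powr (2 * a) * real n" using elim assms by (intro ln_powr_bound2) auto
    finally have "ln (real n) powr a \<le> sqrt ((2 * a) powr (2 * a) * real n)" by (rule real_le_rsqrt)
    then have "ln (real n) powr a / real n \<le> ?D * sqrt (real n) / real n"
      by (intro divide_right_mono) (auto simp: real_sqrt_mult)
    also have "?D * sqrt (real n) / real n = ?D / sqrt (real n)"
      by (subst frac_eq_eq) (use elim in auto)
    finally show ?case by simp
  qed
  ultimately show ?thesis by (rule Lim_null_comparison[rotated])
qed

theorem theorem4:
  fixes x0 :: "nat \<Rightarrow> real ^ 'd"
    and \<rho> :: "nat \<Rightarrow> real"
    and F :: "(real ^ 'd) measure"
    and K :: "(real ^ 'd) set"
    and \<delta> \<omega> :: real
    and M :: "nat \<Rightarrow> 'w measure"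
    and A :: "nat \<Rightarrow> 'w \<Rightarrow> nat \<Rightarrow> nat \<Rightarrow> real"
    and Xt Xh :: "nat \<Rightarrow> (nat \<Rightarrow> nat \<Rightarrow> real) \<Rightarrow> nat \<Rightarrow> real ^ 'd"
  assumes x0_latent: "\<And>i. x0 i \<in> latent_space"
    and rho: "\<And>n. 0 < \<rho> n \<and> \<rho> n \<le> 1"
    and rdpg: "\<And>n. is_rdpg (M n) n (\<rho> n) x0 (A n)"
    and F_prob: "prob_space F" "sets F = sets borel" "measure F latent_space = 1"
    and Delta: "invertible (second_moment F)"
    and F_conv: "(\<lambda>n. SUP x\<in>latent_space. \<bar>empirical_cdf x0 n x - measure F {..x}\<bar>)
                   \<longlonglongrightarrow> 0"
    and delta: "0 < \<delta>" "\<delta> < 1 / 2"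
    and K: "compact K" "convex K" "K \<subseteq> latent_space"
           "\<And>x u. x \<in> K \<Longrightarrow> u \<in> K \<Longrightarrow> x \<bullet> u \<in> {\<delta>..1 - \<delta>}"
    and x0_K: "\<And>i. x0 i \<in> K"
    and omega: "0 \<le> \<omega>"
    and lin: "approx_linearization M A \<rho> x0 \<omega> Xt"
    and one_step: "\<And>n w. w \<in> space (M n) \<Longrightarrow>
                     is_one_step n (A n w) (Xt n (A n w)) (Xh n (A n w))"
    and regime: "(\<forall>n. \<rho> n = 1) \<or>
                 (\<rho> \<longlonglongrightarrow> 0 \<and>
                  (\<lambda>n. ln (real n) powr (2 * max 1 \<omega>) / (real n * \<rho> n ^ 5)) \<longlonglongrightarrow> 0)"
  shows "\<exists>(W :: nat \<Rightarrow> (nat \<Rightarrow> nat \<Rightarrow> real) \<Rightarrow> real ^ 'd ^ 'd)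
           (R :: nat \<Rightarrow> (nat \<Rightarrow> nat \<Rightarrow> real) \<Rightarrow> nat \<Rightarrow> real ^ 'd).
          (\<forall>n B. orthogonal_matrix (W n B)) \<and>
          (\<forall>n. \<forall>w\<in>space (M n). \<forall>i<n.
             transpose (W n (A n w)) *v Xh n (A n w) i - sqrt (\<rho> n) *\<^sub>R x0 i
               = (1 / (real n * sqrt (\<rho> n))) *\<^sub>R
                   (\<Sum>j<n. ((A n w i j - \<rho> n * (x0 i \<bullet> x0 j))
                             / ((x0 i \<bullet> x0 j) * (1 - \<rho> n * (x0 i \<bullet> x0 j)))) *\<^sub>R
                           (matrix_inv (G_mat x0 (\<rho> n) n (x0 i)) *v x0 j))
                 + R n (A n w) i) \<and>
          bounded_in_prob_rows M (\<lambda>n w i. norm (R n (A n w) i))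
            (\<lambda>n. (1 / real n) * \<rho> n powr (- 5 / 2) * ln (real n) powr (max 1 \<omega>)) \<and>
          bounded_in_prob M (\<lambda>n w. \<Sum>i<n. (norm (R n (A n w) i))\<^sup>2)
            (\<lambda>n. (1 / (real n * \<rho> n ^ 5)) * ln (real n) powr (2 * max 1 \<omega>))"
proof -
  obtain W :: "nat \<Rightarrow> adj \<Rightarrow> real ^ 'd ^ 'd" and R :: "nat \<Rightarrow> adj \<Rightarrow> nat \<Rightarrow> real ^ 'd"
      and \<zeta> :: "nat \<Rightarrow> nat \<Rightarrow> nat \<Rightarrow> real ^ 'd" and C :: real
    where W: "\<forall>n B. orthogonal_matrix (W n B)"
      and C: "0 < C" and \<zeta>: "\<forall>n. \<forall>i<n. \<forall>j<n. norm (\<zeta> n i j) \<le> C / real n"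
      and linear: "\<forall>n. \<forall>w\<in>space (M n). \<forall>i<n.
           transpose (W n (A n w)) *v Xt n (A n w) i - sqrt (\<rho> n) *\<^sub>R x0 i
             = (1 / sqrt (\<rho> n)) *\<^sub>R (\<Sum>j<n. (A n w i j - \<rho> n * (x0 i \<bullet> x0 j)) *\<^sub>R \<zeta> n i j) + R n (A n w) i"
      and R: "bounded_in_prob M (\<lambda>n w. \<Sum>i<n. (norm (R n (A n w) i))\<^sup>2) (\<lambda>n. (1 / (real n * \<rho> n)) * ln (real n) powr \<omega>)"
    using lin unfolding approx_linearization_def by (elim exE conjE) (rule that)
  have \<zeta>: "norm (\<zeta> n i j) \<le> C / real n" if "i < n" "j < n" for n i j using \<zeta> that by blast
  have W: "orthogonal_matrix (W n B)" for n B using W by blast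
  have linear: "transpose (W n (A n w)) *v Xt n (A n w) i - sqrt (\<rho> n) *\<^sub>R x0 i
      = (1 / sqrt (\<rho> n)) *\<^sub>R (\<Sum>j<n. noise (\<rho> n) x0 (A n w) i j *\<^sub>R \<zeta> n i j) + R n (A n w) i"
    if "w \<in> space (M n)" "i < n" for n w i
    using linear[rule_format, OF that] unfolding noise_def .
  have xx: "x0 i \<bullet> x0 j \<in> {\<delta>..1 - \<delta>}" for i j by (intro K(4) x0_K)
  have x1: "norm (x0 j) \<le> 1" for j using x0_latent[of j] by (simp add: latent_space_def)
  have \<rho>: "0 < \<rho> n" "\<rho> n \<le> 1" "0 \<le> \<rho> n" for n using rho[of n] by auto
  obtain c where c: "0 < c" and coer: "\<forall>\<^sub>F n in sequentially. \<forall>v. c * (norm v)\<^sup>2 \<le> (1 / real n) * (\<Sum>j<n. (v \<bullet> x0 j)\<^sup>2)"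
    using gram_coercive[OF F_prob Delta F_conv x0_latent] by blast
  define b where "b = 1 / (\<delta> / 2)\<^sup>2"
  define CQ where "CQ = 76 * real CARD('d) * (2 * b\<^sup>2 * C)\<^sup>2"
  have CQ: "0 < CQ" using C delta by (simp add: CQ_def b_def)
  \<comment> \<open>The exponent has two sources: Hoeffding's inequality contributes a factor
    \<open>ln n\<close>, the remainder of the initial estimator a factor
    \<open>ln n powr \<omega>\<close>.\<close>
  define m where "m = max 1 \<omega>"
  have m: "1 \<le> m" "\<omega> \<le> m" by (auto simp: m_def)
  define L where "L n = ln (real n) powr m" for n
  \<comment> \<open>The order of the error before the division by \<open>sqrt (\<rho> n)\<close>.
    Its root \<open>s\<close> dominates both the noise part and the remainder part of the initial
    error.\<close>
  define q where "q n = L n / (real n * (\<rho> n)\<^sup>2)" for n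
  define s where "s n = sqrt (q n)" for n
  have L0: "0 \<le> L n" and q0: "0 \<le> q n" and s0: "0 \<le> s n" and s2: "(s n)\<^sup>2 = q n" for n
    by (auto simp: L_def q_def s_def)
  have ln1: "1 \<le> ln (real n)" if "3 \<le> n" for n
  proof -
    have "exp (1::real) \<le> real n" using exp_le that by linarith
    then show ?thesis using that by (subst ln_ge_iff) auto
  qed
  have L: "1 \<le> L n" "ln (real n) \<le> L n" "ln (real n) powr \<omega> \<le> L n" if n: "3 \<le> n" for n
    using ln1[OF n] m powr_mono[of 1 m "ln (real n)"] powr_mono[of \<omega> m "ln (real n)"]
    unfolding L_def by auto
  \<comment> \<open>The first bound absorbs the quadratic form, once it is of order one, into
    \<open>q\<close>; the second is the condition \<open>1 \<le> n * s\<^sup>2\<close> of the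
    Cauchy-Schwarz step.\<close>
  have qbig: "1 / (real n * \<rho> n) \<le> q n" "1 \<le> real n * q n" if n: "3 \<le> n" for n
  proof -
    have 1: "(\<rho> n)\<^sup>2 \<le> \<rho> n" using mult_left_mono[OF \<rho>(2,3), of n] by (simp add: power2_eq_square)
    then have "1 * (\<rho> n)\<^sup>2 \<le> L n * \<rho> n" using L(1)[OF n] \<rho>[of n] by (intro mult_mono) auto
    then show "1 / (real n * \<rho> n) \<le> q n"
      using n \<rho>[of n] by (simp add: q_def divide_simps power2_eq_square)
    have "(\<rho> n)\<^sup>2 \<le> L n" using 1 \<rho>(2)[of n] L(1)[OF n] by linarith
    then show "1 \<le> real n * q n" using n \<rho>[of n] by (simp add: q_def le_divide_eq)
  qed
  \<comment> \<open>Because \<open>\<rho> n \<le> 1 \<le> L n\<close> for \<open>n \<ge> 3\<close>,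
    \<open>q n\<close> lies below the quantity that vanishes in either regime. Smallness of
    \<open>s\<close> is what keeps the perturbed inner products in range and the perturbed Gram
    matrix coercive.\<close>
  have slim: "s \<longlonglongrightarrow> 0"
  proof -
    have "(\<lambda>n. ln (real n) powr (2 * m) / (real n * \<rho> n ^ 5)) \<longlonglongrightarrow> 0"
      using regime ln_powr_div_tendsto_0[of "2 * m"] m unfolding m_def by auto
    moreover have "\<forall>\<^sub>F n in sequentially. norm (q n) \<le> ln (real n) powr (2 * m) / (real n * \<rho> n ^ 5)"
      using eventually_ge_at_top[of 3]
    proof eventually_elim
      case (elim n)
      have "L n * 1 \<le> L n * L n" using L(1)[OF elim] by (intro mult_left_mono) auto
      also have "\<dots> = ln (real n) powr (2 * m)" by (simp add: L_def flip: powr_add)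
      finally have "L n \<le> ln (real n) powr (2 * m)" by simp
      moreover have "\<rho> n ^ 5 \<le> (\<rho> n)\<^sup>2" using \<rho>[of n] by (intro power_decreasing) auto
      ultimately have "q n \<le> ln (real n) powr (2 * m) / (real n * \<rho> n ^ 5)"
        unfolding q_def using elim \<rho>[of n] L0 by (intro frac_le mult_left_mono) auto
      then show ?case using q0 by simp
    qed
    ultimately have "q \<longlonglongrightarrow> 0" by (rule Lim_null_comparison[rotated])
    then show ?thesis using tendsto_real_sqrt[of q 0] by (simp add: s_def[abs_def])
  qed
  have sbig: "sqrt (real n * ln (real n)) \<le> real n * (\<rho> n * s n)" if n: "3 \<le> n" for n
  proof (rule real_le_lsqrt)
    have "real n * ln (real n) \<le> real n * L n" using L(2)[OF n] by (intro mult_left_mono) auto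
    also have "\<dots> = (real n * (\<rho> n * s n))\<^sup>2"
      using n \<rho>[of n] by (simp only: power_mult_distrib s2) (simp add: q_def power2_eq_square)
    finally show "real n * ln (real n) \<le> (real n * (\<rho> n * s n))\<^sup>2" .
  qed (use n ln1[OF n] \<rho>[of n] s0[of n] in auto)
  \<comment> \<open>The alignment of the initial estimator is reused. Taking the residual itself as
    remainder makes the expansion an identity for every outcome, also where the one-step formula is
    undefined.\<close>
  define Rh where "Rh n B = one_step_residual x0 (\<rho> n) n (W n B) B (Xh n B)" for n B
  define Q where "Q n = quadratic_noise x0 (\<rho> n) n (\<zeta> n)" for n
  have Qm: "(\<integral>w. (norm (Q n (A n w) i))\<^sup>2 \<partial>M n) \<le> CQ" if "i < n" for n i
    unfolding Q_def CQ_def b_def using C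
    by (intro rdpg_second_moment_quadratic_noise[OF rdpg \<rho>(3,2) delta(1) that _ xx x1 \<zeta>]) auto
  \<comment> \<open>Since \<open>Q\<close> stays inside the bound, one event serves both
    conclusions; they differ only in how Markov's inequality is then applied to
    \<open>Q\<close>.\<close>
  define Bad where "Bad k n = {w \<in> space (M n). \<exists>i<n. k * (q n + norm (Q n (A n w) i) / (real n * \<rho> n))
      < sqrt (\<rho> n) * norm (Rh n (A n w) i)}" for k n
  have Bad_sets: "Bad k n \<in> sets (M n)" for k n
    unfolding Bad_def by (rule rdpg_sets[OF rdpg, of n "\<lambda>B. \<exists>i<n. k * (q n + norm (Q n B i) / (real n * \<rho> n)) < sqrt (\<rho> n) * norm (Rh n B i)"])
  have key: "\<exists>k>0. \<forall>\<^sub>F n in sequentially. measure (M n) (Bad k n) \<le> \<epsilon>" if \<epsilon>: "0 < \<epsilon>" for \<epsilon>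
  proof -
    obtain C1 where C1: "0 < C1" and ev: "\<forall>\<^sub>F n in sequentially. measure (M n) {w \<in> space (M n).
        \<bar>\<Sum>i<n. (norm (R n (A n w) i))\<^sup>2\<bar> > C1 * ((1 / (real n * \<rho> n)) * ln (real n) powr \<omega>)} \<le> \<epsilon> / 2"
      using R \<epsilon> unfolding bounded_in_prob_def by (meson half_gt_zero)
    define c1 where "c1 = 4 * real CARD('d) * C"
    define c2 where "c2 = 4 * real CARD('d) * b\<^sup>2"
    \<comment> \<open>Chosen so that \<open>c3\<^sup>2 * \<rho> n * (s n)\<^sup>2\<close> equals
      \<open>C1 * L n / (n * \<rho> n)\<close>, which dominates the threshold \<open>C1\<close>
      times the rate of the linearization remainder for \<open>n \<ge> 3\<close>.\<close>
    define c3 where "c3 = sqrt C1"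
    define k where "k = (4 / c) * (1 + 3 * b\<^sup>2 * c3 + real CARD('d) * (c1 + c3) * c2 + 6 * b\<^sup>2 * (c1 + c3) * c2 / c + 26 * b ^ 3 * (c1 + c3)\<^sup>2)"
    have pos: "0 \<le> b" "0 \<le> c1" "0 \<le> c2" "0 \<le> c3" using C C1 by (auto simp: b_def c1_def c2_def c3_def)
    have "0 \<le> 3 * b\<^sup>2 * c3 + real CARD('d) * (c1 + c3) * c2 + 6 * b\<^sup>2 * (c1 + c3) * c2 / c + 26 * b ^ 3 * (c1 + c3)\<^sup>2"
      using pos c by simp
    then have k: "0 < k" using c unfolding k_def by (intro mult_pos_pos) auto
    have lim6: "(\<lambda>n. 6 * ((c1 + c3) * s n)) \<longlonglongrightarrow> 6 * ((c1 + c3) * 0)"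
      and lim4: "(\<lambda>n. 4 * ((c1 + c3) * s n)\<^sup>2) \<longlonglongrightarrow> 4 * ((c1 + c3) * 0)\<^sup>2"
      by (intro tendsto_intros slim)+
    have small: "\<forall>\<^sub>F n in sequentially. 6 * ((c1 + c3) * s n) < \<delta>" "\<forall>\<^sub>F n in sequentially. 4 * ((c1 + c3) * s n)\<^sup>2 < c"
      by (rule order_tendstoD(2)[OF lim6], use delta(1) in simp)
         (rule order_tendstoD(2)[OF lim4], use c in simp)
    have "(\<lambda>n. 2 * real CARD('d) * (2 + real CARD('d)) / real n) \<longlonglongrightarrow> 0" by (rule lim_const_over_n)
    then have tail: "\<forall>\<^sub>F n in sequentially. 2 * real CARD('d) * (2 + real CARD('d)) / real n < \<epsilon> / 2"
      using \<epsilon> by (intro order_tendstoD(2)) auto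
    have "\<forall>\<^sub>F n in sequentially. measure (M n) (Bad k n) \<le> \<epsilon>"
      using ev small tail coer eventually_ge_at_top[of 3]
    proof eventually_elim
      case (elim n)
      interpret prob_space "M n" by (rule is_rdpgD(1)[OF rdpg])
      have "{w \<in> space (M n). c3\<^sup>2 * \<rho> n * (s n)\<^sup>2 < (\<Sum>j<n. (norm (R n (A n w) j))\<^sup>2)}
        \<subseteq> {w \<in> space (M n). \<bar>\<Sum>i<n. (norm (R n (A n w) i))\<^sup>2\<bar> > C1 * ((1 / (real n * \<rho> n)) * ln (real n) powr \<omega>)}"
      proof (rule Collect_mono, intro impI, elim conjE, intro conjI)
        fix w assume "c3\<^sup>2 * \<rho> n * (s n)\<^sup>2 < (\<Sum>j<n. (norm (R n (A n w) j))\<^sup>2)"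
        moreover have "C1 * ((1 / (real n * \<rho> n)) * ln (real n) powr \<omega>) \<le> C1 * ((1 / (real n * \<rho> n)) * L n)"
          using C1 \<rho>[of n] L(3)[OF elim(6)] by (intro mult_left_mono) auto
        moreover have "C1 * ((1 / (real n * \<rho> n)) * L n) = c3\<^sup>2 * \<rho> n * (s n)\<^sup>2"
          using C1 \<rho>[of n] by (simp only: s2) (simp add: c3_def q_def power2_eq_square)
        ultimately show "\<bar>\<Sum>i<n. (norm (R n (A n w) i))\<^sup>2\<bar> > C1 * ((1 / (real n * \<rho> n)) * ln (real n) powr \<omega>)"
          by linarith
      qed
      then have tailR: "measure (M n) {w \<in> space (M n). c3\<^sup>2 * \<rho> n * (s n)\<^sup>2 < (\<Sum>j<n. (norm (R n (A n w) j))\<^sup>2)} \<le> \<epsilon> / 2"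
        by (rule order.trans[OF finite_measure_mono elim(1)])
           (rule rdpg_sets[OF rdpg, of n "\<lambda>B. C1 * ((1 / (real n * \<rho> n)) * ln (real n) powr \<omega>) < \<bar>\<Sum>i<n. (norm (R n B i))\<^sup>2\<bar>"])
      have "measure (M n) (Bad k n) \<le> \<epsilon> / 2 + 2 * real CARD('d) * (2 + real CARD('d)) / real n"
        unfolding Bad_def Rh_def Q_def k_def b_def c1_def c2_def s2[symmetric]
      proof (rule one_step_residual_event[where X="Xt n" and R="R n" and \<zeta>="\<zeta> n" and \<delta>=\<delta> and C=C and c=c,
            OF rdpg \<rho>(1,2) delta(1) c pos(4) s0 elim(6) C xx x1])
        show "c * (norm v)\<^sup>2 \<le> (1 / real n) * (\<Sum>j<n. (v \<bullet> x0 j)\<^sup>2)" for v using elim(5) by blast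
        show "6 * ((4 * real CARD('d) * C + c3) * s n) \<le> \<delta>" "4 * ((4 * real CARD('d) * C + c3) * s n)\<^sup>2 \<le> c"
          using elim(2,3) by (simp_all add: c1_def)
        show "1 \<le> real n * (s n)\<^sup>2" unfolding s2 by (rule qbig(2)[OF elim(6)])
        show "orthogonal_matrix (W n B)" for B by (rule W)
      qed (fact tailR \<zeta> linear one_step sbig[OF elim(6)])+
      also have "\<dots> \<le> \<epsilon>" using elim(4) by linarith
      finally show ?case .
    qed
    with k show ?thesis by blast
  qed
  have good: "sqrt (\<rho> n) * norm (Rh n (A n w) i) \<le> k * (q n + norm (Q n (A n w) i) / (real n * \<rho> n))"
    if "w \<in> space (M n)" "w \<notin> Bad k n" "i < n" for n w i k
  proof (rule ccontr)
    assume "\<not> ?thesis"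
    then have "w \<in> Bad k n" unfolding Bad_def using that(1,3) by (intro CollectI conjI exI[of _ i]) simp_all
    with that(2) show False by (rule notE)
  qed
  show ?thesis
  proof (intro exI[of _ W] exI[of _ Rh] conjI allI ballI impI)
    show "orthogonal_matrix (W n B)" for n B by (rule W)
    fix n w i
    show "transpose (W n (A n w)) *v Xh n (A n w) i - sqrt (\<rho> n) *\<^sub>R x0 i
               = (1 / (real n * sqrt (\<rho> n))) *\<^sub>R
                   (\<Sum>j<n. ((A n w i j - \<rho> n * (x0 i \<bullet> x0 j))
                             / ((x0 i \<bullet> x0 j) * (1 - \<rho> n * (x0 i \<bullet> x0 j)))) *\<^sub>R
                           (matrix_inv (G_mat x0 (\<rho> n) n (x0 i)) *v x0 j))
                 + Rh n (A n w) i"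
      unfolding Rh_def one_step_residual_def noise_def by simp
  next
    show "bounded_in_prob_rows M (\<lambda>n w i. norm (Rh n (A n w) i))
            (\<lambda>n. (1 / real n) * \<rho> n powr (- 5 / 2) * ln (real n) powr (max 1 \<omega>))"
      unfolding bounded_in_prob_rows_def
    proof (intro allI impI)
      fix \<epsilon> :: real assume \<epsilon>: "0 < \<epsilon>"
      then obtain k where k: "0 < k" "\<forall>\<^sub>F n in sequentially. measure (M n) (Bad k n) \<le> \<epsilon> / 2"
        using key[of "\<epsilon> / 2"] by auto
      \<comment> \<open>Markov's inequality for the squared norm of one \<open>Q n (A n w) i\<close>
        at level \<open>D\<^sup>2\<close> costs \<open>\<epsilon> / 2\<close>. As \<open>CQ\<close>
        does not depend on \<open>i\<close>, the resulting constant is the same for all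
        rows.\<close>
      define D where "D = sqrt (2 * CQ / \<epsilon>)"
      have D: "0 < D" "CQ / D\<^sup>2 = \<epsilon> / 2" using CQ \<epsilon> by (auto simp: D_def)
      have "\<forall>\<^sub>F n in sequentially. \<forall>i<n. measure (M n) {w \<in> space (M n).
           \<bar>norm (Rh n (A n w) i)\<bar> > (k * (1 + D)) * ((1 / real n) * \<rho> n powr (- 5 / 2) * ln (real n) powr (max 1 \<omega>))} \<le> \<epsilon>"
        using k(2) eventually_ge_at_top[of 3]
      proof (eventually_elim, intro allI impI)
        fix n i :: nat assume Bn: "measure (M n) (Bad k n) \<le> \<epsilon> / 2" and n: "3 \<le> n" and i: "i < n"
        interpret prob_space "M n" by (rule is_rdpgD(1)[OF rdpg])
        let ?E = "{w \<in> space (M n). D\<^sup>2 \<le> (norm (Q n (A n w) i))\<^sup>2}"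
        have rate: "(1 / real n) * \<rho> n powr (- 5 / 2) * ln (real n) powr (max 1 \<omega>) = q n / sqrt (\<rho> n)"
        proof -
          have "\<rho> n powr (5 / 2) = \<rho> n powr (2 + 1 / 2)" by simp
          also have "\<dots> = (\<rho> n)\<^sup>2 * sqrt (\<rho> n)" using \<rho>[of n] by (subst powr_add) (simp add: powr_half_sqrt)
          finally have "\<rho> n powr (- 5 / 2) = 1 / ((\<rho> n)\<^sup>2 * sqrt (\<rho> n))" by (simp add: powr_minus_divide)
          then show ?thesis by (simp add: q_def L_def m_def)
        qed
        have "{w \<in> space (M n). \<bar>norm (Rh n (A n w) i)\<bar> > (k * (1 + D)) * ((1 / real n) * \<rho> n powr (- 5 / 2) * ln (real n) powr (max 1 \<omega>))}
          \<subseteq> Bad k n \<union> ?E"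
        proof (rule subsetI, rule ccontr)
          fix w assume "w \<in> {w \<in> space (M n). \<bar>norm (Rh n (A n w) i)\<bar> > (k * (1 + D)) * ((1 / real n) * \<rho> n powr (- 5 / 2) * ln (real n) powr (max 1 \<omega>))}"
          then have w: "w \<in> space (M n)" and *: "(k * (1 + D)) * (q n / sqrt (\<rho> n)) < norm (Rh n (A n w) i)"
            unfolding rate by auto
          assume "w \<notin> Bad k n \<union> ?E"
          then have nB: "w \<notin> Bad k n" and "(norm (Q n (A n w) i))\<^sup>2 < D\<^sup>2" using w by auto
          then have "norm (Q n (A n w) i) \<le> D" using D(1) by (simp add: power_less_imp_less_base less_imp_le)
          then have "norm (Q n (A n w) i) / (real n * \<rho> n) \<le> D * (1 / (real n * \<rho> n))"
            using \<rho>[of n] by (simp add: divide_right_mono)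
          also have "\<dots> \<le> D * q n" using D(1) qbig(1)[OF n] by (intro mult_left_mono) auto
          finally have "k * (q n + norm (Q n (A n w) i) / (real n * \<rho> n)) \<le> k * (q n + D * q n)"
            using k(1) by (intro mult_left_mono) auto
          with good[OF w nB i] have "sqrt (\<rho> n) * norm (Rh n (A n w) i) \<le> (k * (1 + D)) * q n"
            by (simp add: algebra_simps)
          then have "norm (Rh n (A n w) i) \<le> (k * (1 + D)) * (q n / sqrt (\<rho> n))"
            using \<rho>[of n] by (simp add: le_divide_eq mult.commute)
          with * show False by simp
        qed
        moreover have E: "?E \<in> sets (M n)"
          by (rule rdpg_sets[OF rdpg, of n "\<lambda>B. D\<^sup>2 \<le> (norm (Q n B i))\<^sup>2"])
        ultimately have "measure (M n) {w \<in> space (M n). \<bar>norm (Rh n (A n w) i)\<bar> > (k * (1 + D)) * ((1 / real n) * \<rho> n powr (- 5 / 2) * ln (real n) powr (max 1 \<omega>))}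
          \<le> measure (M n) (Bad k n \<union> ?E)"
          by (intro finite_measure_mono sets.Un Bad_sets)
        also have "\<dots> \<le> measure (M n) (Bad k n) + measure (M n) ?E"
          by (intro measure_Un_le Bad_sets E)
        also have "measure (M n) ?E \<le> CQ / D\<^sup>2"
          using D(1) by (intro rdpg_markov[OF rdpg Qm[OF i]]) auto
        finally show "measure (M n) {w \<in> space (M n). \<bar>norm (Rh n (A n w) i)\<bar> > (k * (1 + D)) * ((1 / real n) * \<rho> n powr (- 5 / 2) * ln (real n) powr (max 1 \<omega>))} \<le> \<epsilon>"
          using Bn D(2) by linarith
      qed
      then show "\<exists>C>0. \<forall>\<^sub>F n in sequentially. \<forall>i<n. measure (M n) {w \<in> space (M n).
           \<bar>norm (Rh n (A n w) i)\<bar> > C * ((1 / real n) * \<rho> n powr (- 5 / 2) * ln (real n) powr (max 1 \<omega>))} \<le> \<epsilon>"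
        using k(1) D(1) by (intro exI[of _ "k * (1 + D)"] conjI) auto
    qed
    show "bounded_in_prob M (\<lambda>n w. \<Sum>i<n. (norm (Rh n (A n w) i))\<^sup>2)
            (\<lambda>n. (1 / (real n * \<rho> n ^ 5)) * ln (real n) powr (2 * max 1 \<omega>))"
      unfolding bounded_in_prob_def
    proof (intro allI impI)
      fix \<epsilon> :: real assume \<epsilon>: "0 < \<epsilon>"
      then obtain k where k: "0 < k" "\<forall>\<^sub>F n in sequentially. measure (M n) (Bad k n) \<le> \<epsilon> / 2"
        using key[of "\<epsilon> / 2"] by auto
      \<comment> \<open>Here Markov's inequality is applied to the sum of squares over all rows, of
        mean at most \<open>n * CQ\<close>, at level \<open>D * n\<close>; simultaneous control of
        the single \<open>Q\<close> terms is avoided.\<close>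
      define D where "D = 2 * CQ / \<epsilon>"
      have D: "0 < D" "CQ / D = \<epsilon> / 2" using CQ \<epsilon> by (auto simp: D_def)
      \<comment> \<open>The factor 2 comes from
        \<open>(x + y)\<^sup>2 \<le> 2 * x\<^sup>2 + 2 * y\<^sup>2\<close>; summing over the rows,
        the first term gives 1 and the second \<open>D\<close>, each times
        \<open>n * (q n)\<^sup>2\<close>.\<close>
      define C' where "C' = 2 * k\<^sup>2 * (1 + D)"
      have C': "0 < C'" using k D by (simp add: C'_def)
      have "\<forall>\<^sub>F n in sequentially. measure (M n) {w \<in> space (M n).
           \<bar>\<Sum>i<n. (norm (Rh n (A n w) i))\<^sup>2\<bar> > C' * ((1 / (real n * \<rho> n ^ 5)) * ln (real n) powr (2 * max 1 \<omega>))} \<le> \<epsilon>"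
        using k(2) eventually_ge_at_top[of 3]
      proof eventually_elim
        case (elim n)
        then have n: "3 \<le> n" and Bn: "measure (M n) (Bad k n) \<le> \<epsilon> / 2" by auto
        interpret prob_space "M n" by (rule is_rdpgD(1)[OF rdpg])
        let ?E = "{w \<in> space (M n). D * real n \<le> (\<Sum>i<n. (norm (Q n (A n w) i))\<^sup>2)}"
        have rate: "(1 / (real n * \<rho> n ^ 5)) * ln (real n) powr (2 * max 1 \<omega>) = real n * (q n)\<^sup>2 / \<rho> n"
        proof -
          have "ln (real n) powr (2 * max 1 \<omega>) = (L n)\<^sup>2"
            by (simp add: L_def m_def power2_eq_square flip: powr_add)
          then show ?thesis using n \<rho>[of n] by (simp add: q_def power_divide power_mult_distrib divide_simps) (simp add: eval_nat_numeral)
        qed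
        have "{w \<in> space (M n). \<bar>\<Sum>i<n. (norm (Rh n (A n w) i))\<^sup>2\<bar> > C' * ((1 / (real n * \<rho> n ^ 5)) * ln (real n) powr (2 * max 1 \<omega>))}
          \<subseteq> Bad k n \<union> ?E"
        proof (rule subsetI, rule ccontr)
          fix w assume "w \<in> {w \<in> space (M n). \<bar>\<Sum>i<n. (norm (Rh n (A n w) i))\<^sup>2\<bar> > C' * ((1 / (real n * \<rho> n ^ 5)) * ln (real n) powr (2 * max 1 \<omega>))}"
          then have w: "w \<in> space (M n)" and *: "C' * (real n * (q n)\<^sup>2 / \<rho> n) < (\<Sum>i<n. (norm (Rh n (A n w) i))\<^sup>2)"
            unfolding rate by (auto simp: sum_nonneg)
          assume "w \<notin> Bad k n \<union> ?E"
          then have nB: "w \<notin> Bad k n" and SQ: "(\<Sum>i<n. (norm (Q n (A n w) i))\<^sup>2) \<le> D * real n" using w by auto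
          have "\<rho> n * (norm (Rh n (A n w) i))\<^sup>2 \<le> 2 * k\<^sup>2 * ((q n)\<^sup>2 + (q n)\<^sup>2 * (norm (Q n (A n w) i))\<^sup>2)" if i: "i < n" for i
          proof -
            have "norm (Q n (A n w) i) * (1 / (real n * \<rho> n)) \<le> norm (Q n (A n w) i) * q n"
              using qbig(1)[OF n] by (intro mult_left_mono) auto
            then have "k * (q n + norm (Q n (A n w) i) / (real n * \<rho> n)) \<le> k * (q n + norm (Q n (A n w) i) * q n)"
              using k(1) by (intro mult_left_mono) auto
            with good[OF w nB i] have "sqrt (\<rho> n) * norm (Rh n (A n w) i) \<le> k * (q n + norm (Q n (A n w) i) * q n)" by linarith
            then have "(sqrt (\<rho> n) * norm (Rh n (A n w) i))\<^sup>2 \<le> (k * (q n + norm (Q n (A n w) i) * q n))\<^sup>2"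
              using \<rho>[of n] by (intro power_mono) auto
            also have "\<dots> = k\<^sup>2 * (q n + norm (Q n (A n w) i) * q n)\<^sup>2" by (simp add: power_mult_distrib)
            also have "\<dots> \<le> k\<^sup>2 * (2 * (q n)\<^sup>2 + 2 * (norm (Q n (A n w) i) * q n)\<^sup>2)"
              using zero_le_power2[of "q n - norm (Q n (A n w) i) * q n"]
              by (intro mult_left_mono) (auto simp: power2_eq_square algebra_simps)
            finally show ?thesis using \<rho>[of n] by (simp add: power_mult_distrib algebra_simps)
          qed
          then have "(\<Sum>i<n. \<rho> n * (norm (Rh n (A n w) i))\<^sup>2) \<le> (\<Sum>i<n. 2 * k\<^sup>2 * ((q n)\<^sup>2 + (q n)\<^sup>2 * (norm (Q n (A n w) i))\<^sup>2))"
            by (intro sum_mono) auto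
          also have "\<dots> = 2 * k\<^sup>2 * (real n * (q n)\<^sup>2 + (q n)\<^sup>2 * (\<Sum>i<n. (norm (Q n (A n w) i))\<^sup>2))"
            by (simp add: sum.distrib flip: sum_distrib_left)
          also have "\<dots> \<le> 2 * k\<^sup>2 * (real n * (q n)\<^sup>2 + (q n)\<^sup>2 * (D * real n))"
            using SQ by (intro mult_left_mono add_left_mono) auto
          also have "\<dots> = C' * (real n * (q n)\<^sup>2)" by (simp add: C'_def algebra_simps)
          finally have "\<rho> n * (\<Sum>i<n. (norm (Rh n (A n w) i))\<^sup>2) \<le> C' * (real n * (q n)\<^sup>2)"
            by (simp only: sum_distrib_left)
          then have "(\<Sum>i<n. (norm (Rh n (A n w) i))\<^sup>2) \<le> C' * (real n * (q n)\<^sup>2 / \<rho> n)"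
            using \<rho>[of n] by (simp add: le_divide_eq mult.commute)
          with * show False by simp
        qed
        moreover have E: "?E \<in> sets (M n)"
          by (rule rdpg_sets[OF rdpg, of n "\<lambda>B. D * real n \<le> (\<Sum>i<n. (norm (Q n B i))\<^sup>2)"])
        ultimately have "measure (M n) {w \<in> space (M n). \<bar>\<Sum>i<n. (norm (Rh n (A n w) i))\<^sup>2\<bar> > C' * ((1 / (real n * \<rho> n ^ 5)) * ln (real n) powr (2 * max 1 \<omega>))}
          \<le> measure (M n) (Bad k n \<union> ?E)"
          by (intro finite_measure_mono sets.Un Bad_sets)
        also have "\<dots> \<le> measure (M n) (Bad k n) + measure (M n) ?E"
          by (intro measure_Un_le Bad_sets E)
        also have "measure (M n) ?E \<le> (real n * CQ) / (D * real n)"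
        proof (rule rdpg_markov[OF rdpg])
          have "(\<integral>w. (\<Sum>i<n. (norm (Q n (A n w) i))\<^sup>2) \<partial>M n) = (\<Sum>i<n. \<integral>w. (norm (Q n (A n w) i))\<^sup>2 \<partial>M n)"
            by (rule Bochner_Integration.integral_sum) (rule rdpg_integrable[OF rdpg, of n "\<lambda>B. (norm (Q n B _))\<^sup>2"])
          also have "\<dots> \<le> (\<Sum>i<n. CQ)" using Qm by (intro sum_mono) auto
          finally show "(\<integral>w. (\<Sum>i<n. (norm (Q n (A n w) i))\<^sup>2) \<partial>M n) \<le> real n * CQ" by simp
        qed (use D n in \<open>auto simp: sum_nonneg\<close>)
        also have "(real n * CQ) / (D * real n) = CQ / D" using n by simp
        finally show ?case using Bn D(2) by linarith
      qed
      with C' show "\<exists>C>0. \<forall>\<^sub>F n in sequentially. measure (M n) {w \<in> space (M n).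
           \<bar>\<Sum>i<n. (norm (Rh n (A n w) i))\<^sup>2\<bar> > C * ((1 / (real n * \<rho> n ^ 5)) * ln (real n) powr (2 * max 1 \<omega>))} \<le> \<epsilon>"
        by blast
    qed
  qed
qed

end
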